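(* There is an algorithm which, given a graph $G$ with $n$ vertices that contains no odd hole, reports that $G$ contains no line graph of a bipartite subdivision of $K_4$ if this is the case, and otherwise outputs an induced subgraph of $G$ that is the line graph of a bipartite subdivision of $K_4$ and has the minimum number of vertices among all such induced subgraphs; the algorithm runs in time $O(n^{20})$.
   Context: Graphs are finite, simple, undirected. "Contains" refers to induced subgraphs. A hole is a chordless cycle with at least 4 vertices. A subdivision of $K_4$ is a graph obtained from $K_4$ by replacing edges by internally disjoint paths of length at least 1; it is a bipartite subdivision if the resulting graph is bipartite. The line graph $L(R)$ of $R$ has vertex set $E(R)$, two vertices being adjacent if and only if the corresponding edges share an end. Time is worst-case number of elementary operations, up to a multiplicative constant. *)

theory Defs
  imports Complex_Main "HOL-Library.Landau_Symbols"
begin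

section \<open>Graphs\<close>

record 'a graph =
  verts :: "'a set"
  edges :: "'a set set"

definition simple_graph :: "'a graph \<Rightarrow> bool" where
  "simple_graph G \<longleftrightarrow> finite (verts G) \<and> (\<forall>e \<in> edges G. e \<subseteq> verts G \<and> card e = 2)"

definition induced :: "'a graph \<Rightarrow> 'a set \<Rightarrow> 'a graph" where
  "induced G X = \<lparr>verts = X, edges = {e \<in> edges G. e \<subseteq> X}\<rparr>"

definition graph_iso :: "'a graph \<Rightarrow> 'b graph \<Rightarrow> bool" where
  "graph_iso G H \<longleftrightarrow> (\<exists>f. bij_betw f (verts G) (verts H) \<and>
     (\<forall>u \<in> verts G. \<forall>v \<in> verts G. {u, v} \<in> edges G \<longleftrightarrow> {f u, f v} \<in> edges H))"

text \<open>A cycle is given by the list of its vertices in cyclic order.\<close>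

definition cycle_in :: "'a graph \<Rightarrow> 'a list \<Rightarrow> bool" where
  "cycle_in G c \<longleftrightarrow> length c \<ge> 3 \<and> distinct c \<and> set c \<subseteq> verts G \<and>
     (\<forall>i < length c. {c ! i, c ! (Suc i mod length c)} \<in> edges G)"

definition chordless :: "'a graph \<Rightarrow> 'a list \<Rightarrow> bool" where
  "chordless G c \<longleftrightarrow> (\<forall>i < length c. \<forall>j < length c. {c ! i, c ! j} \<in> edges G \<longrightarrow>
     j = Suc i mod length c \<or> i = Suc j mod length c)"

definition hole :: "'a graph \<Rightarrow> 'a list \<Rightarrow> bool" where
  "hole G c \<longleftrightarrow> cycle_in G c \<and> chordless G c \<and> length c \<ge> 4"

definition contains_odd_hole :: "'a graph \<Rightarrow> bool" where
  "contains_odd_hole G \<longleftrightarrow> (\<exists>c. hole G c \<and> odd (length c))"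

definition bipartite :: "'a graph \<Rightarrow> bool" where
  "bipartite G \<longleftrightarrow> (\<exists>A B. A \<union> B = verts G \<and> A \<inter> B = {} \<and>
     (\<forall>e \<in> edges G. \<exists>a \<in> A. \<exists>b \<in> B. e = {a, b}))"

definition complete_graph :: "nat \<Rightarrow> nat graph" where
  "complete_graph k = \<lparr>verts = {..<k}, edges = {e. e \<subseteq> {..<k} \<and> card e = 2}\<rparr>"

text \<open>A path is given by the list of its vertices; its inner vertices are all but the two ends.\<close>

definition path_edges :: "'a list \<Rightarrow> 'a set set" where
  "path_edges p = {{p ! i, p ! Suc i} | i. Suc i < length p}"

definition inner_verts :: "'a list \<Rightarrow> 'a set" where
  "inner_verts p = set (butlast (tl p))"

text \<open>
  \<open>b\<close> places the vertices of \<open>H\<close> in \<open>R\<close>, and \<open>p e\<close> is the path that replaces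
  the edge \<open>e\<close>. A list with at least two vertices is a path of length at least 1.
\<close>

definition subdivision_of :: "'a graph \<Rightarrow> 'b graph \<Rightarrow> bool" where
  "subdivision_of H R \<longleftrightarrow> (\<exists>b p. inj_on b (verts H) \<and>
     (\<forall>e \<in> edges H. length (p e) \<ge> 2 \<and> distinct (p e) \<and>
        {hd (p e), last (p e)} = b ` e \<and> inner_verts (p e) \<inter> b ` verts H = {}) \<and>
     (\<forall>e \<in> edges H. \<forall>e' \<in> edges H. e \<noteq> e' \<longrightarrow> inner_verts (p e) \<inter> inner_verts (p e') = {}) \<and>
     verts R = b ` verts H \<union> (\<Union>e \<in> edges H. set (p e)) \<and>
     edges R = (\<Union>e \<in> edges H. path_edges (p e)))"

definition line_graph :: "'a graph \<Rightarrow> 'a set graph" where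
  "line_graph R = \<lparr>verts = edges R,
     edges = {{e, f} | e f. e \<in> edges R \<and> f \<in> edges R \<and> e \<noteq> f \<and> e \<inter> f \<noteq> {}}\<rparr>"

text \<open>
  Every finite graph has a copy with vertices in \<open>nat\<close>, so restricting \<open>R\<close> to that
  type loses nothing.
\<close>

definition is_line_graph_of_bip_subdiv_K4 :: "'a graph \<Rightarrow> bool" where
  "is_line_graph_of_bip_subdiv_K4 H \<longleftrightarrow>
     (\<exists>R :: nat graph. subdivision_of (complete_graph 4) R \<and> bipartite R \<and>
        graph_iso H (line_graph R))"


section \<open>Algorithms and elementary operations\<close>

text \<open>
  Algorithms are structured random-access programs. The memory consists of arrays, named by
  numbers, of natural numbers; a program mentions only finitely many arrays, and scalar
  variables are arrays used at index 0. The cost of a run counts every node of every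
  expression evaluated, every assignment and every test of a condition.

  Since arithmetic has unit cost, a bound \<open>W\<close> is imposed on the values that can be stored: a
  run that tries to store a larger value gets stuck. Requiring \<open>W\<close> to be polynomial in the
  number of vertices gives words of logarithmically many bits. Addresses and intermediate
  values are then polynomially bounded too, since a program contains finitely many expressions.
\<close>

type_synonym store = "nat \<Rightarrow> nat \<Rightarrow> nat"

datatype expr =
    Const nat
  | Read nat expr
  | Add expr expr
  | Sub expr expr
  | Mul expr expr

datatype prog =
    Skip
  | Write nat expr expr
  | Seq prog prog
  | If expr prog prog
  | While expr prog

fun val :: "expr \<Rightarrow> store \<Rightarrow> nat" where
  "val (Const k) s = k"
| "val (Read a i) s = s a (val i s)"
| "val (Add x y) s = val x s + val y s"
| "val (Sub x y) s = val x s - val y s"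
| "val (Mul x y) s = val x s * val y s"

fun cost :: "expr \<Rightarrow> nat" where
  "cost (Const k) = 1"
| "cost (Read a i) = 1 + cost i"
| "cost (Add x y) = 1 + cost x + cost y"
| "cost (Sub x y) = 1 + cost x + cost y"
| "cost (Mul x y) = 1 + cost x + cost y"

text \<open>
  \<open>exec W P s t s'\<close>: started in \<open>s\<close>, the program \<open>P\<close> stops in \<open>s'\<close> after \<open>t\<close>
  elementary operations, storing only values at most \<open>W\<close>. A condition holds if its value
  is nonzero; as subtraction is truncated, \<open>x < y\<close> is the condition \<open>Sub y x\<close>.
\<close>

inductive exec :: "nat \<Rightarrow> prog \<Rightarrow> store \<Rightarrow> nat \<Rightarrow> store \<Rightarrow> bool" for W :: nat where
  Skip: "exec W Skip s 1 s"
| Write: "val x s \<le> W \<Longrightarrow>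
    exec W (Write a i x) s (1 + cost i + cost x) (s(a := (s a)(val i s := val x s)))"
| Seq: "exec W P s t s' \<Longrightarrow> exec W Q s' t' s'' \<Longrightarrow> exec W (Seq P Q) s (t + t') s''"
| IfTrue: "val x s \<noteq> 0 \<Longrightarrow> exec W P s t s' \<Longrightarrow> exec W (If x P Q) s (1 + cost x + t) s'"
| IfFalse: "val x s = 0 \<Longrightarrow> exec W Q s t s' \<Longrightarrow> exec W (If x P Q) s (1 + cost x + t) s'"
| WhileFalse: "val x s = 0 \<Longrightarrow> exec W (While x P) s (1 + cost x) s"
| WhileTrue: "val x s \<noteq> 0 \<Longrightarrow> exec W P s t s' \<Longrightarrow> exec W (While x P) s' t' s'' \<Longrightarrow>
    exec W (While x P) s (1 + cost x + t + t') s''"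

text \<open>Programs are deterministic, so the existence of a run describes the only possible run.\<close>

inductive_cases exec_SkipE: "exec W Skip s t s'"
inductive_cases exec_WriteE: "exec W (Write a i x) s t s'"
inductive_cases exec_SeqE: "exec W (Seq P Q) s t s'"
inductive_cases exec_IfE: "exec W (If x P Q) s t s'"
inductive_cases exec_WhileE: "exec W (While x P) s t s'"

lemma exec_deterministic:
  "exec W P s t s' \<Longrightarrow> exec W P s u r \<Longrightarrow> u = t \<and> r = s'"
proof (induction arbitrary: u r rule: exec.induct)
  case (Skip s)
  then show ?case by (rule exec_SkipE) simp
next
  case (Write x s a i)
  from Write.prems show ?case by (rule exec_WriteE) simp
next
  case (Seq P s t s' Q t' s'')
  from Seq.prems show ?case by (rule exec_SeqE) (use Seq.IH in blast)
next
  case (IfTrue x s P t s' Q)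
  from IfTrue.prems show ?case by (rule exec_IfE) (use IfTrue.IH IfTrue.hyps(1) in fastforce)+
next
  case (IfFalse x s Q t s' P)
  from IfFalse.prems show ?case by (rule exec_IfE) (use IfFalse.IH IfFalse.hyps(1) in fastforce)+
next
  case (WhileFalse x s P)
  from WhileFalse.prems show ?case by (rule exec_WhileE) (simp_all add: WhileFalse.hyps)
next
  case (WhileTrue x s P t s' t' s'')
  from WhileTrue.prems show ?case by (rule exec_WhileE) (use WhileTrue.IH WhileTrue.hyps(1) in fastforce)+
qed

text \<open>
  The input is a graph with vertex set \<open>{..<n}\<close>: \<open>n\<close> in array 0, the adjacency matrix, row by
  row, in array 1, and 0 elsewhere. The answer is negative (\<open>None\<close>) if array 2 holds 0 at
  index 0, and is otherwise the set of vertices marked in array 3, standing for the subgraph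
  induced by that set.
\<close>

definition input :: "nat \<Rightarrow> nat graph \<Rightarrow> store" where
  "input n G = (\<lambda>a i.
     if a = 0 \<and> i = 0 then n
     else if a = 1 \<and> i < n * n \<and> {i div n, i mod n} \<in> edges G then 1
     else 0)"

definition answer :: "nat \<Rightarrow> store \<Rightarrow> nat set option" where
  "answer n s = (if s 2 0 = 0 then None else Some {v. v < n \<and> s 3 v \<noteq> 0})"

end

theory Submission
  imports Defs "HOL-Library.Nat_Bijection"
begin

text \<open>
  The line graph of a subdivision of $K_4$ consists of six induced paths that meet in four
  triangles. In a graph without odd holes it is automatically the line graph of a \<^emph>\<open>bipartite\<close>
  subdivision unless all six paths are single vertices, since an odd cycle of the subdivision
  would give an odd hole.

  Consider a smallest such structure. In each of its paths, the half between an end and the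
  middle vertex may be replaced by any walk of at most the same length whose inner vertices are
  not adjacent to the ends of the other five paths. Otherwise some vertex of the walk attaches to
  the other paths; choosing it suitably, one finds either a smaller structure or a pyramid,
  and the latter contains an odd hole. So it suffices to guess the 12 ends and the 6 middle
  vertices, to join them by breadth-first search, and to check whether the six paths obtained
  form a structure. A search takes time $O(n^3)$ and depends on the 12 ends only, and the check
  takes time $O(n^2)$, so that the total is $O(n^{12} n^3 + n^{18} n^2)$.
\<close>

section \<open>Induced paths and contacts\<close>

text \<open>The time bound shapes the argument. Loops over 18 guessed vertices leave a factor n^2
  for each guess, so no search may be repeated for each choice of middle vertices. A half path is
  therefore restricted only by a condition that the 12 ends determine: its inner vertices see no end
  of the other five paths. They might still see inner vertices of these paths, and excluding that is
  the combinatorial core (\<open>half_path_detached\<close>). The vertex to choose there is the last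
  offending one: what follows it up to the middle is harmless, so from it the middle and then either
  end of the path can be reached. Splitting at the middle makes both routes shorter than the path
  itself; minimality applies to each of them, and together they rule out contacts with all five
  paths. A replacement changes neither the ends nor the lengths nor the middle vertices, so the
  halves can be exchanged one after another, and any shortest path found by a search will do. A
  recorded candidate is certified by the check; the replacement argument only shows that some guess
  attains the minimum.\<close>

locale sym_rel =
  fixes E :: "'a \<Rightarrow> 'a \<Rightarrow> bool"
  assumes E_sym: "E u v \<Longrightarrow> E v u" and E_irrefl: "\<not> E u u"
begin

lemma E_commute: "E u v \<longleftrightarrow> E v u"
  using E_sym by blast

fun walk :: "'a list \<Rightarrow> bool" where
  "walk [] = False"
| "walk [x] = True"
| "walk (x # y # p) = (E x y \<and> walk (y # p))"

fun ipath :: "'a list \<Rightarrow> bool" where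
  "ipath [] = False"
| "ipath [x] = True"
| "ipath (x # y # p) = (x \<notin> set (y # p) \<and> E x y \<and> (\<forall>z \<in> set p. \<not> E x z) \<and> ipath (y # p))"

text \<open>Pairs of \<open>Z\<close> outside \<open>U \<times> W\<close> have no effect, which is
  why \<open>con_Un\<close> asks for inclusions before it merges two lists of contacts. Disjointness
  is included because every use needs it.\<close>

definition con :: "'a set \<Rightarrow> 'a set \<Rightarrow> ('a \<times> 'a) set \<Rightarrow> bool" where
  "con U W Z \<longleftrightarrow> U \<inter> W = {} \<and> (\<forall>u \<in> U. \<forall>w \<in> W. E u w \<longleftrightarrow> (u, w) \<in> Z)"

lemma conD: "con U W Z \<Longrightarrow> u \<in> U \<Longrightarrow> w \<in> W \<Longrightarrow> E u w \<longleftrightarrow> (u, w) \<in> Z"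
  unfolding con_def by blast

lemma con_swap: "con U W Z \<Longrightarrow> con W U (Z\<inverse>)"
proof -
  assume c: "con U W Z"
  have "E u w \<longleftrightarrow> (u, w) \<in> Z\<inverse>" if "u \<in> W" "w \<in> U" for u w
    using conD[OF c that(2,1)] by (simp add: E_commute)
  then show ?thesis using c by (simp add: con_def Int_commute)
qed

lemma con_swap0: "con U W {} \<Longrightarrow> con W U {}"
  using con_swap[of U W "{}"] by simp

lemma con_swap1: "con U W {(a, b)} \<Longrightarrow> con W U {(b, a)}"
proof -
  have "{(a, b)}\<inverse> = {(b, a)}" by auto
  then show "con U W {(a, b)} \<Longrightarrow> con W U {(b, a)}" using con_swap by metis
qed

lemma con_swap2: "con U W {(a, b), (c, d)} \<Longrightarrow> con W U {(b, a), (d, c)}"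
proof -
  have "{(a, b), (c, d)}\<inverse> = {(b, a), (d, c)}" by auto
  then show "con U W {(a, b), (c, d)} \<Longrightarrow> con W U {(b, a), (d, c)}" using con_swap by metis
qed

lemma con_Un:
  "con U W Y \<Longrightarrow> con U W' Z \<Longrightarrow> Y \<subseteq> U \<times> W \<Longrightarrow> Z \<subseteq> U \<times> W' \<Longrightarrow> W \<inter> W' = {} \<Longrightarrow>
    con U (W \<union> W') (Y \<union> Z)"
  unfolding con_def by blast

lemma con_sub: "con U W Z \<Longrightarrow> U' \<subseteq> U \<Longrightarrow> W' \<subseteq> W \<Longrightarrow> Z' \<inter> U' \<times> W' = Z \<inter> U' \<times> W' \<Longrightarrow> con U' W' Z'"
  unfolding con_def by blast

lemma con_disj: "con U W Z \<Longrightarrow> u \<in> U \<Longrightarrow> u \<notin> W"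
  unfolding con_def by blast

lemma walk_nonempty: "walk p \<Longrightarrow> p \<noteq> []"
  by auto

lemma ipath_nonempty: "ipath p \<Longrightarrow> p \<noteq> []"
  by auto

lemma walk_append:
  "p \<noteq> [] \<Longrightarrow> q \<noteq> [] \<Longrightarrow> walk (p @ q) \<longleftrightarrow> walk p \<and> walk q \<and> E (last p) (hd q)"
proof (induction p rule: walk.induct)
  case (2 x)
  then show ?case by (cases q) auto
qed auto

text \<open>Cutting an induced path anywhere gives two induced paths whose only contact is the edge
  at the cut. The structures below are assembled and taken apart with this equivalence.\<close>

lemma ipath_append:
  "p \<noteq> [] \<Longrightarrow> q \<noteq> [] \<Longrightarrow>
    ipath (p @ q) \<longleftrightarrow> ipath p \<and> ipath q \<and> con (set p) (set q) {(last p, hd q)}"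
proof (induction p rule: ipath.induct)
  case (2 x)
  then obtain y q' where q: "q = y # q'" by (cases q) auto
  show ?case
  proof (cases "ipath q")
    case True
    then have "distinct q" by (induction q rule: ipath.induct) auto
    then show ?thesis by (auto simp: q con_def)
  qed (simp add: q)
next
  case (3 x y p)
  \<comment> \<open>\<open>x\<close> differs from the last vertex of \<open>y # p\<close>, so
    prepending it cannot affect the one permitted contact with \<open>q\<close>; it only adds the
    demand that \<open>x\<close> sees nothing in \<open>q\<close>.\<close>
  have c: "con (insert x (set (y # p))) (set q) {(last (y # p), hd q)} \<longleftrightarrow>
      con (set (y # p)) (set q) {(last (y # p), hd q)} \<and> x \<notin> set q \<and> (\<forall>z \<in> set q. \<not> E x z)"
    if "x \<notin> set (y # p)"
  proof -
    have "x \<noteq> last (y # p)" using that by (metis last_in_set list.distinct(1))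
    then show ?thesis unfolding con_def by (simp del: last.simps) blast
  qed
  have "ipath ((y # p) @ q) \<longleftrightarrow> ipath (y # p) \<and> ipath q \<and> con (set (y # p)) (set q) {(last (y # p), hd q)}"
    using 3 by blast
  moreover have "ipath ((x # y # p) @ q) \<longleftrightarrow> x \<notin> set (y # p) \<and> x \<notin> set q \<and> E x y \<and> (\<forall>z \<in> set p. \<not> E x z) \<and>
      (\<forall>z \<in> set q. \<not> E x z) \<and> ipath ((y # p) @ q)" by auto
  moreover have "last (x # y # p) = last (y # p)" "set (x # y # p) = insert x (set (y # p))" by simp_all
  moreover have "ipath (x # y # p) \<longleftrightarrow> x \<notin> set (y # p) \<and> E x y \<and> (\<forall>z \<in> set p. \<not> E x z) \<and> ipath (y # p)" by simp
  ultimately show ?case using c by metis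
qed auto

lemma ipath_distinct: "ipath p \<Longrightarrow> distinct p"
  by (induction p rule: ipath.induct) auto

lemma ipath_walk: "ipath p \<Longrightarrow> walk p"
  by (induction p rule: ipath.induct) auto

lemma walk_rev: "walk p \<Longrightarrow> walk (rev p)"
proof (induction p rule: walk.induct)
  case (3 x y p)
  have "walk ((rev p @ [y]) @ [x])"
    by (subst walk_append) (use 3 E_commute in auto)
  then show ?case by simp
qed auto

lemma ipath_rev: "ipath p \<Longrightarrow> ipath (rev p)"
proof (induction p rule: ipath.induct)
  case (3 x y p)
  have "ipath ((rev p @ [y]) @ [x])"
    by (subst ipath_append) (use 3 E_commute ipath_distinct[of "y # p"] in \<open>auto simp: con_def\<close>)
  then show ?case by simp
qed auto

lemma ipath_rev_iff [simp]: "ipath (rev p) = ipath p"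
  using ipath_rev[of p] ipath_rev[of "rev p"] by auto

lemma walk_nth: "walk p \<longleftrightarrow> p \<noteq> [] \<and> (\<forall>i. Suc i < length p \<longrightarrow> E (p ! i) (p ! Suc i))"
proof (induction p rule: walk.induct)
  case (3 x y p)
  then show ?case by (auto simp: nth_Cons split: nat.splits)
qed auto

lemma ipath_nth:
  "ipath p \<longleftrightarrow> p \<noteq> [] \<and> distinct p \<and>
    (\<forall>i < length p. \<forall>j < length p. E (p ! i) (p ! j) \<longleftrightarrow> j = Suc i \<or> i = Suc j)"
proof (induction p rule: ipath.induct)
  case (2 x)
  then show ?case by (simp add: E_irrefl)
next
  case (3 x y p)
  have *: "(\<forall>i < length (x # y # p). \<forall>j < length (x # y # p). E ((x # y # p) ! i) ((x # y # p) ! j) \<longleftrightarrow> j = Suc i \<or> i = Suc j)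
    \<longleftrightarrow> (\<forall>j < length (y # p). E x ((y # p) ! j) \<longleftrightarrow> j = 0) \<and>
      (\<forall>i < length (y # p). \<forall>j < length (y # p). E ((y # p) ! i) ((y # p) ! j) \<longleftrightarrow> j = Suc i \<or> i = Suc j)"
    (is "?A \<longleftrightarrow> ?B \<and> ?C")
  proof
    assume A: ?A
    have ?B using A[rule_format, of 0 "Suc _"] by simp
    moreover have ?C using A[rule_format, of "Suc _" "Suc _"] by simp
    ultimately show "?B \<and> ?C" by blast
  next
    assume BC: "?B \<and> ?C"
    show ?A
    proof (intro allI impI)
      fix i j assume ij: "i < length (x # y # p)" "j < length (x # y # p)"
      show "E ((x # y # p) ! i) ((x # y # p) ! j) \<longleftrightarrow> j = Suc i \<or> i = Suc j"
      proof (cases i; cases j)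
        fix j' assume "i = 0" "j = Suc j'"
        then show ?thesis using BC ij by simp
      next
        fix i' assume "i = Suc i'" "j = 0"
        then show ?thesis using BC ij E_commute[of x] by simp
      next
        fix i' j' assume "i = Suc i'" "j = Suc j'"
        then show ?thesis using BC ij by simp
      qed (simp add: E_irrefl)
    qed
  qed
  have **: "(\<forall>j < length (y # p). E x ((y # p) ! j) \<longleftrightarrow> j = 0) \<longleftrightarrow> E x y \<and> (\<forall>z \<in> set p. \<not> E x z)"
    by (auto simp: all_set_conv_all_nth nth_Cons split: nat.splits)
  show ?case unfolding * ** using 3 by auto
qed auto

lemma hd_last_ends: "ipath p \<Longrightarrow> hd p = last p \<longleftrightarrow> length p = 1"
  using ipath_distinct[of p] by (cases p rule: walk.cases) auto

text \<open>A walk fails to be an induced path because its first vertex recurs, or has a chord, or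
  because the rest fails. In the first two cases the walk jumps ahead from its first vertex; the
  third is the induction.\<close>

lemma walk_shorten:
  assumes "walk w" "\<not> ipath w"
  shows "\<exists>q. walk q \<and> hd q = hd w \<and> last q = last w \<and> set q \<subseteq> set w \<and> length q < length w"
  using assms
proof (induction w rule: walk.induct)
  case (3 x y p)
  consider (a) "x \<in> set (y # p)" | (b) z where "z \<in> set p" "E x z" | (c) "\<not> ipath (y # p)"
    using 3 by auto
  then show ?case
  proof cases
    case a
    then obtain r t where rt: "y # p = r @ x # t" by (meson split_list)
    have "walk (y # p)" using "3.prems" by simp
    then have w: "walk (r @ x # t)" by (simp only: rt)
    have "walk (x # t)"
      using w by (cases "r = []") (auto simp: walk_append)
    moreover have "last (x # t) = last (x # y # p)" "set (x # t) \<subseteq> set (x # y # p)"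
       "length (x # t) < length (x # y # p)" using rt by (auto simp del: last.simps) (simp add: rt)
    ultimately show ?thesis by (metis list.sel(1))
  next
    case b
    then obtain r t where rt: "p = r @ z # t" by (meson split_list)
    have w: "walk ((y # r) @ z # t)" using "3.prems" rt by simp
    have "walk (x # z # t)"
      using w b by (auto simp: walk_append simp del: append_Cons)
    moreover have "last (x # z # t) = last (x # y # p)" "set (x # z # t) \<subseteq> set (x # y # p)"
       "length (x # z # t) < length (x # y # p)" using rt by auto
    ultimately show ?thesis by (metis list.sel(1))
  next
    case c
    then obtain q where q: "walk q" "hd q = y" "last q = last (y # p)" "set q \<subseteq> set (y # p)" "length q < length (y # p)"
      using 3 by auto
    then have "walk (x # q)" using 3 by (cases q) auto
    moreover have "last (x # q) = last (x # y # p)" "set (x # q) \<subseteq> set (x # y # p)"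
       "length (x # q) < length (x # y # p)" using q by (auto dest: walk_nonempty)
    ultimately show ?thesis by (metis list.sel(1))
  qed
qed auto

text \<open>The alternative between \<open>q = w\<close> and a strictly shorter path matters: where
  minimality forbids shortening, it yields that the walk itself was an induced path.\<close>

lemma walk_to_ipath:
  assumes "walk w"
  shows "\<exists>q. ipath q \<and> hd q = hd w \<and> last q = last w \<and> set q \<subseteq> set w \<and> (q = w \<or> length q < length w)"
  using assms
proof (induction "length w" arbitrary: w rule: less_induct)
  case less
  show ?case
  proof (cases "ipath w")
    case False
    then obtain q where q: "walk q" "hd q = hd w" "last q = last w" "set q \<subseteq> set w" "length q < length w"
      using walk_shorten less.prems by blast
    then obtain r where "ipath r \<and> hd r = hd q \<and> last r = last q \<and> set r \<subseteq> set q \<and> (r = q \<or> length r < length q)"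
      using less.hyps by blast
    with q show ?thesis by (intro exI[of _ r]) auto
  qed blast
qed

end

section \<open>Odd holes\<close>

text \<open>A hole is given by two induced paths glued at both ends, so that concatenation and
  reversal of lists replace indices modulo the length. If \<open>p\<close> is a single vertex, its
  two neighbours are the ends of \<open>q\<close>.\<close>

locale even_holes = sym_rel +
  assumes even_hole:
    "ipath p \<Longrightarrow> ipath q \<Longrightarrow> con (set p) (set q) {(last p, hd q), (hd p, last q)} \<Longrightarrow>
      4 \<le> length p + length q \<Longrightarrow> even (length p + length q)"
begin

text \<open>
  Two of the three induced paths from the triangle to the apex have the same parity, and
  together they form an odd hole.
\<close>

lemma no_pyramid:
  assumes w: "walk w1" "walk w2" "walk w3"
    and a: "E a (last w1)" "E a (last w2)" "E a (last w3)"
    and c12: "con (set w1) (set w2) {(hd w1, hd w2)}"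
    and c13: "con (set w1) (set w3) {(hd w1, hd w3)}"
    and c23: "con (set w2) (set w3) {(hd w2, hd w3)}"
    and na: "a \<notin> set w1" "a \<notin> set w2" "a \<notin> set w3"
    and t: "\<not> (E a (hd w1) \<and> E a (hd w2))" "\<not> (E a (hd w1) \<and> E a (hd w3))" "\<not> (E a (hd w2) \<and> E a (hd w3))"
  shows False
proof -
  \<comment> \<open>Each walk, extended by the apex \<open>a\<close>, contains an induced path to
    \<open>a\<close>; as \<open>a\<close> is not on the walk, it occurs only as the last
    vertex.\<close>
  have ex: "\<exists>q. ipath (q @ [a]) \<and> q \<noteq> [] \<and> hd q = hd w \<and> set q \<subseteq> set w"
    if "walk w" "E a (last w)" "a \<notin> set w" for w
  proof -
    have "walk (w @ [a])"
      using that by (subst walk_append) (auto simp: E_commute dest: walk_nonempty)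
    then obtain q where q: "ipath q" "hd q = hd (w @ [a])" "last q = a" "set q \<subseteq> set (w @ [a])"
      using walk_to_ipath[of "w @ [a]"] by auto
    obtain r where r: "q = r @ [a]"
      using q by (metis append_butlast_last_id ipath_nonempty)
    have "r \<noteq> []" using q(2) r that by (cases w) auto
    moreover have "a \<notin> set r" using q(1) ipath_distinct r by fastforce
    ultimately show ?thesis using q r that by (intro exI[of _ r]) (cases w; auto)
  qed
  \<comment> \<open>Two legs \<open>q\<close> and \<open>r\<close> of equal parity close up through
    \<open>a\<close> to a hole of odd length \<open>length q + length r + 1\<close>.\<close>
  have odd: False
    if q: "ipath (q @ [a])" "q \<noteq> []" "hd q = hd w" "set q \<subseteq> set w"
      and r: "ipath (r @ [a])" "r \<noteq> []" "hd r = hd v" "set r \<subseteq> set v"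
      and c: "con (set w) (set v) {(hd w, hd v)}" and na: "a \<notin> set w" "a \<notin> set v"
      and t: "\<not> (E a (hd w) \<and> E a (hd v))" and p: "even (length q + length r)" for q r w v
  proof -
    have qa: "ipath q" "con (set q) {a} {(last q, a)}"
      using q by (auto simp: ipath_append)
    have ra: "ipath r" "con (set r) {a} {(last r, a)}"
      using r by (auto simp: ipath_append)
    have E1: "E u a \<longleftrightarrow> u = last q" if "u \<in> set q" for u
      using conD[OF qa(2) that, of a] by auto
    have E2: "E u a \<longleftrightarrow> u = last r" if "u \<in> set r" for u
      using conD[OF ra(2) that, of a] by auto
    have E3: "E u v \<longleftrightarrow> u = hd q \<and> v = hd r" if "u \<in> set q" "v \<in> set r" for u v
      using conD[OF c, of u v] q r that by auto
    have "con (set (rev r)) (set (q @ [a])) {(last (rev r), hd (q @ [a])), (hd (rev r), last (q @ [a]))}"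
      unfolding con_def
    proof (intro conjI ballI)
      show "set (rev r) \<inter> set (q @ [a]) = {}"
        using q r c na by (auto simp: con_def)
      fix u v assume u: "u \<in> set (rev r)" and v: "v \<in> set (q @ [a])"
      have "u \<noteq> a" using u r na by auto
      have "a \<noteq> hd q" using q na by (metis hd_in_set subsetD)
      show "E u v \<longleftrightarrow> (u, v) \<in> {(last (rev r), hd (q @ [a])), (hd (rev r), last (q @ [a]))}"
        using u v q(2) r(2) E2[of u] E3[of v u] E_commute[of u v] \<open>u \<noteq> a\<close> \<open>a \<noteq> hd q\<close> na q(4)
        by (auto simp: hd_rev last_rev)
    qed
    \<comment> \<open>A cycle of length 3 would make both legs single vertices of the triangle, both
      adjacent to \<open>a\<close>, against \<open>t\<close>.\<close>
    moreover have "4 \<le> length (rev r) + length (q @ [a])"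
    proof (rule ccontr)
      assume "\<not> ?thesis"
      moreover have "length q \<ge> 1" "length r \<ge> 1" using q(2) r(2) by (simp_all add: Suc_le_eq)
      ultimately have "length q = 1" "length r = 1" unfolding length_append length_rev by simp_all
      then have "last q = hd q" "last r = hd r" by (simp_all add: hd_last_ends qa(1) ra(1) eq_commute[of "last _"])
      then have "E a (hd q)" "E a (hd r)"
        using E1[of "hd q"] E2[of "hd r"] q(2) r(2) E_commute by auto
      then show False using t q r by simp
    qed
    ultimately have "even (length (rev r) + length (q @ [a]))"
      using even_hole[of "rev r" "q @ [a]"] ra(1) q(1) by (simp only: ipath_rev_iff)
    then show False using p by simp
  qed
  obtain q1 where q1: "ipath (q1 @ [a])" "q1 \<noteq> []" "hd q1 = hd w1" "set q1 \<subseteq> set w1"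
    using ex[OF w(1) a(1) na(1)] by blast
  obtain q2 where q2: "ipath (q2 @ [a])" "q2 \<noteq> []" "hd q2 = hd w2" "set q2 \<subseteq> set w2"
    using ex[OF w(2) a(2) na(2)] by blast
  obtain q3 where q3: "ipath (q3 @ [a])" "q3 \<noteq> []" "hd q3 = hd w3" "set q3 \<subseteq> set w3"
    using ex[OF w(3) a(3) na(3)] by blast
  consider "even (length q1 + length q2)" | "even (length q1 + length q3)" | "even (length q2 + length q3)"
    by fastforce
  then show False
    using odd[OF q1 q2 c12 na(1,2) t(1)] odd[OF q1 q3 c13 na(1,3) t(2)] odd[OF q2 q3 c23 na(2,3) t(3)]
    by cases
qed

end

section \<open>Line graphs of subdivisions of $K_4$\<close>

definition K4_size :: "(nat \<Rightarrow> nat \<Rightarrow> 'b list) \<Rightarrow> nat" where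
  "K4_size R = length (R 0 1) + length (R 0 2) + length (R 0 3) +
     length (R 1 2) + length (R 1 3) + length (R 2 3)"

text \<open>The arguments are the paths 01, 02, 03, 12, 13, 23 in this order.\<close>

definition K4_of ::
  "'b list \<Rightarrow> 'b list \<Rightarrow> 'b list \<Rightarrow> 'b list \<Rightarrow> 'b list \<Rightarrow> 'b list \<Rightarrow> nat \<Rightarrow> nat \<Rightarrow> 'b list" where
  "K4_of a b c d e f i j =
    (if i = 0 then if j = 1 then a else if j = 2 then b else c
     else if i = 1 then if j = 0 then rev a else if j = 2 then d else e
     else if i = 2 then if j = 0 then rev b else if j = 1 then rev d else f
     else if j = 0 then rev c else if j = 1 then rev e else rev f)"

context sym_rel
begin

text \<open>
  \<open>R i j\<close> is the path of the line graph that comes from the subdivided edge \<open>ij\<close> of $K_4$,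
  traversed from \<open>i\<close> to \<open>j\<close>; the heads of \<open>R i j\<close>, for fixed \<open>i\<close>, form the triangle that comes
  from the branch vertex \<open>i\<close>. \<open>K4_size R = 6\<close> means that $K_4$ itself is not subdivided.
\<close>

definition K4_paths :: "(nat \<Rightarrow> nat \<Rightarrow> 'a list) \<Rightarrow> bool" where
  "K4_paths R \<longleftrightarrow>
    (\<forall>i<4. \<forall>j<4. i \<noteq> j \<longrightarrow> ipath (R i j) \<and> R j i = rev (R i j)) \<and>
    (\<forall>i<4. \<forall>j<4. \<forall>k<4. i \<noteq> j \<longrightarrow> i \<noteq> k \<longrightarrow> j \<noteq> k \<longrightarrow>
      con (set (R i j)) (set (R i k)) {(hd (R i j), hd (R i k))}) \<and>
    (\<forall>i<4. \<forall>j<4. \<forall>k<4. \<forall>l<4. distinct [i, j, k, l] \<longrightarrow> con (set (R i j)) (set (R k l)) {})"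

lemma perm_4_cases:
  assumes "i < 4" "j < 4" "k < 4" "l < 4" "distinct [i, j, k, l :: nat]"
  shows "(i, j, k, l) \<in> {(0, 1, 2, 3), (0, 1, 3, 2), (0, 2, 1, 3), (0, 2, 3, 1), (0, 3, 1, 2), (0, 3, 2, 1),
      (1, 0, 2, 3), (1, 0, 3, 2), (1, 2, 0, 3), (1, 2, 3, 0), (1, 3, 0, 2), (1, 3, 2, 0),
      (2, 0, 1, 3), (2, 0, 3, 1), (2, 1, 0, 3), (2, 1, 3, 0), (2, 3, 0, 1), (2, 3, 1, 0),
      (3, 0, 1, 2), (3, 0, 2, 1), (3, 1, 0, 2), (3, 1, 2, 0), (3, 2, 0, 1), (3, 2, 1, 0)}"
proof -
  have "i = 0 \<or> i = 1 \<or> i = 2 \<or> i = 3" "j = 0 \<or> j = 1 \<or> j = 2 \<or> j = 3"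
    "k = 0 \<or> k = 1 \<or> k = 2 \<or> k = 3" "l = 0 \<or> l = 1 \<or> l = 2 \<or> l = 3" using assms by linarith+
  with assms(5) show ?thesis by (elim disjE) simp_all
qed

lemma fourth_index:
  assumes "i < 4" "j < 4" "k < 4" "i \<noteq> j" "i \<noteq> k" "j \<noteq> (k :: nat)"
  obtains l where "l < 4" "distinct [i, j, k, l]"
proof -
  have "i = 0 \<or> i = 1 \<or> i = 2 \<or> i = 3" "j = 0 \<or> j = 1 \<or> j = 2 \<or> j = 3"
    "k = 0 \<or> k = 1 \<or> k = 2 \<or> k = 3" using assms by linarith+
  then have "l < 4 \<and> distinct [i, j, k, l]" if "l = 6 - (i + j + k)" for l
    using assms(4-) that by (elim disjE) simp_all
  then show ?thesis using that by blast
qed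

context
  fixes R assumes R: "K4_paths R"
begin

lemma K4_ipath: "i < 4 \<Longrightarrow> j < 4 \<Longrightarrow> i \<noteq> j \<Longrightarrow> ipath (R i j)"
  and K4_rev: "i < 4 \<Longrightarrow> j < 4 \<Longrightarrow> i \<noteq> j \<Longrightarrow> R j i = rev (R i j)"
  and K4_con: "i < 4 \<Longrightarrow> j < 4 \<Longrightarrow> k < 4 \<Longrightarrow> i \<noteq> j \<Longrightarrow> i \<noteq> k \<Longrightarrow> j \<noteq> k \<Longrightarrow>
      con (set (R i j)) (set (R i k)) {(hd (R i j), hd (R i k))}"
  and K4_con_opp: "i < 4 \<Longrightarrow> j < 4 \<Longrightarrow> k < 4 \<Longrightarrow> l < 4 \<Longrightarrow> distinct [i, j, k, l] \<Longrightarrow>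
      con (set (R i j)) (set (R k l)) {}"
  by (rule R[unfolded K4_paths_def, THEN conjunct1, rule_format, THEN conjunct1];
      assumption)
    (rule R[unfolded K4_paths_def, THEN conjunct1, rule_format, THEN conjunct2]
      R[unfolded K4_paths_def, THEN conjunct2, THEN conjunct1, rule_format]
      R[unfolded K4_paths_def, THEN conjunct2, THEN conjunct2, rule_format]; assumption)+

lemma K4_set: "i < 4 \<Longrightarrow> j < 4 \<Longrightarrow> i \<noteq> j \<Longrightarrow> set (R j i) = set (R i j)"
  using K4_rev[of i j] by simp

lemma K4_length: "i < 4 \<Longrightarrow> j < 4 \<Longrightarrow> i \<noteq> j \<Longrightarrow> length (R j i) = length (R i j)"
  using K4_rev[of i j] by simp

lemma K4_last: "i < 4 \<Longrightarrow> j < 4 \<Longrightarrow> i \<noteq> j \<Longrightarrow> last (R i j) = hd (R j i)"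
  using K4_rev[of i j] by (simp add: hd_rev)

lemma K4_hd: "i < 4 \<Longrightarrow> j < 4 \<Longrightarrow> i \<noteq> j \<Longrightarrow> hd (R i j) \<in> set (R i j)"
  using ipath_nonempty[OF K4_ipath] by simp

lemma K4_last_mem: "i < 4 \<Longrightarrow> j < 4 \<Longrightarrow> i \<noteq> j \<Longrightarrow> last (R i j) \<in> set (R i j)"
  using ipath_nonempty[OF K4_ipath] by simp

lemma K4_pos: "i < 4 \<Longrightarrow> j < 4 \<Longrightarrow> i \<noteq> j \<Longrightarrow> length (R i j) \<ge> 1"
  using K4_ipath[of i j] by (cases "R i j") auto

lemma K4_size_eq:
  assumes "i < 4" "j < 4" "k < 4" "l < 4" "distinct [i, j, k, l]"
  shows "K4_size R = length (R i j) + length (R i k) + length (R i l) +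
     length (R j k) + length (R j l) + length (R k l)"
  using perm_4_cases[OF assms] unfolding K4_size_def
  by (elim insertE emptyE; simp add: K4_length[of 0 1, simplified] K4_length[of 0 2, simplified]
      K4_length[of 0 3, simplified] K4_length[of 1 2, simplified] K4_length[of 1 3, simplified]
      K4_length[of 2 3, simplified])

lemma K4_size_ge: "K4_size R \<ge> 6"
  unfolding K4_size_def
  using K4_pos[of 0 1] K4_pos[of 0 2] K4_pos[of 0 3] K4_pos[of 1 2] K4_pos[of 1 3] K4_pos[of 2 3] by simp

end

text \<open>Twelve pairs of paths share a branch vertex and three are opposite; by symmetry of
  \<open>con\<close>, the quantifiers of \<open>K4_paths\<close> over ordered indices reduce to
  these fifteen contacts.\<close>

lemma K4_ofI:
  assumes "ipath a" "ipath b" "ipath c" "ipath d" "ipath e" "ipath f"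
    and "con (set a) (set b) {(hd a, hd b)}" "con (set a) (set c) {(hd a, hd c)}"
      "con (set b) (set c) {(hd b, hd c)}"
    and "con (set a) (set d) {(last a, hd d)}" "con (set a) (set e) {(last a, hd e)}"
      "con (set d) (set e) {(hd d, hd e)}"
    and "con (set b) (set d) {(last b, last d)}" "con (set b) (set f) {(last b, hd f)}"
      "con (set d) (set f) {(last d, hd f)}"
    and "con (set c) (set e) {(last c, last e)}" "con (set c) (set f) {(last c, last f)}"
      "con (set e) (set f) {(last e, last f)}"
    and "con (set a) (set f) {}" "con (set b) (set e) {}" "con (set c) (set d) {}"
  shows "K4_paths (K4_of a b c d e f)"
proof -
  note s = assms(7-18)[THEN con_swap1] assms(19-)[THEN con_swap0]
  let ?R = "K4_of a b c d e f"
  have "ipath (?R i j) \<and> ?R j i = rev (?R i j)" if "i < 4" "j < 4" "i \<noteq> j" for i j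
  proof -
    have "i = 0 \<or> i = 1 \<or> i = 2 \<or> i = 3" "j = 0 \<or> j = 1 \<or> j = 2 \<or> j = 3" using that by linarith+
    then show ?thesis using that(3) assms(1-6) by (elim disjE; simp add: K4_of_def)
  qed
  moreover have "con (set (?R i j)) (set (?R i k)) {(hd (?R i j), hd (?R i k))}"
    if ijk: "i < 4" "j < 4" "k < 4" "i \<noteq> j" "i \<noteq> k" "j \<noteq> k" for i j k
  proof -
    obtain l where "l < 4" "distinct [i, j, k, l]" using fourth_index[OF ijk] .
    from perm_4_cases[OF ijk(1-3) this] show ?thesis
      using assms(7-) s by (elim insertE emptyE; simp add: K4_of_def hd_rev last_rev)
  qed
  moreover have "con (set (?R i j)) (set (?R k l)) {}"
    if ijk: "i < 4" "j < 4" "k < 4" "l < 4" "distinct [i, j, k, l]" for i j k l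
    using perm_4_cases[OF ijk] assms(7-) s by (elim insertE emptyE; simp add: K4_of_def)
  ultimately show ?thesis unfolding K4_paths_def by blast
qed

lemma K4_size_of:
  "K4_size (K4_of a b c d e f) = length a + length b + length c + length d + length e + length f"
  by (simp add: K4_size_def K4_of_def)

text \<open>
  What remains of the line graph of a subdivision of $K_4$ when one of its six paths is deleted:
  a prism whose third path is split into \<open>D3\<close> and \<open>D4\<close> by one end of the deleted path.
\<close>

definition prism :: "'a list \<Rightarrow> 'a list \<Rightarrow> 'a list \<Rightarrow> 'a list \<Rightarrow> bool" where
  "prism A1 A2 D3 D4 \<longleftrightarrow> ipath A1 \<and> ipath A2 \<and> ipath D3 \<and> ipath D4 \<and>
    con (set A1) (set A2) {(hd A1, hd A2), (last A1, last A2)} \<and>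
    con (set A1) (set D3) {(hd A1, last D3)} \<and> con (set A1) (set D4) {(last A1, last D4)} \<and>
    con (set A2) (set D3) {(hd A2, last D3)} \<and> con (set A2) (set D4) {(last A2, last D4)} \<and>
    con (set D3) (set D4) {(hd D3, hd D4)}"

lemma prism_swap12: "prism A1 A2 D3 D4 \<Longrightarrow> prism A2 A1 D3 D4"
  unfolding prism_def by (elim conjE, drule con_swap2) simp

lemma prism_swap34: "prism A1 A2 D3 D4 \<Longrightarrow> prism (rev A1) (rev A2) D4 D3"
  unfolding prism_def by (elim conjE, drule con_swap1[of "set D3"]) (simp add: hd_rev last_rev insert_commute)

text \<open>Deleting \<open>R i j\<close> destroys the triangles at \<open>i\<close> and
  \<open>j\<close>. At \<open>i\<close> the remaining edge merges \<open>R k i\<close> and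
  \<open>R i l\<close> into one path of the prism; at \<open>j\<close> it is kept as the cut between
  \<open>D3\<close> and \<open>D4\<close>, where a new spoke can end. The triangles of the prism are
  those at \<open>k\<close> and \<open>l\<close>.\<close>

lemma K4_prism:
  assumes R: "K4_paths R" and ij: "i < 4" "j < 4" "k < 4" "l < 4" "distinct [i, j, k, l]"
  shows "prism (R k l) (R k i @ R i l) (R j k) (R j l)"
proof -
  have d: "i \<noteq> j" "i \<noteq> k" "i \<noteq> l" "j \<noteq> k" "j \<noteq> l" "k \<noteq> l"
    "j \<noteq> i" "k \<noteq> i" "l \<noteq> i" "k \<noteq> j" "l \<noteq> j" "l \<noteq> k" using ij by auto
  note ip = K4_ipath[OF R]
  have e: "set (R k i) = set (R i k)" "last (R k i) = hd (R i k)" "set (R j k) = set (R k j)" "last (R j k) = hd (R k j)"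
    "set (R j l) = set (R l j)" "last (R j l) = hd (R l j)" "set (R k l) = set (R l k)" "last (R k l) = hd (R l k)"
    "set (R i l) = set (R l i)" "last (R i l) = hd (R l i)"
    by (rule K4_set[OF R] K4_last[OF R]; use ij d in blast)+
  have ne: "R k i \<noteq> []" "R i l \<noteq> []" using ip ij d ipath_nonempty by blast+
  have c1: "con (set (R k i)) (set (R i l)) {(last (R k i), hd (R i l))}"
    using K4_con[OF R ij(1,3,4) d(2,3,6)] by (simp only: e)
  have dj: "set (R k i) \<inter> set (R i l) = {}" using c1 by (simp add: con_def)
  have m: "hd (R k l) \<in> set (R k l)" "last (R k l) \<in> set (R k l)" "hd (R k i) \<in> set (R k i)"
    "last (R i l) \<in> set (R i l)" "last (R j k) \<in> set (R j k)" "last (R j l) \<in> set (R j l)"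
    using K4_hd[OF R] K4_last_mem[OF R] ij d by simp_all
  have "ipath (R k i @ R i l)"
    using ip ne c1 ij d by (simp add: ipath_append)
  moreover have "con (set (R k l)) (set (R k i) \<union> set (R i l))
      ({(hd (R k l), hd (R k i))} \<union> {(last (R k l), last (R i l))})"
  proof (rule con_Un)
    show "con (set (R k l)) (set (R k i)) {(hd (R k l), hd (R k i))}"
      using K4_con[OF R ij(3,4,1) d(6,8,9)] .
    show "con (set (R k l)) (set (R i l)) {(last (R k l), last (R i l))}"
      using K4_con[OF R ij(4,3,1) d(12,9,8)] by (simp only: e)
  qed (use m dj in auto)
  moreover have "con (set (R k l)) (set (R j k)) {(hd (R k l), last (R j k))}"
    using K4_con[OF R ij(3,4,2) d(6,10,11)] by (simp only: e)
  moreover have "con (set (R k l)) (set (R j l)) {(last (R k l), last (R j l))}"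
    using K4_con[OF R ij(4,3,2) d(12,11,10)] by (simp only: e)
  moreover have "con (set (R j k)) (set (R k i) \<union> set (R i l)) ({(last (R j k), hd (R k i))} \<union> {})"
  proof (rule con_Un)
    show "con (set (R j k)) (set (R k i)) {(last (R j k), hd (R k i))}"
      using K4_con[OF R ij(3,2,1) d(10,8,7)] by (simp only: e)
    show "con (set (R j k)) (set (R i l)) {}"
      by (rule K4_con_opp[OF R ij(2,3,1,4)]) (use ij(5) in auto)
  qed (use m dj in auto)
  then have "con (set (R k i @ R i l)) (set (R j k)) {(hd (R k i @ R i l), last (R j k))}"
    using con_swap1[of "set (R j k)" "set (R k i) \<union> set (R i l)"] ne by simp
  moreover have "con (set (R j l)) (set (R k i) \<union> set (R i l)) ({} \<union> {(last (R j l), last (R i l))})"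
  proof (rule con_Un)
    show "con (set (R j l)) (set (R k i)) {}"
      by (rule K4_con_opp[OF R ij(2,4,3,1)]) (use ij(5) in auto)
    show "con (set (R j l)) (set (R i l)) {(last (R j l), last (R i l))}"
      using K4_con[OF R ij(4,2,1) d(11,9,7)] by (simp only: e)
  qed (use m dj in auto)
  then have "con (set (R k i @ R i l)) (set (R j l)) {(last (R k i @ R i l), last (R j l))}"
    using con_swap1[of "set (R j l)" "set (R k i) \<union> set (R i l)"] ne by simp
  moreover have "con (set (R j k)) (set (R j l)) {(hd (R j k), hd (R j l))}"
    using K4_con[OF R ij(2,3,4) d(4,5,6)] .
  ultimately show ?thesis
    unfolding prism_def using ip ij d ne by (simp add: insert_commute)
qed

end

section \<open>Attaching a spoke to a prism\<close>

context sym_rel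
begin

lemma con_append0: "con U (set p) {} \<Longrightarrow> con U (set q) {} \<Longrightarrow> con U (set (p @ q)) {}"
  unfolding con_def by auto

lemma con_append: "con U (set p) {(a, b)} \<Longrightarrow> con U (set q) {} \<Longrightarrow> b \<in> set p \<Longrightarrow> con U (set (p @ q)) {(a, b)}"
  unfolding con_def by auto

lemma con_append_left: "con (set p) W {(a, b)} \<Longrightarrow> con (set q) W {} \<Longrightarrow> a \<in> set p \<Longrightarrow> con (set (p @ q)) W {(a, b)}"
  unfolding con_def by auto

text \<open>The walk is the piece of \<open>A\<close> from its head up to a neighbour of
  \<open>x\<close>. As \<open>x\<close> is not adjacent to \<open>last A\<close>, the piece misses
  \<open>last A\<close>, and with it the contacts that a path of a prism has at that end.\<close>

lemma neighbour_prefix: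
  assumes "ipath A" "y \<in> set A" "E x y" "\<not> E x (last A)"
  shows "\<exists>w. walk w \<and> hd w = hd A \<and> E x (last w) \<and> set w \<subseteq> set A - {last A}"
proof -
  obtain p q where A: "A = p @ y # q" using assms by (meson split_list)
  have q: "q \<noteq> []" using assms A by auto
  have "ipath ((p @ [y]) @ q)" using assms A by simp
  then have "ipath (p @ [y])" "con (set (p @ [y])) (set q) {(last (p @ [y]), hd q)}"
    by (subst (asm) ipath_append; use q in simp)+
  then have "walk (p @ [y])" "last A \<notin> set (p @ [y])"
    using ipath_walk q A by (auto simp: con_def)
  then show ?thesis using A assms by (intro exI[of _ "p @ [y]"]) (auto simp: hd_append)
qed

text \<open>The spoke makes up for the deleted path: \<open>x\<close>, \<open>y\<close>,
  \<open>z\<close> form a new triangle that cuts \<open>A1\<close> in two, and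
  \<open>last S\<close>, \<open>hd D3\<close>, \<open>hd D4\<close> form the triangle at the other
  end of the spoke. The two triangles of the prism become branch vertices 2 and 3.\<close>

lemma K4_of_spoke:
  assumes pr: "prism A1 A2 D3 D4"
    and S: "ipath (x # S)" "S \<noteq> []"
    and SA: "con (set S) (set A1) {}" "con (set S) (set A2) {}"
    and SD: "con (set S) (set D3) {(last S, hd D3)}" "con (set S) (set D4) {(last S, hd D4)}"
    and A1: "A1 = p @ y # z # q"
    and x: "con {x} (set A1) {(x, y), (x, z)}" "con {x} (set A2) {}" "con {x} (set D3) {}" "con {x} (set D4) {}"
  shows "K4_paths (K4_of (x # S) (rev (p @ [y])) (z # q) D3 D4 A2)"
proof -
  have xS: "x \<noteq> last S" using S ipath_distinct[OF S(1)] by auto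
  have "ipath ((p @ [y]) @ z # q)" using pr A1 by (simp add: prism_def)
  then have ip: "ipath (p @ [y])" "ipath (z # q)" "con (set (p @ [y])) (set (z # q)) {(y, z)}"
    by (subst (asm) ipath_append; simp)+
  have yz: "y \<notin> set (z # q)" "z \<notin> set (p @ [y])" using ip(3) by (auto simp: con_def)
  have h: "hd A1 = hd (p @ [y])" "last A1 = last (z # q)"
    unfolding A1 by (cases p; simp)+
  have sub: "set (p @ [y]) \<subseteq> set A1" "set (z # q) \<subseteq> set A1" unfolding A1 by auto
  \<comment> \<open>The cut separates the two ends of \<open>A1\<close>, so each piece keeps exactly
    one of the two contacts between \<open>A1\<close> and \<open>A2\<close>.\<close>
  have hl: "hd A1 \<notin> set (z # q)" "last A1 \<notin> set (p @ [y])"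
    unfolding h using ip(3) hd_in_set[of "p @ [y]"] last_in_set[of "z # q"] by (auto simp: con_def simp del: last.simps)
  note c = pr[unfolded prism_def]
  show ?thesis
  proof (rule K4_ofI)
    show "con (set (x # S)) (set (rev (p @ [y]))) {(hd (x # S), hd (rev (p @ [y])))}"
      using x(1) SA(1) sub yz unfolding con_def by (auto simp: A1)
    show "con (set (x # S)) (set (z # q)) {(hd (x # S), hd (z # q))}"
      using x(1) SA(1) sub yz unfolding con_def by (auto simp: A1)
    show "con (set (rev (p @ [y]))) (set (z # q)) {(hd (rev (p @ [y])), hd (z # q))}"
      using ip(3) by simp
    show "con (set (x # S)) (set D3) {(last (x # S), hd D3)}"
      using x(3) SD(1) S(2) xS unfolding con_def by auto
    show "con (set (x # S)) (set D4) {(last (x # S), hd D4)}"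
      using x(4) SD(2) S(2) xS unfolding con_def by auto
    show "con (set (x # S)) (set A2) {}"
      using x(2) SA(2) unfolding con_def by auto
    show "con (set (rev (p @ [y]))) (set D3) {(last (rev (p @ [y])), last D3)}"
      unfolding last_rev set_rev h(1)[symmetric] using c sub by (blast intro: con_sub)
    show "con (set (rev (p @ [y]))) (set A2) {(last (rev (p @ [y])), hd A2)}"
      unfolding last_rev set_rev h(1)[symmetric]
      by (rule con_sub[of "set A1" "set A2" "{(hd A1, hd A2), (last A1, last A2)}"]) (use c sub hl in auto)
    show "con (set (z # q)) (set A2) {(last (z # q), last A2)}"
      unfolding h(2)[symmetric]
      by (rule con_sub[of "set A1" "set A2" "{(hd A1, hd A2), (last A1, last A2)}"]) (use c sub hl in auto)
    show "con (set (z # q)) (set D4) {(last (z # q), last D4)}"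
      unfolding h(2)[symmetric] using c sub by (blast intro: con_sub)
    show "con (set (rev (p @ [y]))) (set D4) {}"
      by (rule con_sub[of "set A1" "set D4" "{(last A1, last D4)}"]) (use c sub hl in auto)
    show "con (set (z # q)) (set D3) {}"
      by (rule con_sub[of "set A1" "set D3" "{(hd A1, last D3)}"]) (use c sub hl in auto)
    show "con (set D3) (set A2) {(last D3, hd A2)}" "con (set D4) (set A2) {(last D4, last A2)}"
      using c con_swap1 by blast+
    show "ipath (rev (p @ [y]))" using ip(1) by (simp only: ipath_rev_iff)
  qed (use S ip c in simp_all)
qed

end

context even_holes
begin

text \<open>Every other pattern of neighbours of \<open>x\<close> gives a pyramid. A neighbour on a
  second path, or non-consecutive first and last neighbours on \<open>A1\<close>, give one with apex
  \<open>x\<close>; a single neighbour \<open>y\<close> gives one with apex \<open>y\<close>. For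
  apex \<open>x\<close> the condition on the triangle holds because \<open>x\<close> sees no end of
  the four paths.\<close>

lemma spoke_attachment:
  assumes pr: "prism A1 A2 D3 D4"
    and S: "ipath (x # S)" "S \<noteq> []"
    and SA: "con (set S) (set A1) {}" "con (set S) (set A2) {}"
    and SD: "con (set S) (set D3) {(last S, hd D3)}" "con (set S) (set D4) {(last S, hd D4)}"
    and x: "x \<notin> set A1" "x \<notin> set A2" "x \<notin> set D3" "x \<notin> set D4"
    and nc: "\<not> E x (hd A1)" "\<not> E x (last A1)" "\<not> E x (hd A2)" "\<not> E x (last A2)"
      "\<not> E x (hd D3)" "\<not> E x (last D3)" "\<not> E x (hd D4)" "\<not> E x (last D4)"
    and n: "u \<in> set A1" "E x u"
  shows "\<exists>p y z q. A1 = p @ y # z # q \<and> p \<noteq> [] \<and> q \<noteq> [] \<and> con {x} (set A1) {(x, y), (x, z)} \<and>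
    con {x} (set A2) {} \<and> con {x} (set D3) {} \<and> con {x} (set D4) {}"
proof -
  note c = pr[unfolded prism_def]
  have ne: "A1 \<noteq> []" "A2 \<noteq> []" "D3 \<noteq> []" "D4 \<noteq> []" using c ipath_nonempty by blast+
  have xS: "x \<notin> set S" "E x (hd S)" "walk S"
    using S ipath_distinct[OF S(1)] ipath_walk[OF S(1)] by (cases S; auto)+
  have wS: "walk (rev S)" "hd (rev S) = last S" "last (rev S) = hd S"
    using walk_rev xS(3) by (auto simp: hd_rev last_rev)
  have wD: "walk (rev D3)" "walk (rev D4)" "walk D3" "walk D4" "walk A2" "walk A1"
    using c ipath_walk walk_rev by blast+
  have lhD: "last S \<in> set S" "hd D3 \<in> set D3" "hd D4 \<in> set D4" "last D3 \<in> set D3" "last D4 \<in> set D4"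
    "hd A1 \<in> set A1" "last A1 \<in> set A1" "hd A2 \<in> set A2" "last A2 \<in> set A2"
    using ne S(2) by simp_all
  have wA: "walk w \<Longrightarrow> w \<noteq> []" for w by auto
  have D3S: "walk (rev D3 @ rev S)"
    using wD wS wA S(2) ne lhD conD[OF SD(1), of "last S" "hd D3"] E_commute
    by (subst walk_append) (auto simp: hd_rev last_rev)
  have D4S: "walk (rev D4 @ rev S)"
    using wD wS wA S(2) ne lhD conD[OF SD(2), of "last S" "hd D4"] E_commute
    by (subst walk_append) (auto simp: hd_rev last_rev)
  have E2: "E (last A2) (last D4)" "E (last D3) (hd A1)" "E (last D4) (last A1)"
    using c lhD E_commute by (auto simp: con_def)
  have E3: "E (last D3) (hd A2)"
    using c lhD E_commute[of "last D3" "hd A2"] by (simp add: con_def)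
  have A2D4S: "walk (A2 @ rev D4 @ rev S)"
    using wD D4S wA S(2) ne E2
    by (subst walk_append) (auto simp: hd_rev last_rev)
  obtain w1 where w1: "walk w1" "hd w1 = hd A1" "E x (last w1)" "set w1 \<subseteq> set A1 - {last A1}"
    using neighbour_prefix[of A1 u x] c n nc by blast
  \<comment> \<open>The triangle is \<open>hd A1\<close>, \<open>hd A2\<close>,
    \<open>last D3\<close>; two legs run to neighbours of \<open>x\<close> on \<open>A1\<close> and
    \<open>A2\<close>, the third goes back along \<open>D3\<close> and \<open>S\<close> to
    \<open>x\<close>.\<close>
  have no2: "\<not> E x v" if v: "v \<in> set A2" for v
  proof
    assume "E x v"
    then obtain w2 where w2: "walk w2" "hd w2 = hd A2" "E x (last w2)" "set w2 \<subseteq> set A2 - {last A2}"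
      using neighbour_prefix[of A2 v x] c v nc by blast
    show False
    proof (rule no_pyramid[of w1 w2 "rev D3 @ rev S" x])
      have "hd (rev D3 @ rev S) = last D3" using ne by (simp add: hd_append hd_rev)
      moreover have "con (set w1) (set (rev D3 @ rev S)) {(hd w1, last D3)}"
      proof (rule con_append)
        show "con (set w1) (set (rev D3)) {(hd w1, last D3)}"
          by (rule con_sub[of "set A1" "set D3" "{(hd A1, last D3)}"]) (use c w1 in auto)
        show "con (set w1) (set (rev S)) {}"
          by (rule con_sub[OF con_swap0[OF SA(1)]]) (use w1 in auto)
      qed (use lhD in simp)
      moreover have "con (set w2) (set (rev D3 @ rev S)) {(hd w2, last D3)}"
      proof (rule con_append)
        show "con (set w2) (set (rev D3)) {(hd w2, last D3)}"
          by (rule con_sub[of "set A2" "set D3" "{(hd A2, last D3)}"]) (use c w2 in auto)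
        show "con (set w2) (set (rev S)) {}"
          by (rule con_sub[OF con_swap0[OF SA(2)]]) (use w2 in auto)
      qed (use lhD in simp)
      ultimately show "con (set w1) (set (rev D3 @ rev S)) {(hd w1, hd (rev D3 @ rev S))}"
        "con (set w2) (set (rev D3 @ rev S)) {(hd w2, hd (rev D3 @ rev S))}" by simp_all
      show "con (set w1) (set w2) {(hd w1, hd w2)}"
        by (rule con_sub[of "set A1" "set A2" "{(hd A1, hd A2), (last A1, last A2)}"]) (use c w1 w2 in auto)
      show "\<not> (E x (hd w1) \<and> E x (hd w2))" "\<not> (E x (hd w1) \<and> E x (hd (rev D3 @ rev S)))"
        "\<not> (E x (hd w2) \<and> E x (hd (rev D3 @ rev S)))" using nc w1 w2 by auto
    qed (use w1 w2 D3S xS S(2) x in \<open>auto simp: last_rev\<close>)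
  qed
  \<comment> \<open>Stated for an arbitrary prism, so that it covers \<open>D3\<close> directly and
    \<open>D4\<close> after \<open>prism_swap34\<close>. The triangle is as before, but the third
    leg now consists of all of \<open>A2'\<close> and of \<open>D4'\<close> and \<open>S\<close>
    backwards. The leg on \<open>D3'\<close> avoids \<open>hd D3'\<close> and so touches neither
    \<open>D4'\<close> nor \<open>S\<close>.\<close>
  have noD: False
    if c': "prism A1' A2' D3' D4'" and w1': "walk w1'" "hd w1' = hd A1'" "E x (last w1')" "set w1' \<subseteq> set A1' - {last A1'}"
     and w3: "walk (A2' @ rev D4' @ rev S)" and v: "v \<in> set D3'" "E x v"
     and nc': "\<not> E x (hd D3')" "\<not> E x (last D3')" "\<not> E x (hd A1')" "\<not> E x (hd A2')"
     and S': "con (set S) (set A1') {}" "con (set S) (set D3') {(last S, hd D3')}"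
     and x': "x \<notin> set A1'" "x \<notin> set A2'" "x \<notin> set D3'" "x \<notin> set D4'"
     for A1' A2' D3' D4' w1' v
  proof -
    note c = c'[unfolded prism_def]
    have ne: "A1' \<noteq> []" "A2' \<noteq> []" "D3' \<noteq> []" "D4' \<noteq> []" using c ipath_nonempty by blast+
    have lh: "hd D3' \<in> set D3'" "hd D4' \<in> set D4'" "last D3' \<in> set D3'" "last D4' \<in> set D4'"
      "hd A1' \<in> set A1'" "last A1' \<in> set A1'" "hd A2' \<in> set A2'" "last A2' \<in> set A2'"
      using ne by simp_all
    obtain w2 where w2: "walk w2" "hd w2 = last D3'" "E x (last w2)" "set w2 \<subseteq> set D3' - {hd D3'}"
      using neighbour_prefix[of "rev D3'" v x] c v nc' by (auto simp: hd_rev last_rev)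
    show False
    proof (rule no_pyramid[of w1' w2 "A2' @ rev D4' @ rev S" x])
      have h: "hd (A2' @ rev D4' @ rev S) = hd A2'" using ne by simp
      show "con (set w1') (set (A2' @ rev D4' @ rev S)) {(hd w1', hd (A2' @ rev D4' @ rev S))}"
        unfolding h
      proof (intro con_append con_append0)
        show "con (set w1') (set A2') {(hd w1', hd A2')}"
          by (rule con_sub[of "set A1'" "set A2'" "{(hd A1', hd A2'), (last A1', last A2')}"]) (use c w1' in auto)
        show "con (set w1') (set (rev D4')) {}"
          by (rule con_sub[of "set A1'" "set D4'" "{(last A1', last D4')}"]) (use c w1' in auto)
        show "con (set w1') (set (rev S)) {}"
          by (rule con_sub[OF con_swap0[OF S'(1)]]) (use w1' in auto)
      qed (use lh in simp)
      show "con (set w2) (set (A2' @ rev D4' @ rev S)) {(hd w2, hd (A2' @ rev D4' @ rev S))}"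
        unfolding h
      proof (intro con_append con_append0)
        have "con (set D3') (set A2') {(last D3', hd A2')}" using c con_swap1 by blast
        then show "con (set w2) (set A2') {(hd w2, hd A2')}"
          by (rule con_sub) (use w2 in auto)
        show "con (set w2) (set (rev D4')) {}"
          by (rule con_sub[of "set D3'" "set D4'" "{(hd D3', hd D4')}"]) (use c w2 in auto)
        show "con (set w2) (set (rev S)) {}"
          by (rule con_sub[OF con_swap1[OF S'(2)]]) (use w2 in auto)
      qed (use lh in simp)
      show "con (set w1') (set w2) {(hd w1', hd w2)}"
        by (rule con_sub[of "set A1'" "set D3'" "{(hd A1', last D3')}"]) (use c w1' w2 in auto)
      show "\<not> (E x (hd w1') \<and> E x (hd w2))" "\<not> (E x (hd w1') \<and> E x (hd (A2' @ rev D4' @ rev S)))"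
        "\<not> (E x (hd w2) \<and> E x (hd (A2' @ rev D4' @ rev S)))" using nc' w1' w2 by auto
    qed (use w1' w2 w3 xS S(2) x' in \<open>auto simp: last_rev\<close>)
  qed
  have no3: "\<not> E x v" if v: "v \<in> set D3" for v
    using noD[OF pr w1 A2D4S v] nc SA SD x by blast
  have no4: "\<not> E x v" if v: "v \<in> set D4" for v
  proof
    assume xv: "E x v"
    obtain w where w: "walk w" "hd w = hd (rev A1)" "E x (last w)" "set w \<subseteq> set (rev A1) - {last (rev A1)}"
      using neighbour_prefix[of "rev A1" u x] c n nc by (auto simp: hd_rev last_rev)
    have "walk (rev A2 @ rev D3 @ rev S)"
      using walk_rev[OF wD(5)] D3S wA S(2) ne E3 E_commute[of "hd A2"]
      by (subst walk_append) (auto simp: hd_rev last_rev)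
    then show False
      using noD[OF prism_swap34[OF pr] w _ v xv] nc SA SD x by (simp add: hd_rev last_rev)
  qed
  \<comment> \<open>The remaining pyramids have the triangle \<open>last S\<close>,
    \<open>hd D3\<close>, \<open>hd D4\<close>; two legs run through \<open>D3\<close> and
    \<open>D4\<close> into \<open>A1\<close> from its opposite ends.\<close>
  have arms: "con (set (D3 @ p)) (set (D4 @ rev r)) {(hd (D3 @ p), hd (D4 @ rev r))}"
    if "set p \<subseteq> set A1" "set r \<subseteq> set A1" "con (set p) (set r) {}" "hd A1 \<notin> set r" "last A1 \<notin> set p" for p r
  proof -
    have "con (set D3) (set (rev r)) {}"
      by (rule con_sub[of "set D3" "set A1" "{(last D3, hd A1)}"]) (use c con_swap1 that in auto)
    then have "con (set D3) (set (D4 @ rev r)) {(hd D3, hd D4)}"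
      using c lhD by (intro con_append) auto
    moreover have "con (set p) (set D4) {}"
      by (rule con_sub[of "set A1" "set D4" "{(last A1, last D4)}"]) (use c that in auto)
    then have "con (set p) (set (D4 @ rev r)) {}"
      using that by (intro con_append0) auto
    ultimately have "con (set (D3 @ p)) (set (D4 @ rev r)) {(hd D3, hd D4)}"
      using lhD by (intro con_append_left) auto
    then show ?thesis using ne by simp
  qed
  have stem: "con (set T) (set (D3 @ p)) {(last S, hd (D3 @ p))}" "con (set T) (set (D4 @ p)) {(last S, hd (D4 @ p))}"
    if "con (set T) (set D3) {(last S, hd D3)}" "con (set T) (set D4) {(last S, hd D4)}"
      "con (set T) (set p) {}" for T p
    using con_append[OF that(1,3) lhD(2)] con_append[OF that(2,3) lhD(3)] ne by simp_all
  obtain p y r where A: "A1 = p @ y # r" and y: "E x y" and p: "\<forall>v \<in> set p. \<not> E x v"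
    using split_list_first_prop[of A1 "E x"] n by blast
  have r: "r \<noteq> []" and pne: "p \<noteq> []" using A y nc ne by (auto simp: hd_append)
  have ipA: "ipath ((p @ [y]) @ r)" using c A by simp
  have ipr: "ipath r" "con (set (p @ [y])) (set r) {(y, hd r)}"
    using ipA by (subst (asm) ipath_append; use r in simp)+
  have py: "walk (D3 @ p)" "E y (last p)"
  proof -
    have "ipath (p @ y # r)" using c A by simp
    then have "ipath p" "con (set p) (set (y # r)) {(last p, y)}"
      by (subst (asm) ipath_append; use pne in simp)+
    then show "walk (D3 @ p)" "E y (last p)"
      using wD pne ne E2 A E_commute ipath_walk by (auto simp: walk_append con_def)
  qed
  have pDy: "walk (D3 @ p @ [y])"
    using py wA pne walk_append[of "D3 @ p" "[y]"] E_commute by simp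
  show ?thesis
  proof (cases "\<exists>v \<in> set r. E x v")
    \<comment> \<open>\<open>y\<close> is the only neighbour of \<open>x\<close> on
      \<open>A1\<close>. It becomes the apex, and the first leg is \<open>S\<close> backwards,
      extended by \<open>x\<close>.\<close>
    case False
    have Ey: "E y (hd r)" "y \<noteq> hd A1" "y \<noteq> last A1"
      using ipr(2) r nc y A by (auto simp: con_def)
    have lr: "last A1 = last r" "last r \<in> set r" using A r by auto
    have hp: "hd A1 = hd p" "hd p \<in> set p" using A pne by auto
    have yp: "y \<notin> set p" "y \<notin> set r" "y \<notin> set D3" "y \<notin> set D4" "y \<notin> set S" "y \<noteq> x"
      using c A ipath_distinct[of A1] SA x by (auto simp: con_def)
    have xr: "\<not> E x v \<and> \<not> E v x" if "v \<in> set p \<union> set r \<union> set D3 \<union> set D4" for v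
      using that p False no3 no4 E_commute by blast
    have pr_sub: "set p \<subseteq> set A1" "set r \<subseteq> set A1" using A by auto
    have "walk (rev S @ [x])"
      using wS xS S(2) E_commute by (auto simp: walk_append)
    moreover have "walk (D4 @ rev r)"
      using wD walk_rev[OF ipath_walk[OF ipr(1)]] r ne E2 A
      by (auto simp: walk_append hd_rev)
    moreover have "con (set (rev S @ [x])) (set (D3 @ p)) {(hd (rev S @ [x]), hd (D3 @ p))}"
      "con (set (rev S @ [x])) (set (D4 @ rev r)) {(hd (rev S @ [x]), hd (D4 @ rev r))}"
    proof -
      have "hd (rev S @ [x]) = last S" using S(2) by (simp add: hd_append hd_rev)
      moreover have "con (set (rev S @ [x])) (set D3) {(last S, hd D3)}" "con (set (rev S @ [x])) (set D4) {(last S, hd D4)}"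
        by (intro con_append_left; use SD xr x lhD in \<open>auto simp: con_def\<close>)+
      moreover have "con (set (rev S @ [x])) (set p) {}" "con (set (rev S @ [x])) (set (rev r)) {}"
        using SA(1) pr_sub xr x unfolding con_def by auto
      ultimately show "con (set (rev S @ [x])) (set (D3 @ p)) {(hd (rev S @ [x]), hd (D3 @ p))}"
        "con (set (rev S @ [x])) (set (D4 @ rev r)) {(hd (rev S @ [x]), hd (D4 @ rev r))}"
        by (metis stem)+
    qed
    moreover have "con (set (D3 @ p)) (set (D4 @ rev r)) {(hd (D3 @ p), hd (D4 @ rev r))}"
    proof (rule arms)
      show "con (set p) (set r) {}" using ipr(2) yp by (auto simp: con_def)
      show "hd A1 \<notin> set r" "last A1 \<notin> set p" using ipr(2) hp lr unfolding con_def by auto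
    qed (use pr_sub in auto)
    moreover have "\<not> E y (hd D3)" "\<not> E y (hd D4)" using c A Ey lhD unfolding con_def by auto
    moreover have "E y (last (rev S @ [x]))" "E y (last (D3 @ p))" "E y (last (D4 @ rev r))"
      using y E_commute[of x y] py(2) Ey(1) pne r by (simp_all add: last_rev)
    moreover have "y \<notin> set (rev S @ [x])" "y \<notin> set (D3 @ p)" "y \<notin> set (D4 @ rev r)" using yp by auto
    moreover have "hd (D3 @ p) = hd D3" "hd (D4 @ rev r) = hd D4" using ne by simp_all
    ultimately have False
      using no_pyramid[of "rev S @ [x]" "D3 @ p" "D4 @ rev r" y] py(1) by metis
    then show ?thesis ..
  next
    case True
    \<comment> \<open>\<open>z\<close> is the last neighbour. If a vertex lies strictly between
      \<open>y\<close> and \<open>z\<close>, then the pieces of \<open>A1\<close> up to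
      \<open>y\<close> and from \<open>z\<close> on have no contact, and \<open>x\<close> is the
      apex of a pyramid; otherwise \<open>y\<close> and \<open>z\<close> are consecutive, as
      claimed.\<close>
    then obtain p' z q where q: "r = p' @ z # q" and z: "E x z" "\<forall>v \<in> set q. \<not> E x v"
      using split_list_last_prop[of r "E x"] by blast
    have qne: "q \<noteq> []" using q A z nc by auto
    have qA: "set (z # q) \<subseteq> set A1" "last A1 = last (z # q)" "last (z # q) \<in> set (z # q)" using A q by auto
    have pA: "set (p @ [y]) \<subseteq> set A1" "hd A1 = hd (p @ [y])" "hd (p @ [y]) \<in> set (p @ [y])" using A pne by auto
    show ?thesis
    proof (cases "p' = []")
      case True
      then have "A1 = p @ y # z # q" using A q by simp
      then show ?thesis
        using pne qne p y z x no2 no3 no4 by (intro exI[of _ p] exI[of _ y] exI[of _ z] exI[of _ q]) (auto simp: con_def)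
    next
      case False
      have ipz: "ipath (z # q)" using ipr(1) q False by (simp add: ipath_append)
      have ds: "set (p @ [y]) \<inter> set (z # q) = {}"
        using ipr(2) q by (auto simp: con_def)
      have nadj: "\<not> E a b" if "a \<in> set (p @ [y])" "b \<in> set (z # q)" for a b
      proof -
        have "b \<in> set r" "b \<noteq> hd r"
          using that q False ipath_distinct[OF ipr(1)] by (cases p'; auto)+
        then show ?thesis using ipr(2) that by (auto simp: con_def)
      qed
      have "walk (D4 @ rev (z # q))"
        using wD walk_rev[OF ipath_walk[OF ipz]] ne E2 qA(2)
        by (subst walk_append) (auto simp: hd_rev simp del: rev.simps last.simps)
      moreover have "con (set (rev S)) (set (D3 @ p @ [y])) {(hd (rev S), hd (D3 @ p @ [y]))}"
        "con (set (rev S)) (set (D4 @ rev (z # q))) {(hd (rev S), hd (D4 @ rev (z # q)))}"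
      proof -
        have "con (set (rev S)) (set (p @ [y])) {}" "con (set (rev S)) (set (rev (z # q))) {}"
          using SA(1) pA(1) qA(1) unfolding con_def by auto
        then show "con (set (rev S)) (set (D3 @ p @ [y])) {(hd (rev S), hd (D3 @ p @ [y]))}"
          "con (set (rev S)) (set (D4 @ rev (z # q))) {(hd (rev S), hd (D4 @ rev (z # q)))}"
          using stem[of "rev S"] SD wS(2) by (metis set_rev)+
      qed
      moreover have "con (set (D3 @ p @ [y])) (set (D4 @ rev (z # q))) {(hd (D3 @ p @ [y]), hd (D4 @ rev (z # q)))}"
      proof (rule arms)
        show "con (set (p @ [y])) (set (z # q)) {}" using ds nadj unfolding con_def by blast
        show "hd A1 \<notin> set (z # q)" "last A1 \<notin> set (p @ [y])" using ds pA qA by auto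
      qed (use pA qA in auto)
      moreover have "x \<notin> set (D3 @ p @ [y])" "x \<notin> set (D4 @ rev (z # q))" using x pA qA by auto
      moreover have "hd (D3 @ p @ [y]) = hd D3" "hd (D4 @ rev (z # q)) = hd D4" using ne by simp_all
      moreover have "x \<notin> set (rev S)" "last (D3 @ p @ [y]) = y" "last (D4 @ rev (z # q)) = z" using xS by auto
      ultimately have False
        using no_pyramid[of "rev S" "D3 @ p @ [y]" "D4 @ rev (z # q)" x] y z pDy wS xS nc by (metis)
      then show ?thesis ..
    qed
  qed
qed

end

section \<open>Replacing half a path by a shortest path\<close>

definition K4_upd :: "(nat \<Rightarrow> nat \<Rightarrow> 'b list) \<Rightarrow> nat \<Rightarrow> nat \<Rightarrow> 'b list \<Rightarrow> nat \<Rightarrow> nat \<Rightarrow> 'b list" where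
  "K4_upd R i j p c d = (if c = i \<and> d = j then p else if c = j \<and> d = i then rev p else R c d)"

context sym_rel
begin

definition least_K4 :: "(nat \<Rightarrow> nat \<Rightarrow> 'a list) \<Rightarrow> bool" where
  "least_K4 R \<longleftrightarrow> K4_paths R \<and> K4_size R \<noteq> 6 \<and>
    (\<forall>R'. K4_paths R' \<longrightarrow> K4_size R' \<noteq> 6 \<longrightarrow> K4_size R \<le> K4_size R')"

definition detached :: "(nat \<Rightarrow> nat \<Rightarrow> 'a list) \<Rightarrow> nat \<Rightarrow> nat \<Rightarrow> 'a \<Rightarrow> bool" where
  "detached R i j x \<longleftrightarrow> (\<forall>c<4. \<forall>d<4. c \<noteq> d \<longrightarrow> {c, d} \<noteq> {i, j} \<longrightarrow> con {x} (set (R c d)) {})"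

lemma K4_pair_cases:
  assumes "i < 4" "j < 4" "k < 4" "l < 4" "distinct [i, j, k, l :: nat]" "c < 4" "d < 4" "c \<noteq> d" "{c, d} \<noteq> {i, j}"
  shows "(c, d) \<in> {(k, l), (l, k), (i, k), (k, i), (i, l), (l, i), (j, k), (k, j), (j, l), (l, j)}"
proof -
  have "c \<in> {i, j, k, l}" if "c < 4" for c
  proof -
    have "card {i, j, k, l} = 4" using assms(5) by simp
    then have "{i, j, k, l} = {..<4}" by (intro card_subset_eq) (use assms in auto)
    then show ?thesis using that by simp
  qed
  then have "c \<in> {i, j, k, l}" "d \<in> {i, j, k, l}" using assms by blast+
  then show ?thesis using assms(8,9) by (simp add: doubleton_eq_iff) metis
qed

lemma detachedI:
  assumes R: "K4_paths R" and ij: "i < 4" "j < 4" "k < 4" "l < 4" "distinct [i, j, k, l]"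
    and "con {x} (set (R k l)) {}" "con {x} (set (R i k)) {}" "con {x} (set (R i l)) {}"
      "con {x} (set (R j k)) {}" "con {x} (set (R j l)) {}"
  shows "detached R i j x"
  unfolding detached_def
proof (intro allI impI)
  fix c d assume cd: "c < 4" "d < 4" "c \<noteq> d" "{c, d} \<noteq> {i, j}"
  have "set (R l k) = set (R k l)" "set (R k i) = set (R i k)" "set (R l i) = set (R i l)"
    "set (R k j) = set (R j k)" "set (R l j) = set (R j l)"
    by (rule K4_set[OF R]; use ij in auto)+
  then show "con {x} (set (R c d)) {}"
    using K4_pair_cases[OF ij cd] assms(7-) by (elim insertE emptyE) simp_all
qed

lemma detachedD:
  "detached R i j x \<Longrightarrow> c < 4 \<Longrightarrow> d < 4 \<Longrightarrow> c \<noteq> d \<Longrightarrow> {c, d} \<noteq> {i, j} \<Longrightarrow> u \<in> set (R c d) \<Longrightarrow> x \<noteq> u \<and> \<not> E x u \<and> \<not> E u x"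
  unfolding detached_def con_def using E_sym by blast

lemma K4_inner_detached:
  assumes R: "K4_paths R" and ij: "i < 4" "j < 4" "i \<noteq> j"
    and x: "x \<in> set (R i j)" "x \<noteq> hd (R i j)" "x \<noteq> last (R i j)"
  shows "detached R i j x"
proof -
  have "\<exists>k<4. k \<noteq> i \<and> k \<noteq> j"
  proof (rule ccontr)
    assume "\<not> ?thesis"
    then have "{..<4} \<subseteq> {i, j}" by auto
    then have "card {..<4::nat} \<le> card {i, j}" by (rule card_mono[rotated]) simp
    then show False using ij by simp
  qed
  then obtain k where k: "k < 4" "i \<noteq> k" "j \<noteq> k" by auto
  obtain l where l: "l < 4" "distinct [i, j, k, l]" using fourth_index[OF ij(1,2) k(1) ij(3) k(2,3)] .
  have x': "x \<in> set (R j i)" "x \<noteq> hd (R j i)"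
    using x K4_set[OF R ij] K4_last[OF R ij] by auto
  have c: "con {x} (set (R k l)) {}"
    by (rule con_sub[OF K4_con_opp[OF R ij(1,2) k(1) l]]) (use x in auto)
  have d: "con {x} (set (R i m)) {}" "con {x} (set (R j m)) {}" if "m < 4" "i \<noteq> m" "j \<noteq> m" for m
    by (rule con_sub[OF K4_con[OF R ij(1,2) that(1) ij(3) that(2,3)]]; use x in simp)
       (rule con_sub[OF K4_con[OF R ij(2,1) that(1) ij(3)[symmetric] that(3,2)]]; use x' in simp)
  show ?thesis
    by (rule detachedI[OF R ij(1,2) k(1) l c]) (use d l k in auto)
qed

text \<open>A vertex of \<open>q\<close> either lies on \<open>R i j\<close>, and then has the
  contacts it had before, or is detached and has none. So contacts occur only at the ends, and these
  are kept.\<close>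

lemma K4_updI:
  assumes R: "K4_paths R" and ij: "i < 4" "j < 4" "i \<noteq> j"
    and q: "ipath q" "hd q = hd (R i j)" "last q = last (R i j)"
    and qd: "\<forall>x \<in> set q. x \<in> set (R i j) \<or> detached R i j x"
  shows "K4_paths (K4_upd R i j q)"
proof -
  let ?U = "K4_upd R i j q"
  have U: "?U c d = R c d" if "{c, d} \<noteq> {i, j}" for c d
  proof -
    have "\<not> (c = i \<and> d = j)" "\<not> (c = j \<and> d = i)" using that by auto
    then show ?thesis unfolding K4_upd_def by metis
  qed
  have qne: "q \<noteq> []" using q ipath_nonempty by blast
  have Uij: "?U i j = q" "?U j i = rev q" unfolding K4_upd_def using ij(3) by simp_all
  have cq: "con (set q) (set (R c d)) Z" if Z: "con (set (R i j)) (set (R c d)) Z"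
    "Z \<subseteq> set (R i j) \<times> UNIV" and cd: "c < 4" "d < 4" "c \<noteq> d" "{c, d} \<noteq> {i, j}" for c d Z
    unfolding con_def
  proof (intro conjI ballI)
    show "set q \<inter> set (R c d) = {}"
      using qd Z(1) detachedD[OF _ cd] unfolding con_def by blast
    fix u w assume uw: "u \<in> set q" "w \<in> set (R c d)"
    then consider "u \<in> set (R i j)" | "u \<notin> set (R i j)" "detached R i j u" using qd by blast
    then show "E u w \<longleftrightarrow> (u, w) \<in> Z"
    proof cases
      case 1 then show ?thesis using conD[OF Z(1) 1 uw(2)] by simp
    next
      case 2 then show ?thesis using Z(2) detachedD[OF 2(2) cd uw(2)] by blast
    qed
  qed
  have mem: "hd (R i j) \<in> set (R i j)" "last (R i j) \<in> set (R i j)" using K4_hd[OF R ij] K4_last_mem[OF R ij] .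
  have ci: "con (set q) (set (R i k)) {(hd q, hd (R i k))}" and cj: "con (set q) (set (R j k)) {(last q, hd (R j k))}"
    if k: "k < 4" "i \<noteq> k" "j \<noteq> k" for k
  proof -
    show "con (set q) (set (R i k)) {(hd q, hd (R i k))}"
      by (rule cq) (use K4_con[OF R ij(1,2) k(1) ij(3) k(2,3)] mem q ij k in \<open>auto simp: doubleton_eq_iff\<close>)
    have "con (set (R i j)) (set (R j k)) {(last (R i j), hd (R j k))}"
      using K4_con[OF R ij(2,1) k(1) ij(3)[symmetric] k(3,2)] K4_set[OF R ij] K4_last[OF R ij] by simp
    then show "con (set q) (set (R j k)) {(last q, hd (R j k))}"
      by (intro cq) (use mem q ij k in \<open>auto simp: doubleton_eq_iff\<close>)
  qed
  have co: "con (set q) (set (R k l)) {}" if "k < 4" "l < 4" "distinct [i, j, k, l]" for k l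
    by (rule cq) (use K4_con_opp[OF R ij(1,2) that] that in \<open>auto simp: doubleton_eq_iff\<close>)
  have "ipath (?U c d) \<and> ?U d c = rev (?U c d)" if cd: "c < 4" "d < 4" "c \<noteq> d" for c d
  proof (cases "{c, d} = {i, j}")
    case True
    then show ?thesis using Uij q by (auto simp: doubleton_eq_iff)
  next
    case False
    then have "{d, c} \<noteq> {i, j}" by (simp add: insert_commute)
    then show ?thesis using U[OF False] U[of d c] K4_ipath[OF R cd] K4_rev[OF R cd] by simp
  qed
  moreover have "con (set (?U c d)) (set (?U c e)) {(hd (?U c d), hd (?U c e))}"
    if c: "c < 4" "d < 4" "e < 4" "c \<noteq> d" "c \<noteq> e" "d \<noteq> e" for c d e
  proof -
    have main: "con (set (?U c d)) (set (?U c e)) {(hd (?U c d), hd (?U c e))}"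
      if cd: "{c, d} = {i, j}" and c: "c < 4" "d < 4" "e < 4" "c \<noteq> d" "c \<noteq> e" "d \<noteq> e" for c d e
    proof -
      have "{c, e} \<noteq> {i, j}" using cd c by (auto simp: doubleton_eq_iff)
      then have e: "?U c e = R c e" by (rule U)
      consider "c = i" "d = j" | "c = j" "d = i" using cd by (auto simp: doubleton_eq_iff)
      then show ?thesis
      proof cases
        case 1 then show ?thesis using ci[of e] Uij e c by simp
      next
        case 2 then show ?thesis using cj[of e] Uij e c by (simp add: hd_rev)
      qed
    qed
    consider "{c, d} = {i, j}" | "{c, e} = {i, j}" | "{c, d} \<noteq> {i, j}" "{c, e} \<noteq> {i, j}" by blast
    then show ?thesis
    proof cases
      case 1 show ?thesis using main[OF 1 c] .
    next
      case 2 show ?thesis using con_swap1[OF main[OF 2 c(1,3,2,5,4) c(6)[symmetric]]] .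
    next
      case 3 then show ?thesis using U K4_con[OF R c] by simp
    qed
  qed
  moreover have "con (set (?U c d)) (set (?U e f)) {}"
    if c: "c < 4" "d < 4" "e < 4" "f < 4" "distinct [c, d, e, f]" for c d e f
  proof -
    have main: "con (set (?U c d)) (set (?U e f)) {}"
      if cd: "{c, d} = {i, j}" and c: "c < 4" "d < 4" "e < 4" "f < 4" "distinct [c, d, e, f]" for c d e f
    proof -
      have "{e, f} \<noteq> {i, j}" using cd c by (auto simp: doubleton_eq_iff)
      then have e: "?U e f = R e f" by (rule U)
      have "set (?U c d) = set q" using cd Uij by (auto simp: doubleton_eq_iff)
      moreover have "distinct [i, j, e, f]" using cd c by (auto simp: doubleton_eq_iff)
      ultimately show ?thesis using co[of e f] e c by simp
    qed
    consider "{c, d} = {i, j}" | "{e, f} = {i, j}" | "{c, d} \<noteq> {i, j}" "{e, f} \<noteq> {i, j}" by blast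
    then show ?thesis
    proof cases
      case 1 show ?thesis using main[OF 1 c] .
    next
      case 2 show ?thesis by (rule con_swap0[OF main[OF 2 c(3,4,1,2)]]) (use c(5) in auto)
    next
      case 3 then show ?thesis using U K4_con_opp[OF R c] by simp
    qed
  qed
  ultimately show ?thesis unfolding K4_paths_def by blast
qed

end

context even_holes
begin

text \<open>
  A spoke that is shorter than the path \<open>R i j\<close> it replaces would give a smaller structure.
\<close>

lemma short_spoke_detached:
  assumes least: "least_K4 R" and ij: "i < 4" "j < 4" "k < 4" "l < 4" "distinct [i, j, k, l]"
    and S: "ipath (x # S)" "S \<noteq> []" "length (x # S) < length (R i j)"
    and SR: "con (set S) (set (R k l)) {}" "con (set S) (set (R i k)) {}" "con (set S) (set (R i l)) {}"
      "con (set S) (set (R j k)) {(last S, hd (R j k))}" "con (set S) (set (R j l)) {(last S, hd (R j l))}"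
    and x: "x \<notin> set (R k l)" "x \<notin> set (R i k)" "x \<notin> set (R i l)" "x \<notin> set (R j k)" "x \<notin> set (R j l)"
    and nc: "\<And>c d. c < 4 \<Longrightarrow> d < 4 \<Longrightarrow> c \<noteq> d \<Longrightarrow> {c, d} \<noteq> {i, j} \<Longrightarrow> \<not> E x (hd (R c d))"
  shows "con {x} (set (R k l)) {}" "con {x} (set (R i k)) {}" "con {x} (set (R i l)) {}"
proof -
  have R: "K4_paths R" using least by (simp add: least_K4_def)
  have d: "i \<noteq> j" "i \<noteq> k" "i \<noteq> l" "j \<noteq> k" "j \<noteq> l" "k \<noteq> l"
    "j \<noteq> i" "k \<noteq> i" "l \<noteq> i" "k \<noteq> j" "l \<noteq> j" "l \<noteq> k" using ij by auto
  have e: "set (R k i) = set (R i k)" "last (R j k) = hd (R k j)" "last (R j l) = hd (R l j)"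
    "last (R k l) = hd (R l k)" "last (R i l) = hd (R l i)"
    by (rule K4_set[OF R] K4_last[OF R]; use ij d in blast)+
  have pr: "prism (R k l) (R k i @ R i l) (R j k) (R j l)" by (rule K4_prism[OF R ij])
  have neq: "{k, l} \<noteq> {i, j}" "{l, k} \<noteq> {i, j}" "{k, i} \<noteq> {i, j}" "{l, i} \<noteq> {i, j}"
    "{j, k} \<noteq> {i, j}" "{k, j} \<noteq> {i, j}" "{j, l} \<noteq> {i, j}" "{l, j} \<noteq> {i, j}"
    using d by (auto simp: doubleton_eq_iff)
  have ne: "R k i \<noteq> []" "R i l \<noteq> []" using K4_ipath[OF R] ij d ipath_nonempty by blast+
  have corners: "\<not> E x (hd (R k l))" "\<not> E x (last (R k l))" "\<not> E x (hd (R k i @ R i l))"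
    "\<not> E x (last (R k i @ R i l))" "\<not> E x (hd (R j k))" "\<not> E x (last (R j k))"
    "\<not> E x (hd (R j l))" "\<not> E x (last (R j l))"
    using nc[OF ij(3,4) d(6) neq(1)] nc[OF ij(4,3) d(12) neq(2)] nc[OF ij(3,1) d(8) neq(3)]
      nc[OF ij(4,1) d(9) neq(4)] nc[OF ij(2,3) d(4) neq(5)] nc[OF ij(3,2) d(10) neq(6)]
      nc[OF ij(2,4) d(5) neq(7)] nc[OF ij(4,2) d(11) neq(8)] ne
    by (simp_all add: e)
  have SA: "con (set S) (set (R k i @ R i l)) {}"
    using SR e by (intro con_append0) simp_all
  have x2: "x \<notin> set (R k i @ R i l)" using x e by simp
  \<comment> \<open>The spoke replaces \<open>R i j\<close>, and \<open>A1\<close> is merely cut in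
    two, so the new structure is smaller by \<open>length (R i j) - length (x # S)\<close>. The two
    long paths of the prism may be exchanged, which handles neighbours on either of them.\<close>
  have small: False
    if pr: "prism A1 A2 (R j k) (R j l)" and A: "length A1 + length A2 = length (R k l) + length (R k i @ R i l)"
      and h: "con (set S) (set A1) {}" "con (set S) (set A2) {}" "x \<notin> set A1" "x \<notin> set A2"
      "\<not> E x (hd A1)" "\<not> E x (last A1)" "\<not> E x (hd A2)" "\<not> E x (last A2)" "u \<in> set A1" "E x u" for A1 A2 u
  proof -
    obtain p y z q where pq: "A1 = p @ y # z # q" "p \<noteq> []" "q \<noteq> []" "con {x} (set A1) {(x, y), (x, z)}"
      "con {x} (set A2) {}" "con {x} (set (R j k)) {}" "con {x} (set (R j l)) {}"
      using spoke_attachment[OF pr S(1,2) h(1,2) SR(4,5) h(3,4) x(4,5) h(5-8) corners(5-8) h(9,10)]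
      by blast
    define N where "N = K4_of (x # S) (rev (p @ [y])) (z # q) (R j k) (R j l) A2"
    have N: "K4_paths N"
      unfolding N_def using K4_of_spoke[OF pr S(1,2) h(1,2) SR(4,5) pq(1,4-7)] .
    have size: "K4_size N = length (x # S) + length A1 + length A2 + length (R j k) + length (R j l)"
      unfolding N_def K4_size_of pq(1) by simp
    \<comment> \<open>The cut edge is interior to \<open>A1\<close>, which keeps the new structure
      away from the excluded size 6.\<close>
    moreover have "length A1 \<ge> 4" using pq(1-3) by (cases p; cases q) auto
    moreover have "length (R j k) \<ge> 1" "length (R j l) \<ge> 1" using K4_pos[OF R] ij d by blast+
    ultimately have "K4_size N \<noteq> 6" using size S(2) by (cases S) auto
    then have "K4_size R \<le> K4_size N" using least N unfolding least_K4_def by blast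
    moreover have "K4_size R = length (R i j) + length (R k l) + length (R k i @ R i l) + length (R j k) + length (R j l)"
      using K4_size_eq[OF R ij] K4_length[OF R ij(1,3) d(2)] by simp
    ultimately show False using size A S(3) by simp
  qed
  have no1: "\<not> E x u" if "u \<in> set (R k l)" for u
    using small[OF pr _ SR(1) SA x(1) x2 corners(1-4) that] by auto
  have no2: "\<not> E x u" if "u \<in> set (R k i @ R i l)" for u
    using small[OF prism_swap12[OF pr] _ SA SR(1) x2 x(1) corners(3,4,1,2) that] by auto
  show "con {x} (set (R k l)) {}" "con {x} (set (R i k)) {}" "con {x} (set (R i l)) {}"
    using no1 no2 x e by (auto simp: con_def)
qed

end

context sym_rel
begin

text \<open>\<open>a\<close> is the position on \<open>R i j\<close> of a vertex that is roughly in the middle.\<close>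

definition half_path :: "(nat \<Rightarrow> nat \<Rightarrow> 'a list) \<Rightarrow> nat \<Rightarrow> nat \<Rightarrow> nat \<Rightarrow> 'a list \<Rightarrow> bool" where
  "half_path R i j a P \<longleftrightarrow> walk P \<and> hd P = hd (R i j) \<and> last P = R i j ! a \<and> length P \<le> Suc a \<and>
    a < length (R i j) \<and> 2 * a \<le> length (R i j) \<and>
    (\<forall>t. 0 < t \<longrightarrow> Suc t < length P \<longrightarrow>
      (\<forall>c<4. \<forall>d<4. c \<noteq> d \<longrightarrow> {c, d} \<noteq> {i, j} \<longrightarrow> \<not> E (P ! t) (hd (R c d))))"

lemma K4_upd_same: "K4_upd R i j p i j = p"
  and K4_upd_rev: "i \<noteq> j \<Longrightarrow> K4_upd R i j p j i = rev p"
  by (simp_all add: K4_upd_def)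

lemma K4_upd_other: "{c, d} \<noteq> {i, j} \<Longrightarrow> K4_upd R i j p c d = R c d"
proof -
  assume "{c, d} \<noteq> {i, j}"
  then have "\<not> (c = i \<and> d = j)" "\<not> (c = j \<and> d = i)" by auto
  then show ?thesis unfolding K4_upd_def by metis
qed

lemma detached_commute: "detached R i j x \<longleftrightarrow> detached R j i x"
  unfolding detached_def by (simp add: insert_commute)

lemma other_indices:
  assumes "i < 4" "j < 4" "i \<noteq> (j :: nat)"
  obtains k l where "k < 4" "l < 4" "distinct [i, j, k, l]"
proof -
  have "\<exists>k<4. k \<noteq> i \<and> k \<noteq> j"
  proof (rule ccontr)
    assume "\<not> ?thesis"
    then have "{..<4} \<subseteq> {i, j}" by auto
    then have "card {..<4::nat} \<le> card {i, j}" by (rule card_mono[rotated]) simp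
    then show False using assms by simp
  qed
  then obtain k where k: "k < 4" "i \<noteq> k" "j \<noteq> k" by auto
  then show ?thesis using fourth_index[OF assms(1,2) k(1) assms(3) k(2,3)] that by blast
qed

text \<open>Apart from its head, \<open>R i j\<close> has contacts only at its last vertex, and
  detached vertices have none. So a path through such vertices that ends in
  \<open>last (R i j)\<close> behaves like a spoke towards \<open>j\<close>.\<close>

lemma spoke_con:
  assumes R: "K4_paths R" and ij: "i < 4" "j < 4" "k < 4" "l < 4" "distinct [i, j, k, l]"
    and S: "\<forall>s \<in> set S. detached R i j s \<or> s \<in> set (R i j) \<and> s \<noteq> hd (R i j)"
    and last: "last S = last (R i j)"
  shows "con (set S) (set (R k l)) {}" "con (set S) (set (R i k)) {}" "con (set S) (set (R i l)) {}"
    "con (set S) (set (R j k)) {(last S, hd (R j k))}" "con (set S) (set (R j l)) {(last S, hd (R j l))}"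
proof -
  have main: "con (set S) (set (R c d)) Z"
    if cd: "c < 4" "d < 4" "c \<noteq> d" "{c, d} \<noteq> {i, j}"
      and Z: "con (set (R i j) - {hd (R i j)}) (set (R c d)) Z" "\<And>u v. (u, v) \<in> Z \<Longrightarrow> E u v" for c d Z
    unfolding con_def
  proof (intro conjI ballI)
    show "set S \<inter> set (R c d) = {}"
      using S Z(1) detachedD[OF _ cd] unfolding con_def by blast
    fix u w assume uw: "u \<in> set S" "w \<in> set (R c d)"
    then consider "u \<in> set (R i j)" "u \<noteq> hd (R i j)" | "detached R i j u" using S by blast
    then show "E u w \<longleftrightarrow> (u, w) \<in> Z"
    proof cases
      case 1 then show ?thesis using conD[OF Z(1) _ uw(2)] by simp
    next
      case 2 then show ?thesis using Z(2) detachedD[OF 2 cd uw(2)] by blast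
    qed
  qed
  have d: "i \<noteq> j" "i \<noteq> k" "i \<noteq> l" "j \<noteq> k" "j \<noteq> l" "k \<noteq> l" "j \<noteq> i" using ij by auto
  have neq: "{k, l} \<noteq> {i, j}" "{i, k} \<noteq> {i, j}" "{i, l} \<noteq> {i, j}" "{j, k} \<noteq> {i, j}" "{j, l} \<noteq> {i, j}"
    using d by (auto simp: doubleton_eq_iff)
  show "con (set S) (set (R k l)) {}"
    by (rule main[OF ij(3,4) d(6) neq(1)]) (use K4_con_opp[OF R ij] in \<open>auto simp: con_def\<close>)
  show "con (set S) (set (R i k)) {}"
    by (rule main[OF ij(1,3) d(2) neq(2)]) (use K4_con[OF R ij(1,2,3) d(1,2,4)] in \<open>auto simp: con_def\<close>)
  show "con (set S) (set (R i l)) {}"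
    by (rule main[OF ij(1,4) d(3) neq(3)]) (use K4_con[OF R ij(1,2,4) d(1,3,5)] in \<open>auto simp: con_def\<close>)
  have cj: "con (set (R i j)) (set (R j m)) {(last S, hd (R j m))} \<and> E (last S) (hd (R j m))"
    if "m < 4" "i \<noteq> m" "j \<noteq> m" for m
  proof -
    have "con (set (R i j)) (set (R j m)) {(last S, hd (R j m))}"
      using K4_con[OF R ij(2,1) that(1) d(7) that(3,2)] last K4_set[OF R ij(1,2) d(1)] K4_last[OF R ij(1,2) d(1)] by simp
    moreover have "last S \<in> set (R i j)" "hd (R j m) \<in> set (R j m)"
      using K4_last_mem[OF R ij(1,2) d(1)] K4_hd[OF R ij(2) that(1,3)] last by simp_all
    ultimately show ?thesis by (auto simp: con_def)
  qed
  show "con (set S) (set (R j k)) {(last S, hd (R j k))}"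
    by (rule main[OF ij(2,3) d(4) neq(4)]) (use cj[OF ij(3) d(2,4)] in \<open>auto simp: con_def\<close>)
  show "con (set S) (set (R j l)) {(last S, hd (R j l))}"
    by (rule main[OF ij(2,4) d(5) neq(5)]) (use cj[OF ij(4) d(3,5)] in \<open>auto simp: con_def\<close>)
qed

lemma walk_to_spoke:
  assumes "walk (x # w)" "x \<noteq> last w" "w \<noteq> []"
  obtains S where "ipath (x # S)" "S \<noteq> []" "last S = last w" "set S \<subseteq> set w" "length S \<le> length w"
proof -
  obtain q where q: "ipath q" "hd q = x" "last q = last w" "set q \<subseteq> insert x (set w)" "q = x # w \<or> length q < length (x # w)"
    using walk_to_ipath[OF assms(1)] assms(3) by auto
  then obtain S where S: "q = x # S" by (cases q) auto
  then have "S \<noteq> []" using q assms by auto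
  moreover have "x \<notin> set S" using ipath_distinct[OF q(1)] S by simp
  moreover have "set S \<subseteq> set w" using q(4) S \<open>x \<notin> set S\<close> by auto
  moreover have "length S \<le> length w" using q(5) S by auto
  ultimately show ?thesis using that[of S] q S by simp
qed

end

context even_holes
begin

text \<open>
  The last vertex of the half path that attaches to the other five paths starts spokes to both
  ends of \<open>R i j\<close>, through the middle, and both are short. Hence its neighbours lie both in the
  paths at \<open>i\<close> and in those at \<open>j\<close>.
\<close>

lemma half_path_detached:
  assumes least: "least_K4 R" and ij: "i < 4" "j < 4" "i \<noteq> j"
    and P: "half_path R i j a P" and t: "0 < t" "Suc t < length P"
  shows "detached R i j (P ! t)"
proof (rule ccontr)
  assume neg: "\<not> ?thesis"
  note P' = P[unfolded half_path_def]
  have R: "K4_paths R" using least by (simp add: least_K4_def)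
  obtain k l where kl: "k < 4" "l < 4" "distinct [i, j, k, l]" using other_indices[OF ij] .
  define T where "T = {t. 0 < t \<and> Suc t < length P \<and> \<not> detached R i j (P ! t)}"
  have T: "finite T" "T \<noteq> {}"
    using neg t by (auto simp: T_def intro: finite_subset[of _ "{..<length P}"])
  \<comment> \<open>The last offending position: all vertices after it up to the middle are
    detached, so spokes can use that stretch.\<close>
  define s where "s = Max T"
  have s: "0 < s" "Suc s < length P" "\<not> detached R i j (P ! s)"
    using Max_in[OF T] by (auto simp: s_def T_def)
  have later: "detached R i j (P ! r)" if "s < r" "Suc r < length P" for r
    using Max_ge[OF T(1), of r] that unfolding s_def[symmetric] by (force simp: T_def)
  let ?L = "length (R i j)"
  define x where "x = P ! s"
  define w where "w = drop (Suc s) P"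
  \<comment> \<open>\<open>P\<close> has an inner vertex, hence at least three vertices, and so
    \<open>2 \<le> a\<close>; with \<open>2 * a \<le> ?L\<close> the middle is an inner vertex of
    \<open>R i j\<close>.\<close>
  have a: "2 \<le> a" "Suc a < ?L" "2 * a \<le> ?L" "length P \<le> Suc a" using P' s by auto
  have ip: "ipath (R i j)" by (rule K4_ipath[OF R ij])
  note dist = ipath_distinct[OF ip]
  have w: "w \<noteq> []" "walk w" "hd w = P ! Suc s" "last w = R i j ! a" "length w = length P - Suc s"
    using s P' by (auto simp: w_def hd_drop_conv_nth walk_nth)
  have xw: "E x (hd w)" using P' s(2) by (simp add: x_def w(3) walk_nth)
  have hl: "hd (R i j) = R i j ! 0" "last (R i j) = R i j ! (?L - 1)" "R i j \<noteq> []"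
  proof -
    show ne: "R i j \<noteq> []" using a by auto
    show "hd (R i j) = R i j ! 0" "last (R i j) = R i j ! (?L - 1)"
      using ne by (simp_all add: hd_conv_nth last_conv_nth)
  qed
  have "detached R i j (R i j ! a)"
  proof (rule K4_inner_detached[OF R ij])
    show "R i j ! a \<in> set (R i j)" using a by simp
    have "a < ?L" "0 < ?L" "?L - 1 < ?L" "a \<noteq> 0" "a \<noteq> ?L - 1" using a by linarith+
    then show "R i j ! a \<noteq> hd (R i j)" "R i j ! a \<noteq> last (R i j)"
      unfolding hl(1,2) using nth_eq_iff_index_eq[OF dist] by blast+
  qed
  then have wd: "detached R i j y" if yw: "y \<in> set w" for y
  proof -
    obtain r where r: "r < length w" "y = w ! r" using yw by (metis in_set_conv_nth)
    then have y: "y = P ! (Suc s + r)" "Suc s + r < length P"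
      by (simp_all add: w_def less_diff_conv add.commute)
    show ?thesis
    proof (cases "Suc (Suc s + r) < length P")
      case True
      then show ?thesis unfolding y(1) by (intro later) simp_all
    next
      case False
      then have "Suc s + r = length P - 1" "P \<noteq> []" using y(2) by auto
      then have "y = R i j ! a" using P' y(1) by (simp add: last_conv_nth)
      then show ?thesis using \<open>detached R i j (R i j ! a)\<close> by simp
    qed
  qed
  have hw: "hd w \<in> set w" using w(1) by simp
  have corner: "\<not> E x (hd (R c d))" if "c < 4" "d < 4" "c \<noteq> d" "{c, d} \<noteq> {i, j}" for c d
  proof -
    have "\<forall>c<4. \<forall>d<4. c \<noteq> d \<longrightarrow> {c, d} \<noteq> {i, j} \<longrightarrow> \<not> E (P ! s) (hd (R c d))"
      using P' s by simp
    then show ?thesis using that unfolding x_def by blast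
  qed
  have corner': "\<not> E x (hd (R c d))" if "c < 4" "d < 4" "c \<noteq> d" "{c, d} \<noteq> {j, i}" for c d
    by (rule corner[OF that(1-3)]) (use that(4) in \<open>simp add: insert_commute[of i]\<close>)
  have xR: "x \<notin> set (R c d)" if "c < 4" "d < 4" "c \<noteq> d" "{c, d} \<noteq> {i, j}" for c d
    using detachedD[OF wd[OF hw] that, of x] xw by auto
  have d: "i \<noteq> j" "i \<noteq> k" "i \<noteq> l" "j \<noteq> k" "j \<noteq> l" "k \<noteq> l" "j \<noteq> i" using kl by auto
  have neq: "{k, l} \<noteq> {i, j}" "{i, k} \<noteq> {i, j}" "{i, l} \<noteq> {i, j}" "{j, k} \<noteq> {i, j}" "{j, l} \<noteq> {i, j}"
    using d by (auto simp: doubleton_eq_iff)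
  have x5: "x \<notin> set (R k l)" "x \<notin> set (R i k)" "x \<notin> set (R i l)" "x \<notin> set (R j k)" "x \<notin> set (R j l)"
    using xR neq d ij kl by simp_all
  have Ehd: "E (hd (R i j)) (hd (R i k))" "E (hd (R j i)) (hd (R j k))"
    using K4_con[OF R ij(1,2) kl(1) d(1,2,4)] K4_con[OF R ij(2,1) kl(1) d(7,4,2)]
      K4_hd[OF R ij] K4_hd[OF R ij(2,1) d(7)] K4_hd[OF R ij(1) kl(1) d(2)] K4_hd[OF R ij(2) kl(1) d(4)]
    by (auto simp: con_def)
  \<comment> \<open>The ends of \<open>R i j\<close> are adjacent to ends of other paths, which
    inner vertices of a half path are not.\<close>
  have xe: "x \<noteq> hd (R i j)" "x \<noteq> last (R i j)"
    using Ehd corner[OF ij(1) kl(1) d(2) neq(2)] corner[OF ij(2) kl(1) d(4) neq(4)] K4_last[OF R ij] by auto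
  \<comment> \<open>From \<open>x\<close> through the middle to the end at \<open>j\<close>. At most
    \<open>a - s\<close> vertices of \<open>P\<close> follow \<open>x\<close>, and
    \<open>?L - Suc a\<close> vertices of \<open>R i j\<close> follow the middle, so
    \<open>x # S\<close> has at most \<open>?L - s\<close> vertices.\<close>
  obtain S where S: "ipath (x # S)" "S \<noteq> []" "last S = last (R i j)" "set S \<subseteq> set (w @ drop (Suc a) (R i j))"
    "length S \<le> length (w @ drop (Suc a) (R i j))"
  proof (rule walk_to_spoke[of x "w @ drop (Suc a) (R i j)"])
    have "walk (drop (Suc a) (R i j))" "E (R i j ! a) (R i j ! Suc a)"
      using ipath_walk[OF ip] a by (simp_all add: walk_nth)
    then have "walk (w @ drop (Suc a) (R i j))"
      using w a by (subst walk_append) (auto simp: hd_drop_conv_nth)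
    then show "walk (x # w @ drop (Suc a) (R i j))"
      using xw w(1) by (cases w) auto
  qed (use a xe w in auto)
  have S1: "con {x} (set (R k l)) {}" "con {x} (set (R i k)) {}" "con {x} (set (R i l)) {}"
  proof -
    have "length (x # S) < ?L" using S(5) a s(1) w(5) by simp
    moreover have "\<forall>y \<in> set S. detached R i j y \<or> y \<in> set (R i j) \<and> y \<noteq> hd (R i j)"
    proof
      fix y assume "y \<in> set S"
      then consider "y \<in> set w" | "y \<in> set (drop (Suc a) (R i j))" using S by auto
      then show "detached R i j y \<or> y \<in> set (R i j) \<and> y \<noteq> hd (R i j)"
      proof cases
        case 2
        then obtain r where "r < length (drop (Suc a) (R i j))" "y = drop (Suc a) (R i j) ! r"
          by (metis in_set_conv_nth)
        then have "Suc a + r < ?L" "y = R i j ! (Suc a + r)" by auto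
        then have "y \<in> set (R i j)" "y \<noteq> hd (R i j)" using dist hl by (auto simp: nth_eq_iff_index_eq)
        then show ?thesis by simp
      qed (use wd in blast)
    qed
    note c = spoke_con[OF R ij(1,2) kl this S(3)]
    ultimately show "con {x} (set (R k l)) {}" "con {x} (set (R i k)) {}" "con {x} (set (R i l)) {}"
      using short_spoke_detached[OF least ij(1,2) kl S(1,2) _ c x5] corner by blast+
  qed
  obtain S' where S': "ipath (x # S')" "S' \<noteq> []" "last S' = hd (R i j)"
    "set S' \<subseteq> set w \<union> set (take a (R i j))" "length (x # S') < ?L"
  \<comment> \<open>Back from the middle to the end at \<open>i\<close> the count is at most
    \<open>2 * a + 1 - s\<close>, which is sure to be below \<open>?L\<close> only for
    \<open>s \<ge> 2\<close>. For \<open>s = 1\<close> the vertex \<open>x\<close> follows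
    \<open>hd (R i j)\<close> on \<open>P\<close>, and \<open>[hd (R i j)]\<close> is a spoke by
    itself.\<close>
  proof (cases "s = 1")
    case True
    have "E (P ! 0) (P ! 1)" using P' s(2) True by (simp add: walk_nth)
    moreover have "P ! 0 = hd (R i j)" using P' s(2) by (metis hd_conv_nth list.size(3) not_less0)
    ultimately have "E x (hd (R i j))" using True E_commute by (simp add: x_def)
    moreover have "hd (R i j) \<in> set (take a (R i j))" using a hl by (cases "R i j"; cases a) auto
    ultimately show ?thesis using that[of "[hd (R i j)]"] xe a by simp
  next
    case False
    let ?v = "w @ rev (take a (R i j))"
    have tk: "take a (R i j) \<noteq> []" "hd (take a (R i j)) = hd (R i j)" "last (take a (R i j)) = R i j ! (a - 1)"
      using a hl by (auto simp: last_conv_nth hd_conv_nth min_def)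
    have "Suc (a - 1) = a" "Suc (a - 1) < ?L" using a by linarith+
    then have "walk (take a (R i j))" "E (R i j ! (a - 1)) (R i j ! a)"
      using ipath_walk[OF ip] tk(1) unfolding walk_nth by (auto, metis)
    then have "walk ?v"
      using w a tk E_commute[of "R i j ! a"] walk_rev[of "take a (R i j)"] by (subst walk_append) (auto simp: hd_rev)
    then have "walk (x # ?v)" using xw w(1) by (cases w) auto
    moreover have l: "last ?v = hd (R i j)" using tk by (simp add: last_rev)
    ultimately obtain S' where "ipath (x # S')" "S' \<noteq> []" "last S' = last ?v" "set S' \<subseteq> set ?v" "length S' \<le> length ?v"
      using walk_to_spoke[of x ?v] xe w(1) by (metis append_is_Nil_conv)
    then show ?thesis using that[of S'] l a s(1) False w(5) by (auto simp: min_def)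
  qed
  \<comment> \<open>The same argument with \<open>i\<close> and \<open>j\<close> exchanged; together
    with \<open>S1\<close> it covers all five other paths.\<close>
  have S2: "con {x} (set (R k l)) {}" "con {x} (set (R j k)) {}" "con {x} (set (R j l)) {}"
  proof -
    have len: "length (x # S') < length (R j i)" using S'(5) K4_length[OF R ij] by simp
    have last: "last S' = last (R j i)" using S'(3) K4_last[OF R ij(2,1) d(7)] by simp
    have el: "\<forall>y \<in> set S'. detached R j i y \<or> y \<in> set (R j i) \<and> y \<noteq> hd (R j i)"
    proof
      fix y assume "y \<in> set S'"
      then consider "y \<in> set w" | "y \<in> set (take a (R i j))" using S' by auto
      then show "detached R j i y \<or> y \<in> set (R j i) \<and> y \<noteq> hd (R j i)"
      proof cases
        case 2
        then obtain r where "r < a" "y = R i j ! r" by (auto simp: in_set_conv_nth)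
        then have "y \<in> set (R i j)" "y \<noteq> last (R i j)" using dist hl a by (auto simp: nth_eq_iff_index_eq)
        then show ?thesis using K4_set[OF R ij] K4_last[OF R ij] by simp
      qed (use wd detached_commute in blast)
    qed
    have kl': "distinct [j, i, k, l]" using kl(3) by auto
    note c = spoke_con[OF R ij(2,1) kl(1,2) kl' el last]
    show "con {x} (set (R k l)) {}" "con {x} (set (R j k)) {}" "con {x} (set (R j l)) {}"
      using short_spoke_detached[OF least ij(2,1) kl(1,2) kl' S'(1,2) len c x5(1,4,5,2,3)] corner' by blast+
  qed
  have "detached R i j x"
    using detachedI[OF R ij(1,2) kl S1(1,2,3) S2(2,3)] .
  then show False using s(3) by (simp add: x_def)
qed

text \<open>\<open>P\<close> followed by the rest of \<open>R i j\<close> is a walk with the ends of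
  \<open>R i j\<close> and at most its length, all of whose vertices lie on \<open>R i j\<close> or
  are detached. An induced path inside it gives a structure again; minimality leaves no room for
  shortening, so the walk is itself induced and \<open>P\<close> has exactly \<open>Suc a\<close>
  vertices.\<close>

lemma half_path_replace:
  assumes least: "least_K4 R" and ij: "i < 4" "j < 4" "i \<noteq> j" and P: "half_path R i j a P"
  shows "length P = Suc a" "least_K4 (K4_upd R i j (P @ drop (Suc a) (R i j)))"
    "K4_size (K4_upd R i j (P @ drop (Suc a) (R i j))) = K4_size R"
proof -
  note P' = P[unfolded half_path_def]
  have R: "K4_paths R" using least by (simp add: least_K4_def)
  obtain k l where kl: "k < 4" "l < 4" "distinct [i, j, k, l]" using other_indices[OF ij] .
  let ?L = "length (R i j)"
  let ?w = "P @ drop (Suc a) (R i j)"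
  have ip: "ipath (R i j)" by (rule K4_ipath[OF R ij])
  have a: "a < ?L" using P' by simp
  have Pne: "P \<noteq> []" using P' by auto
  have w: "walk ?w" "hd ?w = hd (R i j)" "last ?w = last (R i j)"
  proof -
    show "walk ?w"
    proof (cases "Suc a < ?L")
      case True
      have "walk (drop (Suc a) (R i j))" "E (R i j ! a) (R i j ! Suc a)"
        using ipath_walk[OF ip] True by (simp_all add: walk_nth)
      then show ?thesis using P' Pne True by (subst walk_append) (auto simp: hd_drop_conv_nth)
    qed (use P' in simp)
    show "hd ?w = hd (R i j)" using P' Pne by simp
    show "last ?w = last (R i j)"
    proof (cases "Suc a < ?L")
      case False
      then have "a = ?L - 1" using a by simp
      then show ?thesis using P' a by (metis False append_Nil2 drop_all last_conv_nth list.size(3) not_less not_less0)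
    qed simp
  qed
  obtain q where q: "ipath q" "hd q = hd ?w" "last q = last ?w" "set q \<subseteq> set ?w" "q = ?w \<or> length q < length ?w"
    using walk_to_ipath[OF w(1)] by blast
  have "\<forall>x \<in> set q. x \<in> set (R i j) \<or> detached R i j x"
  proof
    fix x assume "x \<in> set q"
    then consider "x \<in> set (R i j)" | "x \<in> set P" using q(4) by (auto dest: in_set_dropD)
    then show "x \<in> set (R i j) \<or> detached R i j x"
    proof cases
      case 2
      then obtain t where t: "t < length P" "x = P ! t" by (metis in_set_conv_nth)
      consider "t = 0" | "0 < t" "Suc t < length P" | "Suc t = length P" using t by linarith
      then show ?thesis
      proof cases
        case 1
        then have "x = hd (R i j)" using t P' Pne by (simp add: hd_conv_nth)
        then show ?thesis using K4_hd[OF R ij] by simp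
      next
        case 2
        then show ?thesis using half_path_detached[OF least ij P] t by simp
      next
        case 3
        then have "x = last P" using t Pne by (simp add: last_conv_nth flip: 3)
        then show ?thesis using P' by simp
      qed
    qed simp
  qed
  then have Q: "K4_paths (K4_upd R i j q)" using K4_updI[OF R ij q(1)] q w by simp
  have size: "K4_size (K4_upd R i j q) + ?L = K4_size R + length q"
  proof -
    have "K4_upd R i j q i j = q" by (rule K4_upd_same)
    moreover have "K4_upd R i j q i k = R i k" "K4_upd R i j q i l = R i l" "K4_upd R i j q j k = R j k"
      "K4_upd R i j q j l = R j l" "K4_upd R i j q k l = R k l"
      by (rule K4_upd_other; use kl in \<open>auto simp: doubleton_eq_iff\<close>)+
    ultimately show ?thesis
      using K4_size_eq[OF Q ij(1,2) kl] K4_size_eq[OF R ij(1,2) kl] by simp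
  qed
  \<comment> \<open>Size 6 would force \<open>q\<close> to be a single vertex; then the ends of
    \<open>R i j\<close> coincide, \<open>R i j\<close> is a single vertex too, and \<open>R\<close>
    itself has size 6.\<close>
  have "K4_size (K4_upd R i j q) \<noteq> 6"
  proof
    assume s6: "K4_size (K4_upd R i j q) = 6"
    have pos: "length (R i k) \<ge> 1" "length (R i l) \<ge> 1" "length (R j k) \<ge> 1" "length (R j l) \<ge> 1" "length (R k l) \<ge> 1"
      by (rule K4_pos[OF R]; use ij kl in auto)+
    have "length q \<ge> 1" using q(1) by (cases q) auto
    then have "length q = 1"
      using size s6 pos K4_size_eq[OF R ij(1,2) kl] by simp
    then have "hd (R i j) = last (R i j)" using q w hd_last_ends by metis
    then have "?L = 1" using hd_last_ends[OF ip] by simp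
    then show False using size s6 \<open>length q = 1\<close> least by (simp add: least_K4_def)
  qed
  then have "K4_size R \<le> K4_size (K4_upd R i j q)" using least Q unfolding least_K4_def by blast
  then have "?L \<le> length q" using size by simp
  moreover have "length P \<le> Suc a" using P' by blast
  then have "length ?w \<le> ?L" using a by simp
  ultimately have qw: "q = ?w" "length ?w = ?L" using q(5) by auto
  show "length P = Suc a" using qw(2) a \<open>length P \<le> Suc a\<close> by simp
  show "K4_size (K4_upd R i j ?w) = K4_size R" using size qw by simp
  then show "least_K4 (K4_upd R i j ?w)" using Q qw(1) least unfolding least_K4_def by simp
qed

text \<open>The indices \<open>a i j\<close> and \<open>a j i\<close> are the positions of the same vertex, seen from both ends.\<close>

lemma all_halves_replace:
  assumes least: "least_K4 R"
    and a: "\<And>i j. i < 4 \<Longrightarrow> j < 4 \<Longrightarrow> i \<noteq> j \<Longrightarrow> Suc (a i j + a j i) = length (R i j)"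
    and P: "\<And>i j. i < 4 \<Longrightarrow> j < 4 \<Longrightarrow> i \<noteq> j \<Longrightarrow> half_path R i j (a i j) (P i j)"
    and R': "\<And>i j. i < 4 \<Longrightarrow> j < 4 \<Longrightarrow> i \<noteq> j \<Longrightarrow> R' i j = P i j @ tl (rev (P j i))"
  shows "K4_paths R'" "K4_size R' = K4_size R"
proof -
  define U where "U = {(i, j). i < 4 \<and> j < 4 \<and> i \<noteq> (j :: nat)}"
  have "finite U" by (rule finite_subset[of _ "{..<4} \<times> {..<4}"]) (auto simp: U_def)
  \<comment> \<open>Induction on the set \<open>D\<close> of oriented halves already exchanged.
    Lengths, heads and middle vertices are kept for all pairs, so the remaining \<open>P i j\<close>
    are half paths of \<open>Q\<close> as well as of \<open>R\<close>.\<close>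
  have "\<exists>Q. least_K4 Q \<and> K4_size Q = K4_size R \<and>
      (\<forall>(i, j) \<in> U. length (Q i j) = length (R i j) \<and> hd (Q i j) = hd (R i j) \<and> Q i j ! a i j = R i j ! a i j) \<and>
      (\<forall>(i, j) \<in> D. take (Suc (a i j)) (Q i j) = P i j)" if "finite D" "D \<subseteq> U" for D
    using that
  proof (induction D rule: finite_induct)
    case empty
    show ?case by (rule exI[of _ R]) (use least in auto)
  next
    case (insert e D)
    obtain i j where e: "e = (i, j)" by force
    then have ij: "i < 4" "j < 4" "i \<noteq> j" and ijU: "(i, j) \<in> U" "(j, i) \<in> U" using insert.prems by (auto simp: U_def)
    obtain Q where Q: "least_K4 Q" "K4_size Q = K4_size R"
      "\<forall>(i, j) \<in> U. length (Q i j) = length (R i j) \<and> hd (Q i j) = hd (R i j) \<and> Q i j ! a i j = R i j ! a i j"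
      "\<forall>(i, j) \<in> D. take (Suc (a i j)) (Q i j) = P i j"
      using insert by auto
    have QK: "K4_paths Q" using Q(1) by (simp add: least_K4_def)
    have hP: "half_path Q i j (a i j) (P i j)"
    proof -
      have "hd (Q c d) = hd (R c d)" if "c < 4" "d < 4" "c \<noteq> d" for c d
        using Q(3) that by (auto simp: U_def)
      moreover have "length (Q i j) = length (R i j)" "Q i j ! a i j = R i j ! a i j"
        using Q(3) ijU by auto
      ultimately show ?thesis using P[OF ij] ij unfolding half_path_def by simp
    qed
    let ?v = "P i j @ drop (Suc (a i j)) (Q i j)"
    let ?Q = "K4_upd Q i j ?v"
    note new = half_path_replace[OF Q(1) ij hP]
    have aL: "Suc (a i j + a j i) = length (Q i j)" using a[OF ij] Q(3) ijU by auto
    have Pl: "last (P i j) = Q i j ! a i j" "hd (P i j) = hd (Q i j)" "P i j \<noteq> []"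
      using hP new(1) by (auto simp: half_path_def)
    have up: "?Q c d = Q c d" if "(c, d) \<noteq> (i, j)" "(c, d) \<noteq> (j, i)" for c d
      by (rule K4_upd_other) (use that in \<open>auto simp: doubleton_eq_iff\<close>)
    have upij: "?Q i j = ?v" "?Q j i = rev ?v" by (rule K4_upd_same, rule K4_upd_rev[OF ij(3)])
    have len: "length ?v = length (Q i j)" using new(1) aL by simp
    have Qji: "Q j i = rev (Q i j)" using K4_rev[OF QK ij] .
    have va: "?v ! a i j = Q i j ! a i j"
      using Pl new(1) by (simp add: nth_append last_conv_nth)
    have drop_v: "drop (a i j) ?v = drop (a i j) (Q i j)"
    proof -
      have "drop (a i j) ?v = ?v ! a i j # drop (Suc (a i j)) ?v"
        using len aL by (intro Cons_nth_drop_Suc[symmetric]) simp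
      also have "drop (Suc (a i j)) ?v = drop (Suc (a i j)) (Q i j)" using new(1) by simp
      also have "?v ! a i j # \<dots> = drop (a i j) (Q i j)"
        unfolding va using aL by (intro Cons_nth_drop_Suc) simp
      finally show ?thesis .
    qed
    \<comment> \<open>Nothing changes from the middle on, so the half seen from \<open>j\<close>,
      which may have been exchanged earlier, survives.\<close>
    have take_ji: "take (Suc (a j i)) (rev ?v) = take (Suc (a j i)) (Q j i)"
    proof -
      have "length ?v - Suc (a j i) = a i j" "length (Q i j) - Suc (a j i) = a i j" using len aL by simp_all
      then show ?thesis unfolding Qji take_rev using drop_v by simp
    qed
    have keep: "length (?Q c d) = length (R c d) \<and> hd (?Q c d) = hd (R c d) \<and> ?Q c d ! a c d = R c d ! a c d"
      if cd: "(c, d) \<in> U" for c d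
    proof -
      have old: "length (Q c d) = length (R c d)" "hd (Q c d) = hd (R c d)" "Q c d ! a c d = R c d ! a c d"
        using Q(3) cd by auto
      consider "(c, d) = (i, j)" | "(c, d) = (j, i)" | "(c, d) \<noteq> (i, j)" "(c, d) \<noteq> (j, i)" by blast
      then show ?thesis
      proof cases
        case 1
        then show ?thesis using old upij(1) len va Pl by simp
      next
        case 2
        have "rev ?v ! a j i = Q j i ! a j i" using take_ji by (metis lessI nth_take)
        moreover have "hd (rev ?v) = hd (Q j i)"
          using take_ji by (metis hd_take zero_less_Suc)
        moreover have "length (rev ?v) = length (Q j i)" using len Qji by simp
        ultimately show ?thesis using old 2 upij(2) by simp
      qed (use up old in simp)
    qed
    have "take (Suc (a c d)) (?Q c d) = P c d" if cd: "(c, d) \<in> insert e D" for c d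
    proof -
      consider "(c, d) = (i, j)" | "(c, d) = (j, i)" "(c, d) \<in> D" | "(c, d) \<noteq> (i, j)" "(c, d) \<noteq> (j, i)" "(c, d) \<in> D"
        using cd e by blast
      then show ?thesis
      proof cases
        case 1 then show ?thesis using upij(1) new(1) by simp
      next
        case 2 then show ?thesis using upij(2) take_ji Q(4) by auto
      next
        case 3 then show ?thesis using up Q(4) by auto
      qed
    qed
    then show ?case using new Q(2) keep by (intro exI[of _ ?Q]) auto
  qed
  from this[OF \<open>finite U\<close>] obtain Q where Q: "least_K4 Q" "K4_size Q = K4_size R"
      "\<forall>(i, j) \<in> U. length (Q i j) = length (R i j)"
      "\<forall>(i, j) \<in> U. take (Suc (a i j)) (Q i j) = P i j" by blast
  have QK: "K4_paths Q" using Q(1) by (simp add: least_K4_def)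
  \<comment> \<open>Both halves of each path are now prescribed; \<open>tl\<close> drops the second
    copy of the middle vertex.\<close>
  have QR: "Q i j = R' i j" if ij: "i < 4" "j < 4" "i \<noteq> j" for i j
  proof -
    have U: "(i, j) \<in> U" "(j, i) \<in> U" using ij by (auto simp: U_def)
    have aL: "Suc (a i j + a j i) = length (Q i j)" using a[OF ij] Q(3) U by auto
    have "P j i = rev (drop (a i j) (Q i j))"
    proof -
      have "P j i = take (Suc (a j i)) (rev (Q i j))" using Q(4) U K4_rev[OF QK ij] by auto
      moreover have "length (Q i j) - Suc (a j i) = a i j" using aL by simp
      ultimately show ?thesis by (simp add: take_rev)
    qed
    then have "tl (rev (P j i)) = drop (Suc (a i j)) (Q i j)" by (simp add: drop_Suc tl_drop)
    moreover have "P i j = take (Suc (a i j)) (Q i j)" using Q(4) U by auto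
    ultimately show ?thesis using R'[OF ij] by simp
  qed
  note RQ = QR[symmetric]
  show "K4_paths R'"
    unfolding K4_paths_def
  proof (intro conjI allI impI)
    fix i j k l :: nat assume ij: "i < 4" "j < 4"
    show "ipath (R' i j)" "R' j i = rev (R' i j)" if "i \<noteq> j"
      using K4_ipath[OF QK ij that] K4_rev[OF QK ij that] RQ[OF ij that] RQ[OF ij(2,1) that[symmetric]] by simp_all
    assume k: "k < 4"
    show "con (set (R' i j)) (set (R' i k)) {(hd (R' i j), hd (R' i k))}" if "i \<noteq> j" "i \<noteq> k" "j \<noteq> k"
      using K4_con[OF QK ij k that] RQ[OF ij that(1)] RQ[OF ij(1) k that(2)] by simp
    assume l: "l < 4" "distinct [i, j, k, l]"
    then have "i \<noteq> j" "k \<noteq> l" by auto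
    then show "con (set (R' i j)) (set (R' k l)) {}"
      using K4_con_opp[OF QK ij k l] RQ[OF ij] RQ[OF k l(1)] by simp
  qed
  show "K4_size R' = K4_size R"
    using Q(2) QR unfolding K4_size_def by simp
qed

text \<open>Cycles through four of the paths are always holes; cycles through three are holes unless
  all three paths are single vertices. In that case the four-cycles give the other three paths equal
  parity, so every triangle through the fourth index has odd sum and consists of single vertices as
  well, and the size is 6.\<close>

lemma K4_even_triangle:
  assumes R: "K4_paths R" and s: "K4_size R \<noteq> 6" and ij: "i < 4" "j < 4" "k < 4" "distinct [i, j, k]"
  shows "even (length (R i j) + length (R j k) + length (R k i))"
proof -
  have cyc: "even (length (R i j) + length (R j k) + length (R k i)) \<or>
      (length (R i j) = 1 \<and> length (R j k) = 1 \<and> length (R k i) = 1)"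
    if ij: "i < 4" "j < 4" "k < 4" "i \<noteq> j" "i \<noteq> k" "j \<noteq> k" for i j k
  proof (cases "length (R i j) + length (R j k) + length (R k i) \<ge> 4")
    case True
    have e: "set (R i j) = set (R j i)" "last (R i j) = hd (R j i)" "set (R j k) = set (R k j)" "last (R j k) = hd (R k j)"
      "set (R k i) = set (R i k)" "last (R k i) = hd (R i k)"
      by (rule K4_set[OF R] K4_last[OF R]; use ij in simp)+
    have ne: "R i j \<noteq> []" "R j k \<noteq> []" "R k i \<noteq> []" using K4_ipath[OF R] ij ipath_nonempty by metis+
    have c1: "con (set (R i j)) (set (R j k)) {(last (R i j), hd (R j k))}"
      using K4_con[OF R ij(2,1,3)] ij e by simp
    have c2: "con (set (R k i)) (set (R i j)) {(last (R k i), hd (R i j))}"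
      using K4_con[OF R ij(1,3,2)] ij by (simp add: e(5,6))
    have c3: "con (set (R k i)) (set (R j k)) {(hd (R k i), last (R j k))}"
      using K4_con[OF R ij(3,1,2)] ij by (simp add: e(3,4))
    have ip: "ipath (R i j @ R j k)" using c1 ne K4_ipath[OF R] ij by (simp add: ipath_append)
    have "con (set (R k i)) (set (R i j) \<union> set (R j k)) ({(last (R k i), hd (R i j))} \<union> {(hd (R k i), last (R j k))})"
      by (rule con_Un[OF c2 c3]) (use ne c1 in \<open>auto simp: con_def\<close>)
    then have "even (length (R k i) + length (R i j @ R j k))"
      using ip ne True K4_ipath[OF R ij(3,1)] ij by (intro even_hole) (auto simp: insert_commute)
    then show ?thesis by (simp add: add.commute add.left_commute)
  next
    case False
    moreover have "length (R i j) \<ge> 1" "length (R j k) \<ge> 1" "length (R k i) \<ge> 1"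
      using K4_pos[OF R] ij by simp_all
    ultimately show ?thesis by linarith
  qed
  have cyc4: "even (length (R i j) + length (R j k) + length (R k l) + length (R l i))"
    if ij: "i < 4" "j < 4" "k < 4" "l < 4" "distinct [i, j, k, l]" for i j k l
  proof -
    have d: "i \<noteq> j" "i \<noteq> k" "i \<noteq> l" "j \<noteq> k" "j \<noteq> l" "k \<noteq> l" using ij by auto
    have e: "set (R i j) = set (R j i)" "last (R i j) = hd (R j i)" "set (R j k) = set (R k j)" "last (R j k) = hd (R k j)"
      "set (R k l) = set (R l k)" "last (R k l) = hd (R l k)" "set (R l i) = set (R i l)" "last (R l i) = hd (R i l)"
      by (rule K4_set[OF R] K4_last[OF R]; use ij d in metis)+
    have ne: "R i j \<noteq> []" "R j k \<noteq> []" "R k l \<noteq> []" "R l i \<noteq> []" using K4_ipath[OF R] ij d ipath_nonempty by metis+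
    have c1: "con (set (R i j)) (set (R j k)) {(last (R i j), hd (R j k))}"
      using K4_con[OF R ij(2,1,3)] d e by simp
    have c2: "con (set (R k l)) (set (R l i)) {(last (R k l), hd (R l i))}"
      using K4_con[OF R ij(4,3,1)] d by (simp add: e(5,6))
    have c3: "con (set (R j k)) (set (R k l)) {(last (R j k), hd (R k l))}"
      using K4_con[OF R ij(3,2,4)] d by (simp add: e(3,4))
    have c4: "con (set (R i j)) (set (R l i)) {(hd (R i j), last (R l i))}"
      using K4_con[OF R ij(1,2,4)] d by (simp add: e(7,8))
    have c5: "con (set (R i j)) (set (R k l)) {}" "con (set (R j k)) (set (R l i)) {}"
      by (rule K4_con_opp[OF R]; use ij d in auto)+
    have ip: "ipath (R i j @ R j k)" "ipath (R k l @ R l i)"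
      using c1 c2 ne K4_ipath[OF R] ij d by (simp_all add: ipath_append)
    have dj: "set (R k l) \<inter> set (R l i) = {}" using c2 by (simp add: con_def)
    have "con (set (R i j)) (set (R k l) \<union> set (R l i)) ({} \<union> {(hd (R i j), last (R l i))})"
      by (rule con_Un[OF c5(1) c4 _ _ dj]) (use ne in auto)
    moreover have "con (set (R j k)) (set (R k l) \<union> set (R l i)) ({(last (R j k), hd (R k l))} \<union> {})"
      by (rule con_Un[OF c3 c5(2) _ _ dj]) (use ne in auto)
    moreover have "set (R i j) \<inter> set (R j k) = {}" using c1 by (simp add: con_def)
    ultimately have "con (set (R i j @ R j k)) (set (R k l @ R l i))
        {(last (R i j @ R j k), hd (R k l @ R l i)), (hd (R i j @ R j k), last (R k l @ R l i))}"
      using ne hd_in_set[OF ne(1)] last_in_set[OF ne(2)] unfolding con_def by auto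
    moreover have "length (R i j) \<ge> 1" "length (R j k) \<ge> 1" "length (R k l) \<ge> 1" "length (R l i) \<ge> 1"
      using K4_pos[OF R] ij d by blast+
    ultimately have "even (length (R i j @ R j k) + length (R k l @ R l i))"
      using ip by (intro even_hole) auto
    then show ?thesis by (simp add: add.assoc)
  qed
  have d: "i \<noteq> j" "i \<noteq> k" "j \<noteq> k" using ij by auto
  obtain l where l: "l < 4" "distinct [i, j, k, l]" using fourth_index[OF ij(1-3) d] .
  then have dl: "i \<noteq> l" "j \<noteq> l" "k \<noteq> l" by auto
  have sym: "length (R j i) = length (R i j)" "length (R k i) = length (R i k)" "length (R l i) = length (R i l)"
    "length (R k j) = length (R j k)" "length (R l j) = length (R j l)" "length (R l k) = length (R k l)"
    by (rule K4_length[OF R]; use ij l d dl in simp)+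
  have "K4_size R = length (R i j) + length (R i k) + length (R i l) +
     length (R j k) + length (R j l) + length (R k l)"
    using K4_size_eq[OF R ij(1-3) l] .
  moreover have "even (length (R i j) + length (R j k) + length (R k l) + length (R i l))"
    "even (length (R i j) + length (R j l) + length (R k l) + length (R i k))"
    "even (length (R i k) + length (R j k) + length (R j l) + length (R i l))"
    using cyc4[OF ij(1-3) l] cyc4[OF ij(1,2) l(1) ij(3)] cyc4[OF ij(1,3,2) l(1)] sym d dl ij l(2) by auto
  moreover have "even (length (R i j) + length (R j l) + length (R i l)) \<or>
      length (R i j) = 1 \<and> length (R j l) = 1 \<and> length (R i l) = 1"
    "even (length (R i k) + length (R k l) + length (R i l)) \<or>
      length (R i k) = 1 \<and> length (R k l) = 1 \<and> length (R i l) = 1"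
    using cyc[OF ij(1,2) l(1)] cyc[OF ij(1,3) l(1)] d dl sym by simp_all
  moreover have "even (length (R i j) + length (R j k) + length (R i k)) \<or>
      length (R i j) = 1 \<and> length (R j k) = 1 \<and> length (R i k) = 1"
    using cyc[OF ij(1,2,3) d] sym by simp
  moreover have "length (R j k) \<ge> 1" "length (R i k) \<ge> 1" using K4_pos[OF R] ij d by simp_all
  ultimately show ?thesis using s sym(2) by (simp only: even_add) force
qed

end

section \<open>Line graphs of bipartite subdivisions of $K_4$\<close>

definition adj :: "'a graph \<Rightarrow> 'a \<Rightarrow> 'a \<Rightarrow> bool" where
  "adj G u v \<longleftrightarrow> {u, v} \<in> edges G"

lemma sym_rel_adj: "simple_graph G \<Longrightarrow> sym_rel (adj G)"
  by unfold_locales (auto simp: adj_def simple_graph_def insert_commute)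

lemma adj_line_graph:
  "adj (line_graph H) e f \<longleftrightarrow> e \<in> edges H \<and> f \<in> edges H \<and> e \<noteq> f \<and> e \<inter> f \<noteq> {}"
  unfolding adj_def line_graph_def by (auto simp: doubleton_eq_iff)

lemma sym_rel_line_graph: "sym_rel (adj (line_graph H))"
  by unfold_locales (auto simp: adj_line_graph)

text \<open>The hole is the list \<open>p @ q\<close> read cyclically. The two contacts in the
  hypothesis of \<open>even_hole\<close> are the step from \<open>p\<close> to \<open>q\<close> and
  the step that closes the cycle.\<close>

lemma even_holes_adj:
  assumes G: "simple_graph G" "\<not> contains_odd_hole G"
  shows "even_holes (adj G)"
proof -
  interpret sym_rel "adj G" by (rule sym_rel_adj[OF G(1)])
  show ?thesis
  proof
    fix p q
    assume p: "ipath p" and q: "ipath q" and c: "con (set p) (set q) {(last p, hd q), (hd p, last q)}"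
      and l: "4 \<le> length p + length q"
    define r where "r = p @ q"
    have ne: "p \<noteq> []" "q \<noteq> []" using p q by auto
    have dist: "distinct r" using ipath_distinct p q c by (auto simp: r_def con_def)
    have len: "length r = length p + length q" by (simp add: r_def)
    have pos: "0 < length p" "0 < length q" using ne by simp_all
    have key: "adj G (r ! i) (r ! j) \<longleftrightarrow> j = Suc i mod length r \<or> i = Suc j mod length r"
      if ij: "i < length r" "j < length r" "i \<le> j" for i j
    proof -
      consider "j < length p" | "i \<ge> length p" | "i < length p" "j \<ge> length p" by linarith
      then show ?thesis
      proof cases
        case 1
        then have "adj G (r ! i) (r ! j) \<longleftrightarrow> j = Suc i \<or> i = Suc j"
          using p ij unfolding ipath_nth r_def by (simp add: nth_append)
        moreover have "Suc i < length r" "Suc j < length r" using 1 ij(3) pos len by linarith+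
        ultimately show ?thesis by simp
      next
        case 2
        then have "adj G (r ! i) (r ! j) \<longleftrightarrow> j - length p = Suc (i - length p) \<or> i - length p = Suc (j - length p)"
          using q ij len unfolding ipath_nth r_def by (simp add: nth_append)
        also have "\<dots> \<longleftrightarrow> j = Suc i" using 2 ij by linarith
        also have "\<dots> \<longleftrightarrow> j = Suc i mod length r \<or> i = Suc j mod length r"
        proof -
          have "Suc i mod length r = Suc i \<or> Suc i mod length r = 0" using ij(1) by (cases "Suc i = length r") auto
          moreover have "Suc j mod length r = Suc j \<or> Suc j mod length r = 0" using ij(2) by (cases "Suc j = length r") auto
          moreover have "Suc i mod length r = Suc i" if "j = Suc i" using ij that by simp
          ultimately show ?thesis using 2 ij pos by linarith
        qed
        finally show ?thesis .
      next
        case 3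
        have e: "r ! i = p ! i" "r ! j = q ! (j - length p)" using 3 by (simp_all add: r_def nth_append)
        have m: "p ! i \<in> set p" "q ! (j - length p) \<in> set q" using 3 ij len by simp_all
        have h: "hd p = p ! 0" "last p = p ! (length p - 1)" "hd q = q ! 0" "last q = q ! (length q - 1)"
          using ne by (simp_all add: hd_conv_nth last_conv_nth)
        have "adj G (r ! i) (r ! j) \<longleftrightarrow> (p ! i = last p \<and> q ! (j - length p) = hd q) \<or> (p ! i = hd p \<and> q ! (j - length p) = last q)"
          unfolding e using conD[OF c m] by auto
        also have "\<dots> \<longleftrightarrow> (i = length p - 1 \<and> j - length p = 0) \<or> (i = 0 \<and> j - length p = length q - 1)"
        proof -
          have "p ! i = p ! k \<longleftrightarrow> i = k" if "k < length p" for k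
            using nth_eq_iff_index_eq[OF ipath_distinct[OF p]] 3 that by simp
          moreover have "q ! (j - length p) = q ! k \<longleftrightarrow> j - length p = k" if "k < length q" for k
            using nth_eq_iff_index_eq[OF ipath_distinct[OF q]] 3 that ij len by simp
          ultimately show ?thesis unfolding h using pos by simp
        qed
        also have "\<dots> \<longleftrightarrow> j = Suc i mod length r \<or> i = Suc j mod length r"
        proof -
          have "Suc i < length r" using 3 pos len by linarith
          then have "Suc i mod length r = Suc i" by simp
          moreover have "Suc j mod length r = (if Suc j = length r then 0 else Suc j)" using ij by simp
          ultimately show ?thesis using 3 pos len ij by (auto split: if_splits)
        qed
        finally show ?thesis .
      qed
    qed
    have key': "adj G (r ! i) (r ! j) \<longleftrightarrow> j = Suc i mod length r \<or> i = Suc j mod length r"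
      if ij: "i < length r" "j < length r" for i j
    proof (cases "i \<le> j")
      case False
      then have "adj G (r ! j) (r ! i) \<longleftrightarrow> i = Suc j mod length r \<or> j = Suc i mod length r"
        using key[OF ij(2,1)] by simp
      then show ?thesis using E_commute[of "r ! i"] by blast
    qed (use key ij in simp)
    have "cycle_in G r"
      unfolding cycle_in_def
    proof (intro conjI allI impI)
      show "3 \<le> length r" using l len by simp
      show c: "{r ! i, r ! (Suc i mod length r)} \<in> edges G" if "i < length r" for i
        using key'[OF that, of "Suc i mod length r"] that unfolding adj_def by (metis mod_less_divisor less_nat_zero_code not_gr_zero)
      \<comment> \<open>The relation \<open>adj G\<close> lives on the whole type, so membership has
        to be derived: each vertex lies on an edge of the cycle.\<close>
      show "set r \<subseteq> verts G"
        using c G(1) unfolding simple_graph_def by (force simp: in_set_conv_nth)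
    qed (rule dist)
    moreover have "chordless G r"
      using key' unfolding chordless_def adj_def by blast
    ultimately have "hole G r" using l len by (simp add: hole_def)
    then show "even (length p + length q)" using G(2) len unfolding contains_odd_hole_def by auto
  qed
qed

section \<open>Structures with equal path lengths are isomorphic\<close>

definition K4_verts :: "(nat \<Rightarrow> nat \<Rightarrow> 'b list) \<Rightarrow> 'b set" where
  "K4_verts R = (\<Union>i<4. \<Union>j\<in>{..<4} - {i}. set (R i j))"

lemma (in sym_rel) K4_verts_eq:
  assumes R: "K4_paths R"
  shows "K4_verts R = set (R 0 1 @ R 0 2 @ R 0 3 @ R 1 2 @ R 1 3 @ R 2 3)"
proof -
  have l4: "{..<4} = {0, 1, 2, 3::nat}" by auto
  show ?thesis
    unfolding K4_verts_def l4
    using K4_set[OF R, of 0 1] K4_set[OF R, of 0 2] K4_set[OF R, of 0 3] K4_set[OF R, of 1 2]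
      K4_set[OF R, of 1 3] K4_set[OF R, of 2 3] by auto
qed

lemma (in sym_rel) card_K4_verts:
  assumes R: "K4_paths R"
  shows "finite (K4_verts R)" "card (K4_verts R) = K4_size R"
proof -
  note c = K4_con[OF R, unfolded con_def, THEN conjunct1]
  note o = K4_con_opp[OF R, unfolded con_def, THEN conjunct1]
  note s = K4_set[OF R]
  have "set (R 0 1) \<inter> set (R 0 2) = {}" "set (R 0 1) \<inter> set (R 0 3) = {}" "set (R 0 2) \<inter> set (R 0 3) = {}"
    using c[of 0 1 2] c[of 0 1 3] c[of 0 2 3] by simp_all
  moreover have "set (R 0 1) \<inter> set (R 1 2) = {}" "set (R 0 1) \<inter> set (R 1 3) = {}" "set (R 1 2) \<inter> set (R 1 3) = {}"
    using c[of 1 0 2] c[of 1 0 3] c[of 1 2 3] s[of 0 1] by simp_all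
  moreover have "set (R 0 2) \<inter> set (R 1 2) = {}" "set (R 0 2) \<inter> set (R 2 3) = {}" "set (R 1 2) \<inter> set (R 2 3) = {}"
    using c[of 2 0 1] c[of 2 0 3] c[of 2 1 3] s[of 0 2] s[of 1 2] by simp_all
  moreover have "set (R 0 3) \<inter> set (R 1 3) = {}" "set (R 0 3) \<inter> set (R 2 3) = {}" "set (R 1 3) \<inter> set (R 2 3) = {}"
    using c[of 3 0 1] c[of 3 0 2] c[of 3 1 2] s[of 0 3] s[of 1 3] s[of 2 3] by simp_all
  moreover have "set (R 0 1) \<inter> set (R 2 3) = {}" "set (R 0 2) \<inter> set (R 1 3) = {}" "set (R 0 3) \<inter> set (R 1 2) = {}"
    using o[of 0 1 2 3] o[of 0 2 1 3] o[of 0 3 1 2] by simp_all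
  moreover have "distinct (R 0 1)" "distinct (R 0 2)" "distinct (R 0 3)" "distinct (R 1 2)" "distinct (R 1 3)" "distinct (R 2 3)"
    by (rule ipath_distinct; rule K4_ipath[OF R]; simp)+
  ultimately have "distinct (R 0 1 @ R 0 2 @ R 0 3 @ R 1 2 @ R 1 3 @ R 2 3)"
    by (simp add: Int_Un_distrib)
  then show "card (K4_verts R) = K4_size R"
    unfolding K4_verts_eq[OF R] by (simp only: distinct_card) (simp add: K4_size_def)
  show "finite (K4_verts R)" unfolding K4_verts_eq[OF R] by simp
qed

lemma in_K4_verts: "u \<in> K4_verts R \<longleftrightarrow> (\<exists>i<4. \<exists>j<4. i \<noteq> j \<and> (\<exists>k<length (R i j). R i j ! k = u))"
  unfolding K4_verts_def by (force simp: in_set_conv_nth)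

lemma K4_verts_image:
  "K4_verts Q = (\<lambda>(i, j, k). Q i j ! k) ` {(i, j, k). i < 4 \<and> j < 4 \<and> i \<noteq> j \<and> k < length (Q i j)}"
proof -
  have "u \<in> (\<lambda>(i, j, k). Q i j ! k) ` {(i, j, k). i < 4 \<and> j < 4 \<and> i \<noteq> j \<and> k < length (Q i j)} \<longleftrightarrow>
      (\<exists>i j k. i < 4 \<and> j < 4 \<and> i \<noteq> j \<and> k < length (Q i j) \<and> Q i j ! k = u)" for u
    unfolding image_def by fastforce
  then show ?thesis unfolding set_eq_iff in_K4_verts by blast
qed

lemma nth_eq_hd: "distinct p \<Longrightarrow> k < length p \<Longrightarrow> p ! k = hd p \<longleftrightarrow> k = 0"
  by (cases p) (auto simp: nth_Cons split: nat.splits)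

text \<open>Whether two positions \<open>(i, j, k)\<close> carry the same vertex, or adjacent ones,
  depends on the indices and the lengths only. Matching equal positions is therefore an
  isomorphism.\<close>

lemma K4_paths_iso:
  assumes E: "sym_rel E" and L: "sym_rel L" and R: "sym_rel.K4_paths E R" and R': "sym_rel.K4_paths L R'"
    and len: "\<And>i j. i < 4 \<Longrightarrow> j < 4 \<Longrightarrow> i \<noteq> j \<Longrightarrow> length (R i j) = length (R' i j)"
  shows "\<exists>f. bij_betw f (K4_verts R) (K4_verts R') \<and>
    (\<forall>u \<in> K4_verts R. \<forall>v \<in> K4_verts R. E u v \<longleftrightarrow> L (f u) (f v))"
proof -
  interpret E: sym_rel E by (rule E)
  interpret L: sym_rel L by (rule L)
  define Z where "Z = {(i, j, k). i < 4 \<and> j < 4 \<and> i \<noteq> (j::nat) \<and> k < length (R i j)}"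
  define nd where "nd = (\<lambda>(i, j, k). R i j ! k)"
  define nd' where "nd' = (\<lambda>(i, j, k). R' i j ! k)"
  have V: "K4_verts R = nd ` Z"
    unfolding nd_def Z_def by (rule K4_verts_image)
  have "Z = {(i, j, k). i < 4 \<and> j < 4 \<and> i \<noteq> (j::nat) \<and> k < length (R' i j)}"
    unfolding Z_def using len by auto
  then have V': "K4_verts R' = nd' ` Z"
    unfolding nd'_def by (simp only: K4_verts_image)
  define agree where "agree z w \<longleftrightarrow> (nd z = nd w \<longleftrightarrow> nd' z = nd' w) \<and> (E (nd z) (nd w) \<longleftrightarrow> L (nd' z) (nd' w))" for z w
  have agree: "agree z w"
    if z: "z \<in> Z" and w: "w \<in> Z" for z w
  proof -
    \<comment> \<open>Each vertex has two positions, one for either orientation of its path. Passing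
      to the other one moves a common branch vertex to the first place, which leaves three cases:
      the same path, two paths at \<open>i\<close>, opposite paths.\<close>
    have rot: "\<exists>y \<in> Z. nd y = nd x \<and> nd' y = nd' x \<and> fst y = fst (snd x) \<and> fst (snd y) = fst x" if "x \<in> Z" for x
    proof -
      obtain i j k where x: "x = (i, j, k)" "i < 4" "j < 4" "i \<noteq> j" "k < length (R i j)"
        using \<open>x \<in> Z\<close> by (auto simp: Z_def)
      have "R j i = rev (R i j)" "R' j i = rev (R' i j)"
        using E.K4_rev[OF R x(2-4)] L.K4_rev[OF R' x(2-4)] .
      then show ?thesis
        using x len[OF x(2-4)]
        by (intro bexI[of _ "(j, i, length (R i j) - Suc k)"]) (auto simp: Z_def nd_def nd'_def rev_nth)
    qed
    have case_same: "agree z w" if "z = (i, j, k)" "w = (i, j, l)" "z \<in> Z" "w \<in> Z" for z w i j k l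
    proof -
      have ij: "i < 4" "j < 4" "i \<noteq> j" "k < length (R i j)" "l < length (R i j)"
        using that by (auto simp: Z_def)
      note p = E.K4_ipath[OF R ij(1-3), unfolded E.ipath_nth] and p' = L.K4_ipath[OF R' ij(1-3), unfolded L.ipath_nth]
      show ?thesis
        using p p' ij len[OF ij(1-3)] that by (auto simp: agree_def nd_def nd'_def nth_eq_iff_index_eq)
    qed
    have case_share: "agree z w" if "z = (i, j, k)" "w = (i, m, l)" "j \<noteq> m" "z \<in> Z" "w \<in> Z" for z w i j k l m
    proof -
      have ij: "i < 4" "j < 4" "m < 4" "i \<noteq> j" "i \<noteq> m" "j \<noteq> m" "k < length (R i j)" "l < length (R i m)"
        using that by (auto simp: Z_def)
      have hd: "R i j ! k = hd (R i j) \<longleftrightarrow> k = 0" "R i m ! l = hd (R i m) \<longleftrightarrow> l = 0"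
        "R' i j ! k = hd (R' i j) \<longleftrightarrow> k = 0" "R' i m ! l = hd (R' i m) \<longleftrightarrow> l = 0"
        using nth_eq_hd[OF E.ipath_distinct[OF E.K4_ipath[OF R ij(1,2,4)]]]
          nth_eq_hd[OF E.ipath_distinct[OF E.K4_ipath[OF R ij(1,3,5)]]]
          nth_eq_hd[OF L.ipath_distinct[OF L.K4_ipath[OF R' ij(1,2,4)]]]
          nth_eq_hd[OF L.ipath_distinct[OF L.K4_ipath[OF R' ij(1,3,5)]]]
          ij(7,8) len[OF ij(1,2,4)] len[OF ij(1,3,5)] by simp_all
      note c = E.K4_con[OF R ij(1-6)] L.K4_con[OF R' ij(1-6)]
      have m: "R i j ! k \<in> set (R i j)" "R i m ! l \<in> set (R i m)" "R' i j ! k \<in> set (R' i j)" "R' i m ! l \<in> set (R' i m)"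
        using ij(7,8) len[OF ij(1,2,4)] len[OF ij(1,3,5)] by simp_all
      have "R i j ! k \<noteq> R i m ! l" "R' i j ! k \<noteq> R' i m ! l"
        using E.con_disj[OF c(1) m(1)] L.con_disj[OF c(2) m(3)] m by auto
      then show ?thesis
        using E.conD[OF c(1) m(1,2)] L.conD[OF c(2) m(3,4)] hd that(1,2) by (simp add: agree_def nd_def nd'_def)
    qed
    have case_opp: "agree z w" if "z = (i, j, k)" "w = (m, n, l)" "distinct [i, j, m, n]" "z \<in> Z" "w \<in> Z" for z w i j k l m n
    proof -
      have ij: "i < 4" "j < 4" "m < 4" "n < 4" "i \<noteq> j" "m \<noteq> n" "k < length (R i j)" "l < length (R m n)"
        using that by (auto simp: Z_def)
      note c = E.K4_con_opp[OF R ij(1-4) that(3)] L.K4_con_opp[OF R' ij(1-4) that(3)]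
      have m: "R i j ! k \<in> set (R i j)" "R m n ! l \<in> set (R m n)" "R' i j ! k \<in> set (R' i j)" "R' m n ! l \<in> set (R' m n)"
        using ij(7,8) len[OF ij(1,2,5)] len[OF ij(3,4,6)] by simp_all
      have "R i j ! k \<noteq> R m n ! l" "R' i j ! k \<noteq> R' m n ! l"
        using E.con_disj[OF c(1) m(1)] L.con_disj[OF c(2) m(3)] m by auto
      then show ?thesis
        using E.conD[OF c(1) m(1,2)] L.conD[OF c(2) m(3,4)] that(1,2) by (simp add: agree_def nd_def nd'_def)
    qed
    have first: "agree z w" if h: "fst z = fst w" "z \<in> Z" "w \<in> Z" for z w
    proof (cases "fst (snd z) = fst (snd w)")
      case True
      then show ?thesis using case_same[of z _ _ _ w] h by (metis prod.collapse)
    next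
      case False
      then show ?thesis using case_share[of z _ _ _ w] h by (metis prod.collapse)
    qed
    obtain z' where z': "z' \<in> Z" "nd z' = nd z" "nd' z' = nd' z" "fst z' = fst (snd z)" "fst (snd z') = fst z"
      using rot[OF z] by blast
    obtain w' where w': "w' \<in> Z" "nd w' = nd w" "nd' w' = nd' w" "fst w' = fst (snd w)" "fst (snd w') = fst w"
      using rot[OF w] by blast
    consider "fst z = fst w" | "fst z = fst (snd w)" | "fst (snd z) = fst w" | "fst (snd z) = fst (snd w)"
      | "distinct [fst z, fst (snd z), fst w, fst (snd w)]"
    proof -
      have "fst z \<noteq> fst (snd z)" "fst w \<noteq> fst (snd w)" using z w by (auto simp: Z_def)
      then show ?thesis using that by fastforce
    qed
    then show ?thesis
    proof cases
      case 1 then show ?thesis using first z w by blast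
    next
      case 2 then show ?thesis using first[of z w'] z w' by (simp add: agree_def)
    next
      case 3 then show ?thesis using first[of z' w] w z' by (simp add: agree_def)
    next
      case 4 then show ?thesis using first[of z' w'] w' z' by (simp add: agree_def)
    next
      case 5 then show ?thesis using case_opp[of z _ _ _ w] z w by (metis prod.collapse)
    qed
  qed
  then have same: "(nd z = nd w \<longleftrightarrow> nd' z = nd' w) \<and> (E (nd z) (nd w) \<longleftrightarrow> L (nd' z) (nd' w))"
    if "z \<in> Z" "w \<in> Z" for z w using that by (simp add: agree_def)
  \<comment> \<open>An arbitrary position of \<open>u\<close> is chosen; \<open>same\<close> makes
    the value independent of the choice.\<close>
  define f where "f u = nd' (SOME z. z \<in> Z \<and> nd z = u)" for u
  have f: "f (nd z) = nd' z" if "z \<in> Z" for z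
  proof -
    have "(SOME y. y \<in> Z \<and> nd y = nd z) \<in> Z \<and> nd (SOME y. y \<in> Z \<and> nd y = nd z) = nd z"
      by (rule someI[of _ z]) (use that in simp)
    then show ?thesis using same[OF _ that] unfolding f_def by blast
  qed
  have "inj_on f (K4_verts R)" unfolding V using f same by (auto simp: inj_on_def)
  moreover have "f ` K4_verts R = K4_verts R'" unfolding V V' using f by (force simp: image_iff)
  moreover have "E u v \<longleftrightarrow> L (f u) (f v)" if "u \<in> K4_verts R" "v \<in> K4_verts R" for u v
    using that f same unfolding V by auto
  ultimately show ?thesis by (auto simp: bij_betw_def)
qed

section \<open>From subdivisions to structures in line graphs\<close>

definition edge_list :: "'a list \<Rightarrow> 'a set list" where
  "edge_list p = map (\<lambda>k. {p ! k, p ! Suc k}) [0..<length p - 1]"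

lemma set_edge_list: "set (edge_list p) = path_edges p"
  unfolding edge_list_def path_edges_def by (force simp: less_diff_conv)

lemma length_edge_list [simp]: "length (edge_list p) = length p - 1"
  by (simp add: edge_list_def)

lemma edge_list_nth: "k < length p - 1 \<Longrightarrow> edge_list p ! k = {p ! k, p ! Suc k}"
  by (simp add: edge_list_def)

lemma edge_list_rev: "edge_list (rev p) = rev (edge_list p)"
proof (rule nth_equalityI)
  fix k assume "k < length (edge_list (rev p))"
  then have k: "Suc k < length p" by simp
  have "length p - Suc (Suc k) < length p - 1" using k by simp
  moreover have "Suc (length p - Suc (Suc k)) = length p - Suc k" using k by simp
  ultimately show "edge_list (rev p) ! k = rev (edge_list p) ! k"
    using k by (simp add: edge_list_nth rev_nth insert_commute)
qed simp

lemma edge_list_subset: "e \<in> set (edge_list p) \<Longrightarrow> e \<subseteq> set p"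
  unfolding edge_list_def by auto

text \<open>The triangle at a branch vertex comes from the edges incident with it; as a path has
  distinct vertices, only its first edge contains its head.\<close>

lemma hd_edge_list:
  assumes "distinct p" "length p \<ge> 2" "e \<in> set (edge_list p)"
  shows "hd p \<in> e \<longleftrightarrow> e = hd (edge_list p)"
proof -
  obtain k where k: "k < length p - 1" "e = {p ! k, p ! Suc k}"
    using assms(3) by (auto simp: edge_list_def)
  have h: "hd p = p ! 0" "hd (edge_list p) = {p ! 0, p ! 1}"
  proof -
    have "p \<noteq> []" "edge_list p \<noteq> []" "0 < length p - 1" using assms(2) by (auto simp: edge_list_def)
    then show "hd p = p ! 0" "hd (edge_list p) = {p ! 0, p ! 1}"
      using edge_list_nth[of 0 p] by (simp_all add: hd_conv_nth)
  qed
  have i: "p ! 0 = p ! k \<longleftrightarrow> k = 0" "p ! 0 \<noteq> p ! Suc k" "k \<noteq> 0 \<Longrightarrow> p ! 0 \<noteq> p ! k"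
  proof -
    have "0 < length p" "k < length p" "Suc k < length p" using k(1) by linarith+
    then show "p ! 0 = p ! k \<longleftrightarrow> k = 0" "p ! 0 \<noteq> p ! Suc k" "k \<noteq> 0 \<Longrightarrow> p ! 0 \<noteq> p ! k"
      by (simp_all add: nth_eq_iff_index_eq[OF assms(1)])
  qed
  show ?thesis unfolding h k(2) using i by (cases k) auto
qed

lemma edge_list_ipath:
  assumes "distinct p" "length p \<ge> 2" "set (edge_list p) \<subseteq> edges H"
  shows "sym_rel.ipath (adj (line_graph H)) (edge_list p)"
proof -
  interpret sym_rel "adj (line_graph H)" by (rule sym_rel_line_graph)
  have eq: "edge_list p ! s = edge_list p ! t \<longleftrightarrow> s = t"
    and meet: "edge_list p ! s \<inter> edge_list p ! t \<noteq> {} \<longleftrightarrow> s = t \<or> t = Suc s \<or> s = Suc t"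
    if "s < length p - 1" "t < length p - 1" for s t
    using that assms(1) by (auto simp: edge_list_nth doubleton_eq_iff nth_eq_iff_index_eq)
  have mem: "edge_list p ! s \<in> edges H" if "s < length p - 1" for s
    using assms(3) that by (auto simp: subset_iff in_set_conv_nth)
  show ?thesis
    unfolding ipath_nth
  proof (intro conjI allI impI)
    show "edge_list p \<noteq> []" using assms(2) by (simp add: edge_list_def)
    show "distinct (edge_list p)" using eq by (simp add: distinct_conv_nth)
    fix s t assume "s < length (edge_list p)" "t < length (edge_list p)"
    then show "adj (line_graph H) (edge_list p ! s) (edge_list p ! t) \<longleftrightarrow> t = Suc s \<or> s = Suc t"
      using eq meet mem by (auto simp: adj_line_graph)
  qed
qed

lemma edges_complete_graph_4: "e \<in> edges (complete_graph 4) \<longleftrightarrow> (\<exists>i<4. \<exists>j<4. i \<noteq> j \<and> e = {i, j})"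
  unfolding complete_graph_def by (auto simp: card_2_iff)

locale subdivided_K4 =
  fixes H :: "'a graph" and b :: "nat \<Rightarrow> 'a" and p :: "nat set \<Rightarrow> 'a list"
  assumes inj: "inj_on b {..<4}"
    and path: "\<And>i j. i < 4 \<Longrightarrow> j < 4 \<Longrightarrow> i \<noteq> j \<Longrightarrow> length (p {i, j}) \<ge> 2 \<and> distinct (p {i, j}) \<and>
        {hd (p {i, j}), last (p {i, j})} = {b i, b j} \<and> inner_verts (p {i, j}) \<inter> b ` {..<4} = {}"
    and inner: "\<And>i j k l. i < 4 \<Longrightarrow> j < 4 \<Longrightarrow> k < 4 \<Longrightarrow> l < 4 \<Longrightarrow> i \<noteq> j \<Longrightarrow> k \<noteq> l \<Longrightarrow> {i, j} \<noteq> {k, l} \<Longrightarrow>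
        inner_verts (p {i, j}) \<inter> inner_verts (p {k, l}) = {}"
    and edges: "edges H = (\<Union>i<4. \<Union>j\<in>{..<4} - {i}. path_edges (p {i, j}))"
begin

text \<open>\<open>p\<close> is indexed by unordered pairs, so its paths have an arbitrary
  orientation; \<open>Q i j\<close> is turned so that it leads from \<open>b i\<close> to
  \<open>b j\<close>.\<close>

definition Q :: "nat \<Rightarrow> nat \<Rightarrow> 'a list" where
  "Q i j = (if hd (p {i, j}) = b i then p {i, j} else rev (p {i, j}))"

lemma b_neq: "i < 4 \<Longrightarrow> j < 4 \<Longrightarrow> i \<noteq> j \<Longrightarrow> b i \<noteq> b j"
  using inj by (auto simp: inj_on_def)

lemma Q_basic:
  assumes "i < 4" "j < 4" "i \<noteq> j"
  shows "length (Q i j) = length (p {i, j})" "length (Q i j) \<ge> 2" "distinct (Q i j)" "hd (Q i j) = b i"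
    "last (Q i j) = b j" "set (Q i j) = set (p {i, j})" "path_edges (Q i j) = path_edges (p {i, j})"
    "Q j i = rev (Q i j)"
proof -
  note p = path[OF assms]
  have bn: "b i \<noteq> b j" using b_neq assms by blast
  have ends: "hd (p {i, j}) = b i \<and> last (p {i, j}) = b j \<or> hd (p {i, j}) = b j \<and> last (p {i, j}) = b i"
    using p by (auto simp: doubleton_eq_iff)
  show "length (Q i j) = length (p {i, j})" "length (Q i j) \<ge> 2" "distinct (Q i j)"
    "set (Q i j) = set (p {i, j})"
    using p by (simp_all add: Q_def)
  show "hd (Q i j) = b i" "last (Q i j) = b j"
    using ends bn by (auto simp: Q_def hd_rev last_rev)
  show "path_edges (Q i j) = path_edges (p {i, j})"
    by (simp add: Q_def edge_list_rev flip: set_edge_list)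
  have "{j, i} = {i, j}" by auto
  then show "Q j i = rev (Q i j)"
    using ends bn by (auto simp: Q_def)
qed

lemma Q_set:
  assumes "i < 4" "j < 4" "i \<noteq> j"
  shows "set (Q i j) = {b i, b j} \<union> inner_verts (p {i, j})"
proof -
  have ends: "set r = {hd r, last r} \<union> inner_verts r" if r2: "length r \<ge> 2" for r :: "'a list"
  proof -
    obtain x r' where r: "r = x # r'" using r2 by (cases r) simp_all
    have "r' \<noteq> []" using r2 r by auto
    then obtain y r'' where "r' = r'' @ [y]" by (metis append_butlast_last_id)
    then show ?thesis using r by (auto simp: inner_verts_def)
  qed
  have "set (p {i, j}) = {hd (p {i, j}), last (p {i, j})} \<union> inner_verts (p {i, j})"
    by (rule ends) (use path[OF assms] in blast)
  moreover have "{hd (p {i, j}), last (p {i, j})} = {b i, b j}" using path[OF assms] by blast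
  ultimately show ?thesis unfolding Q_basic(6)[OF assms] by (simp only:)
qed

lemma Q_meet:
  assumes "i < 4" "j < 4" "k < 4" "i \<noteq> j" "i \<noteq> k" "j \<noteq> k"
  shows "set (Q i j) \<inter> set (Q i k) = {b i}"
proof -
  have "{i, j} \<noteq> {i, k}" using assms by (auto simp: doubleton_eq_iff)
  then have "inner_verts (p {i, j}) \<inter> inner_verts (p {i, k}) = {}" using inner assms by blast
  moreover have "b i \<noteq> b j" "b i \<noteq> b k" "b j \<noteq> b k" using b_neq assms by blast+
  moreover have "b x \<notin> inner_verts (p {i, j})" "b x \<notin> inner_verts (p {i, k})" if "x < 4" for x
    using path[of i j] path[of i k] assms that by auto
  ultimately show ?thesis using assms unfolding Q_set[OF assms(1,2,4)] Q_set[OF assms(1,3,5)] by blast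
qed

lemma Q_disjoint:
  assumes "i < 4" "j < 4" "k < 4" "l < 4" "distinct [i, j, k, l]"
  shows "set (Q i j) \<inter> set (Q k l) = {}"
proof -
  have d: "i \<noteq> j" "k \<noteq> l" "i \<noteq> k" "i \<noteq> l" "j \<noteq> k" "j \<noteq> l" using assms by auto
  have "{i, j} \<noteq> {k, l}" using d by (auto simp: doubleton_eq_iff)
  then have "inner_verts (p {i, j}) \<inter> inner_verts (p {k, l}) = {}" using inner assms d by blast
  moreover have "b i \<noteq> b k" "b i \<noteq> b l" "b j \<noteq> b k" "b j \<noteq> b l" using b_neq assms d by blast+
  moreover have "b x \<notin> inner_verts (p {i, j})" "b x \<notin> inner_verts (p {k, l})" if "x < 4" for x
    using path[of i j] path[of k l] assms d that by auto
  ultimately show ?thesis using assms unfolding Q_set[OF assms(1,2) d(1)] Q_set[OF assms(3,4) d(2)] by blast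
qed

lemma Q_edges: "i < 4 \<Longrightarrow> j < 4 \<Longrightarrow> i \<noteq> j \<Longrightarrow> set (edge_list (Q i j)) \<subseteq> edges H"
  unfolding edges set_edge_list using Q_basic(7) by auto

lemma edge_card:
  assumes "i < 4" "j < 4" "i \<noteq> j" "e \<in> set (edge_list (Q i j))"
  shows "card e = 2"
proof -
  obtain k where "k < length (Q i j) - 1" "e = {Q i j ! k, Q i j ! Suc k}"
    using assms(4) by (auto simp: edge_list_def)
  moreover have "k < length (Q i j)" "Suc k < length (Q i j)" using calculation by simp_all
  then have "Q i j ! k \<noteq> Q i j ! Suc k" using Q_basic(3)[OF assms(1-3)] by (simp add: nth_eq_iff_index_eq)
  ultimately show ?thesis by simp
qed

text \<open>Edges on two paths at \<open>b i\<close> can meet only in \<open>b i\<close>, and only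
  the first edges contain it; edges on opposite paths do not meet at all. No edge lies on two paths,
  since it has two elements and the paths share at most one.\<close>

lemma line_graph_K4_paths:
  "sym_rel.K4_paths (adj (line_graph H)) (\<lambda>i j. edge_list (Q i j))"
proof -
  interpret sym_rel "adj (line_graph H)" by (rule sym_rel_line_graph)
  show ?thesis
    unfolding K4_paths_def
  proof (intro conjI allI impI)
    fix i j k l :: nat assume ij: "i < 4" "j < 4"
    show "ipath (edge_list (Q i j))" "edge_list (Q j i) = rev (edge_list (Q i j))" if "i \<noteq> j"
      using edge_list_ipath[OF _ _ Q_edges] Q_basic[OF ij that] ij that by (simp_all add: edge_list_rev)
    assume k: "k < 4"
    show "con (set (edge_list (Q i j))) (set (edge_list (Q i k))) {(hd (edge_list (Q i j)), hd (edge_list (Q i k)))}"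
      if d: "i \<noteq> j" "i \<noteq> k" "j \<noteq> k"
    proof -
      have meet: "e \<inter> f \<subseteq> {b i}" if "e \<in> set (edge_list (Q i j))" "f \<in> set (edge_list (Q i k))" for e f
        using Q_meet[OF ij k d] edge_list_subset that by fast
      have ne: "e \<noteq> f" if "e \<in> set (edge_list (Q i j))" "f \<in> set (edge_list (Q i k))" for e f
      proof
        assume "e = f"
        then have "e \<subseteq> {b i}" using meet[OF that] by simp
        then have "card e \<le> 1" using card_mono[of "{b i}" e] by simp
        then show False using edge_card[OF ij d(1) that(1)] by simp
      qed
      have "e \<inter> f \<noteq> {} \<longleftrightarrow> e = hd (edge_list (Q i j)) \<and> f = hd (edge_list (Q i k))"
        if "e \<in> set (edge_list (Q i j))" "f \<in> set (edge_list (Q i k))" for e f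
      proof -
        have "b i \<in> e \<longleftrightarrow> e = hd (edge_list (Q i j))" "b i \<in> f \<longleftrightarrow> f = hd (edge_list (Q i k))"
          using hd_edge_list[OF Q_basic(3,2)[OF ij d(1)] that(1)] hd_edge_list[OF Q_basic(3,2)[OF ij(1) k d(2)] that(2)]
            Q_basic(4)[OF ij d(1)] Q_basic(4)[OF ij(1) k d(2)] by simp_all
        then show ?thesis using meet[OF that] by blast
      qed
      then show ?thesis
        unfolding con_def using ne Q_edges[OF ij d(1)] Q_edges[OF ij(1) k d(2)]
        by (simp add: adj_line_graph subset_iff disjoint_iff) metis
    qed
    assume l: "l < 4" "distinct [i, j, k, l]"
    have d: "i \<noteq> j" "k \<noteq> l" using l by auto
    have "e \<inter> f = {}" if "e \<in> set (edge_list (Q i j))" "f \<in> set (edge_list (Q k l))" for e f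
      using Q_disjoint[OF ij k l] edge_list_subset that by fast
    moreover have "e \<noteq> {}" if "e \<in> set (edge_list (Q i j))" for e
      using edge_card[OF ij d(1) that] by auto
    ultimately show "con (set (edge_list (Q i j))) (set (edge_list (Q k l))) {}"
      unfolding con_def by (fastforce simp: adj_line_graph)
  qed
qed

lemma K4_verts_edges: "K4_verts (\<lambda>i j. edge_list (Q i j)) = edges H"
  unfolding K4_verts_def edges set_edge_list
  by (intro SUP_cong refl) (use Q_basic(7) in auto)

lemma length_path: "i < 4 \<Longrightarrow> j < 4 \<Longrightarrow> i \<noteq> j \<Longrightarrow> length (edge_list (Q i j)) = length (p {i, j}) - 1"
  using Q_basic(1) by simp

end

lemma subdivided_K4I:
  assumes "subdivision_of (complete_graph 4) H"
  shows "\<exists>b p. subdivided_K4 H b p"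
proof -
  have v: "verts (complete_graph 4) = {..<4}" by (simp add: complete_graph_def)
  obtain b p where s: "inj_on b {..<4}"
    "\<forall>e \<in> edges (complete_graph 4). length (p e) \<ge> 2 \<and> distinct (p e) \<and>
        {hd (p e), last (p e)} = b ` e \<and> inner_verts (p e) \<inter> b ` {..<4} = {}"
    "\<forall>e \<in> edges (complete_graph 4). \<forall>e' \<in> edges (complete_graph 4). e \<noteq> e' \<longrightarrow> inner_verts (p e) \<inter> inner_verts (p e') = {}"
    "edges H = (\<Union>e \<in> edges (complete_graph 4). path_edges (p e))"
    using assms unfolding subdivision_of_def v by auto
  have e: "{i, j} \<in> edges (complete_graph 4)" if "i < 4" "j < 4" "i \<noteq> j" for i j
    using that by (auto simp: edges_complete_graph_4)
  have "subdivided_K4 H b p"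
  proof
    fix i j :: nat assume "i < 4" "j < 4" "i \<noteq> j"
    from s(2)[rule_format, OF e[OF this]]
    show "length (p {i, j}) \<ge> 2 \<and> distinct (p {i, j}) \<and>
        {hd (p {i, j}), last (p {i, j})} = {b i, b j} \<and> inner_verts (p {i, j}) \<inter> b ` {..<4} = {}" by simp
  next
    fix i j k l :: nat assume "i < 4" "j < 4" "k < 4" "l < 4" "i \<noteq> j" "k \<noteq> l" "{i, j} \<noteq> {k, l}"
    then show "inner_verts (p {i, j}) \<inter> inner_verts (p {k, l}) = {}" using s(3) e by simp
  next
    have "edges (complete_graph 4) = (\<Union>i<4. \<Union>j\<in>{..<4} - {i}. {{i, j}})"
      unfolding set_eq_iff edges_complete_graph_4 by blast
    then show "edges H = (\<Union>i<4. \<Union>j\<in>{..<4} - {i}. path_edges (p {i, j}))"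
      unfolding s(4) by simp
  qed (rule s(1))
  then show ?thesis by blast
qed

lemma graph_iso_adj:
  "graph_iso G H \<longleftrightarrow> (\<exists>f. bij_betw f (verts G) (verts H) \<and>
     (\<forall>u \<in> verts G. \<forall>v \<in> verts G. adj G u v \<longleftrightarrow> adj H (f u) (f v)))"
  by (simp add: graph_iso_def adj_def)

lemma adj_induced: "u \<in> X \<Longrightarrow> v \<in> X \<Longrightarrow> adj (induced G X) u v \<longleftrightarrow> adj G u v"
  by (simp add: adj_def induced_def)

text \<open>The isomorphism carries the structure of the line graph over to \<open>X\<close>.
  Bipartiteness excludes size 6: six single vertices would mean that no edge of $K_4$ is subdivided,
  and then \<open>b 0\<close>, \<open>b 1\<close>, \<open>b 2\<close> form a triangle of
  \<open>H\<close>.\<close>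

lemma K4_paths_of_line_graph:
  assumes G: "simple_graph G" and lg: "is_line_graph_of_bip_subdiv_K4 (induced G X)"
  obtains R where "sym_rel.K4_paths (adj G) R" "K4_size R \<noteq> 6" "K4_verts R = X"
proof -
  obtain H :: "nat graph" where H: "subdivision_of (complete_graph 4) H" "bipartite H" "graph_iso (induced G X) (line_graph H)"
    using lg unfolding is_line_graph_of_bip_subdiv_K4_def by blast
  obtain b p where "subdivided_K4 H b p" using subdivided_K4I[OF H(1)] by blast
  then interpret S: subdivided_K4 H b p .
  obtain f where f: "bij_betw f X (edges H)" "\<And>u v. u \<in> X \<Longrightarrow> v \<in> X \<Longrightarrow> adj G u v \<longleftrightarrow> adj (line_graph H) (f u) (f v)"
    using H(3) unfolding graph_iso_adj by (auto simp: induced_def line_graph_def adj_def)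
  define g where "g = inv_into X f"
  have g: "bij_betw g (edges H) X" unfolding g_def by (rule bij_betw_inv_into[OF f(1)])
  have fg: "f (g e) = e" "g e \<in> X" if "e \<in> edges H" for e
    using f(1) that g by (auto simp: g_def bij_betw_def f_inv_into_f)
  have gadj: "adj G (g e) (g e') \<longleftrightarrow> adj (line_graph H) e e'" if "e \<in> edges H" "e' \<in> edges H" for e e'
    using f(2)[OF fg(2)[OF that(1)] fg(2)[OF that(2)]] fg(1) that by simp
  interpret G: sym_rel "adj G" by (rule sym_rel_adj[OF G])
  interpret L: sym_rel "adj (line_graph H)" by (rule sym_rel_line_graph)
  note K = S.line_graph_K4_paths
  define R where "R i j = map g (edge_list (S.Q i j))" for i j
  have ginj: "inj_on g (edges H)" using g by (simp add: bij_betw_def)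
  have sub: "set (edge_list (S.Q i j)) \<subseteq> edges H" if "i < 4" "j < 4" "i \<noteq> j" for i j
    by (rule S.Q_edges[OF that])
  have con: "G.con (g ` U) (g ` W) ((\<lambda>(x, y). (g x, g y)) ` Z)"
    if c: "L.con U W Z" "U \<subseteq> edges H" "W \<subseteq> edges H" "Z \<subseteq> edges H \<times> edges H" for U W Z
    unfolding G.con_def
  proof (intro conjI ballI)
    show "g ` U \<inter> g ` W = {}"
      using c(1) inj_on_image_Int[OF ginj c(2,3)] unfolding L.con_def by simp
    fix u w assume "u \<in> g ` U" "w \<in> g ` W"
    then obtain x y where xy: "x \<in> U" "y \<in> W" "u = g x" "w = g y" by blast
    have "(g x, g y) \<in> (\<lambda>(x, y). (g x, g y)) ` Z \<longleftrightarrow> (x, y) \<in> Z"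
    proof
      assume "(g x, g y) \<in> (\<lambda>(x, y). (g x, g y)) ` Z"
      then obtain x' y' where z: "(x', y') \<in> Z" "g x = g x'" "g y = g y'" by auto
      moreover have "x' \<in> edges H" "y' \<in> edges H" using z(1) c(4) by auto
      ultimately have "x = x'" "y = y'" using ginj xy(1,2) c(2,3) by (meson inj_onD subsetD)+
      then show "(x, y) \<in> Z" using z by simp
    qed force
    moreover have "x \<in> edges H" "y \<in> edges H" using xy c by auto
    ultimately show "adj G u w \<longleftrightarrow> (u, w) \<in> (\<lambda>(x, y). (g x, g y)) ` Z"
      using gadj L.conD[OF c(1) xy(1,2)] xy(3,4) by simp
  qed
  have "G.K4_paths R"
    unfolding G.K4_paths_def
  proof (intro conjI allI impI)
    fix i j k l :: nat assume ij: "i < 4" "j < 4"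
    show "G.ipath (R i j)" if "i \<noteq> j"
    proof -
      have m: "edge_list (S.Q i j) ! s \<in> edges H" if "s < length (edge_list (S.Q i j))" for s
        using sub[OF ij \<open>i \<noteq> j\<close>] that nth_mem by blast
      have "distinct (R i j)"
        unfolding R_def distinct_map
        using L.ipath_distinct[OF L.K4_ipath[OF K ij that]] ginj sub[OF ij that] inj_on_subset by blast
      then show ?thesis
        using L.K4_ipath[OF K ij that] m gadj unfolding G.ipath_nth L.ipath_nth R_def by simp
    qed
    show "R j i = rev (R i j)" if "i \<noteq> j"
      using L.K4_rev[OF K ij that] by (simp add: R_def rev_map)
    assume k: "k < 4"
    show "G.con (set (R i j)) (set (R i k)) {(hd (R i j), hd (R i k))}" if d: "i \<noteq> j" "i \<noteq> k" "j \<noteq> k"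
    proof -
      have ne: "edge_list (S.Q i j) \<noteq> []" "edge_list (S.Q i k) \<noteq> []"
        using L.K4_ipath[OF K ij d(1)] L.K4_ipath[OF K ij(1) k d(2)] L.ipath_nonempty by blast+
      have "{(hd (edge_list (S.Q i j)), hd (edge_list (S.Q i k)))} \<subseteq> edges H \<times> edges H"
        using ne sub[OF ij d(1)] sub[OF ij(1) k d(2)] hd_in_set by blast
      then show ?thesis
        using con[OF L.K4_con[OF K ij k d] sub[OF ij d(1)] sub[OF ij(1) k d(2)]] ne
        by (simp add: R_def hd_map)
    qed
    assume l: "l < 4" "distinct [i, j, k, l]"
    have d: "i \<noteq> j" "k \<noteq> l" using l by auto
    show "G.con (set (R i j)) (set (R k l)) {}"
      using con[OF L.K4_con_opp[OF K ij k l] sub[OF ij d(1)] sub[OF k l(1) d(2)]] by (simp add: R_def)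
  qed
  moreover have "K4_verts R = g ` K4_verts (\<lambda>i j. edge_list (S.Q i j))"
    unfolding K4_verts_def R_def by (simp add: image_UN)
  then have "K4_verts R = X"
    using g unfolding S.K4_verts_edges by (simp add: bij_betw_def)
  moreover have "K4_size R \<noteq> 6"
  proof
    assume s: "K4_size R = 6"
    have one: "length (R i j) = 1" if "(i, j) \<in> {(0, 1), (0, 2), (1, 2)}" for i j
    proof -
      have "length (R 0 1) \<ge> 1" "length (R 0 2) \<ge> 1" "length (R 0 3) \<ge> 1" "length (R 1 2) \<ge> 1" "length (R 1 3) \<ge> 1" "length (R 2 3) \<ge> 1"
        using G.K4_pos[OF \<open>G.K4_paths R\<close>] by simp_all
      then show ?thesis using s that unfolding K4_size_def by auto
    qed
    have tri: "{b i, b j} \<in> edges H" if "(i, j) \<in> {(0, 1), (0, 2), (1, 2)}" for i j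
    proof -
      have ij: "i < 4" "j < 4" "i \<noteq> j" using that by auto
      have "length (S.Q i j) = 2" using one[OF that] S.Q_basic(2)[OF ij] by (simp add: R_def)
      then obtain x y where "S.Q i j = [x, y]" by (auto simp: numeral_2_eq_2 length_Suc_conv)
      then have "S.Q i j = [b i, b j]" using S.Q_basic(4,5)[OF ij] by simp
      then have "{b i, b j} \<in> set (edge_list (S.Q i j))" by (simp add: edge_list_def)
      then show ?thesis using sub[OF ij] by blast
    qed
    obtain A B where "A \<inter> B = {}" "\<forall>e \<in> edges H. \<exists>a \<in> A. \<exists>c \<in> B. e = {a, c}"
      using H(2) unfolding bipartite_def by blast
    have side: "b i \<in> A \<longleftrightarrow> b j \<notin> A" if ij: "(i, j) \<in> {(0, 1), (0, 2), (1, 2)}" for i j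
    proof -
      obtain x y where "x \<in> A" "y \<in> B" "{b i, b j} = {x, y}"
        using tri[OF ij] \<open>\<forall>e \<in> edges H. \<exists>a \<in> A. \<exists>c \<in> B. e = {a, c}\<close> by meson
      then show ?thesis using \<open>A \<inter> B = {}\<close> by (auto simp: doubleton_eq_iff)
    qed
    show False using side[of 0 1] side[of 0 2] side[of 1 2] by blast
  qed
  ultimately show ?thesis using that by blast
qed

text \<open>
  The subdivision with paths of lengths \<open>l i j\<close>; its vertices are 0, 1, 2, 3 and codes of the
  inner vertices.
\<close>

definition inner_code :: "nat \<Rightarrow> nat \<Rightarrow> nat \<Rightarrow> nat" where
  "inner_code i j k = 4 + prod_encode (i, prod_encode (j, k))"

text \<open>\<open>l i j\<close> counts the edges of the path, that is, the vertices of the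
  corresponding path in the line graph; hence there are \<open>l i j - 1\<close> inner vertices,
  numbered from 1.\<close>

definition subdiv_path :: "(nat \<Rightarrow> nat \<Rightarrow> nat) \<Rightarrow> nat set \<Rightarrow> nat list" where
  "subdiv_path l e = Min e # map (inner_code (Min e) (Max e)) [1..<l (Min e) (Max e)] @ [Max e]"

definition subdiv_graph :: "(nat \<Rightarrow> nat \<Rightarrow> nat) \<Rightarrow> nat graph" where
  "subdiv_graph l = \<lparr>verts = {..<4} \<union> (\<Union>e \<in> edges (complete_graph 4). set (subdiv_path l e)),
     edges = (\<Union>e \<in> edges (complete_graph 4). path_edges (subdiv_path l e))\<rparr>"

lemma inner_code_eq [simp]: "inner_code i j k = inner_code i' j' k' \<longleftrightarrow> i = i' \<and> j = j' \<and> k = k'"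
  by (simp add: inner_code_def)

lemma inner_code_ge: "inner_code i j k \<ge> 4"
  by (simp add: inner_code_def)

lemma subdiv_path_inner:
  "inner_verts (subdiv_path l e) = inner_code (Min e) (Max e) ` {1..<l (Min e) (Max e)}"
  by (simp add: subdiv_path_def inner_verts_def)

lemma complete_edge_cases:
  assumes "e \<in> edges (complete_graph 4)"
  obtains i j where "i < j" "j < 4" "e = {i, j}" "Min e = i" "Max e = j"
proof -
  obtain i j where ij: "i < 4" "j < 4" "i \<noteq> j" "e = {i, j}"
    using assms unfolding edges_complete_graph_4 by blast
  consider "i < j" | "j < i" using ij by linarith
  then show ?thesis
  proof cases
    case 1 then show ?thesis using that[of i j] ij by simp
  next
    case 2 then show ?thesis using that[of j i] ij by (simp add: insert_commute)
  qed
qed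

lemma subdiv_path_props:
  assumes "e \<in> edges (complete_graph 4)"
  shows "2 \<le> length (subdiv_path l e) \<and> distinct (subdiv_path l e) \<and>
    {hd (subdiv_path l e), last (subdiv_path l e)} = e \<and> inner_verts (subdiv_path l e) \<inter> {..<4} = {}"
proof (intro conjI)
  obtain i j where ij: "i < j" "j < 4" "e = {i, j}" "Min e = i" "Max e = j"
    using complete_edge_cases[OF assms] .
  show "2 \<le> length (subdiv_path l e)" by (simp add: subdiv_path_def)
  have "i \<noteq> inner_code i j k" "j \<noteq> inner_code i j k" for k
    using ij inner_code_ge[of i j k] by linarith+
  then show "distinct (subdiv_path l e)"
    using ij(1) by (auto simp: subdiv_path_def ij(4,5) distinct_map inj_on_def)
  show "{hd (subdiv_path l e), last (subdiv_path l e)} = e"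
    unfolding subdiv_path_def ij(4,5) by (simp add: ij(3))
  show "inner_verts (subdiv_path l e) \<inter> {..<4} = {}"
  proof -
    have "\<not> v < 4" if "v \<in> inner_verts (subdiv_path l e)" for v
      using that inner_code_ge unfolding subdiv_path_inner by (auto simp: not_less)
    then show ?thesis by blast
  qed
qed

lemma subdiv_path_inner_disjoint:
  assumes e: "e \<in> edges (complete_graph 4)" "f \<in> edges (complete_graph 4)" "e \<noteq> f"
  shows "inner_verts (subdiv_path l e) \<inter> inner_verts (subdiv_path l f) = {}"
proof -
  obtain i j where ij: "i < j" "j < 4" "e = {i, j}" "Min e = i" "Max e = j"
    using complete_edge_cases[OF e(1)] .
  obtain k m where km: "k < m" "m < 4" "f = {k, m}" "Min f = k" "Max f = m"
    using complete_edge_cases[OF e(2)] .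
  show ?thesis
    unfolding subdiv_path_inner ij(4,5) km(4,5) using e(3) ij(3) km(3) by auto
qed

lemma subdivision_subdiv_graph: "subdivision_of (complete_graph 4) (subdiv_graph l)"
  unfolding subdivision_of_def
proof (rule exI[of _ "\<lambda>i. i"], rule exI[of _ "subdiv_path l"], intro conjI ballI impI)
  have v: "verts (complete_graph 4) = {..<4}" by (simp add: complete_graph_def)
  fix e assume e: "e \<in> edges (complete_graph 4)"
  note props = subdiv_path_props[OF e, of l]
  show "2 \<le> length (subdiv_path l e)" "distinct (subdiv_path l e)"
    using props by blast+
  show "{hd (subdiv_path l e), last (subdiv_path l e)} = (\<lambda>i. i) ` e"
    "inner_verts (subdiv_path l e) \<inter> (\<lambda>i. i) ` verts (complete_graph 4) = {}"
    unfolding v image_ident using props by blast+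
  show "inner_verts (subdiv_path l e) \<inter> inner_verts (subdiv_path l f) = {}"
    if "f \<in> edges (complete_graph 4)" "e \<noteq> f" for f
    using subdiv_path_inner_disjoint[OF e that] .
next
  show "inj_on (\<lambda>i. i) (verts (complete_graph 4))" by simp
  show "verts (subdiv_graph l) = (\<lambda>i. i) ` verts (complete_graph 4) \<union> (\<Union>e \<in> edges (complete_graph 4). set (subdiv_path l e))"
    unfolding subdiv_graph_def by (simp only: graph.simps image_ident) (simp add: complete_graph_def)
  show "edges (subdiv_graph l) = (\<Union>e \<in> edges (complete_graph 4). path_edges (subdiv_path l e))"
    unfolding subdiv_graph_def by (simp only: graph.simps)
qed

text \<open>Colour by the parity of the distance from branch vertex 0 along the paths: branch vertex
  \<open>i\<close> gets \<open>l 0 i\<close>, and along a path from \<open>i\<close> the colour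
  changes at each step. At the far end \<open>j\<close> this agrees with \<open>l 0 j\<close>
  because the triangle of 0, \<open>i\<close>, \<open>j\<close> has even sum.\<close>

lemma bipartite_subdiv_graph:
  assumes sym: "\<And>i j. i < 4 \<Longrightarrow> j < 4 \<Longrightarrow> i \<noteq> j \<Longrightarrow> l i j = l j i"
    and pos: "\<And>i j. i < 4 \<Longrightarrow> j < 4 \<Longrightarrow> i \<noteq> j \<Longrightarrow> l i j \<ge> 1"
    and even: "\<And>i j k. i < 4 \<Longrightarrow> j < 4 \<Longrightarrow> k < 4 \<Longrightarrow> distinct [i, j, k] \<Longrightarrow> even (l i j + l j k + l k i)"
  shows "bipartite (subdiv_graph l)"
proof -
  define c where "c i = (if i = 0 then 0 else l 0 i)" for i
  \<comment> \<open>The colour is read off from the code: an inner vertex decodes to its path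
    \<open>(i, j)\<close> and its position \<open>k\<close>.\<close>
  define \<chi> where "\<chi> v = (if v < 4 then c v else
    (let (i, j, k) = (\<lambda>(i, y). (i, prod_decode y)) (prod_decode (v - 4)) in c i + k))" for v
  have c: "even (c i + c j + l i j)" if "i < j" "j < 4" for i j
    using even[of 0 i j] sym[of 0 j] that by (cases "i = 0") (auto simp: c_def)
  have \<chi>: "\<chi> (inner_code i j k) = c i + k" for i j k
    by (simp add: \<chi>_def inner_code_def)
  have alt: "odd (\<chi> u + \<chi> v) \<and> u \<noteq> v"
    if e: "e \<in> edges (complete_graph 4)" and s: "Suc s < length (subdiv_path l e)"
      and uv: "u = subdiv_path l e ! s" "v = subdiv_path l e ! Suc s" for e s u v
  proof -
    obtain i j where ij: "i < j" "j < 4" "e = {i, j}" "Min e = i" "Max e = j"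
      using complete_edge_cases[OF e] .
    have len: "length (subdiv_path l e) = Suc (l i j)"
      using pos[of i j] ij by (simp add: subdiv_path_def)
    have val: "even (\<chi> (subdiv_path l e ! t) + (c i + t))" if "t \<le> l i j" for t
    proof -
      consider "t = 0" | "0 < t" "t < l i j" | "t = l i j" "0 < t" using \<open>t \<le> l i j\<close> by linarith
      then show ?thesis
      proof cases
        case 1 then show ?thesis using ij by (simp add: subdiv_path_def \<chi>_def)
      next
        case 2
        then have "subdiv_path l e ! t = inner_code i j t"
          unfolding subdiv_path_def ij(4,5) by (cases t) (auto simp: nth_append)
        then show ?thesis by (simp add: \<chi>)
      next
        case 3
        then have "subdiv_path l e ! t = j"
          unfolding subdiv_path_def ij(4,5) by (cases t) (auto simp: nth_append)
        then show ?thesis using c[OF ij(1,2)] 3 ij(2) by (simp add: \<chi>_def) blast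
      qed
    qed
    have "even (\<chi> u + (c i + s))" "even (\<chi> v + (c i + Suc s))"
      using val[of s] val[of "Suc s"] s len uv by simp_all
    then have "odd (\<chi> u + \<chi> v)" by simp
    then show ?thesis by auto
  qed
  let ?V = "verts (subdiv_graph l)"
  show ?thesis
    unfolding bipartite_def
  proof (rule exI[of _ "{v \<in> ?V. even (\<chi> v)}"], rule exI[of _ "{v \<in> ?V. odd (\<chi> v)}"], intro conjI ballI)
    fix f assume "f \<in> edges (subdiv_graph l)"
    then obtain e s where e: "e \<in> edges (complete_graph 4)" "Suc s < length (subdiv_path l e)"
      "f = {subdiv_path l e ! s, subdiv_path l e ! Suc s}"
      unfolding subdiv_graph_def path_edges_def by auto
    define u where "u = subdiv_path l e ! s"
    define v where "v = subdiv_path l e ! Suc s"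
    have "u \<in> set (subdiv_path l e)" "v \<in> set (subdiv_path l e)" using e(2) by (simp_all add: u_def v_def)
    then have uv: "u \<in> ?V" "v \<in> ?V" using e(1) by (auto simp: subdiv_graph_def)
    have o: "odd (\<chi> u + \<chi> v)" using alt[OF e(1,2) u_def v_def] by blast
    have f: "f = {u, v}" using e(3) by (simp add: u_def v_def)
    show "\<exists>a \<in> {v \<in> ?V. even (\<chi> v)}. \<exists>b \<in> {v \<in> ?V. odd (\<chi> v)}. f = {a, b}"
    proof (cases "even (\<chi> u)")
      case True
      then show ?thesis using o uv f by (intro bexI[of _ u] bexI[of _ v]) auto
    next
      case False
      then show ?thesis using o uv f by (intro bexI[of _ v] bexI[of _ u]) (auto simp: insert_commute)
    qed
  qed auto
qed

text \<open>The subdivision with path lengths \<open>length (R i j)\<close> has a line graph that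
  carries a structure with the same path lengths as \<open>R\<close>, so \<open>K4_paths_iso\<close>
  identifies the two. It is bipartite by \<open>K4_even_triangle\<close>, which needs both that
  \<open>G\<close> has no odd hole and that the size is not 6.\<close>

lemma line_graph_of_K4_paths:
  assumes G: "simple_graph G" "\<not> contains_odd_hole G"
    and R: "sym_rel.K4_paths (adj G) R" and s: "K4_size R \<noteq> 6"
  shows "is_line_graph_of_bip_subdiv_K4 (induced G (K4_verts R))"
proof -
  interpret G: even_holes "adj G" by (rule even_holes_adj[OF G])
  define l where "l i j = length (R i j)" for i j
  define H where "H = subdiv_graph l"
  have sd: "subdivision_of (complete_graph 4) H" unfolding H_def by (rule subdivision_subdiv_graph)
  have sym: "l i j = l j i" if "i < 4" "j < 4" "i \<noteq> j" for i j
    using G.K4_length[OF R that] by (simp add: l_def)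
  have pos: "l i j \<ge> 1" if "i < 4" "j < 4" "i \<noteq> j" for i j
    using G.K4_pos[OF R that] by (simp add: l_def)
  have "bipartite H"
    unfolding H_def by (rule bipartite_subdiv_graph[OF sym pos]) (use G.K4_even_triangle[OF R s] in \<open>simp_all add: l_def\<close>)
  interpret S: subdivided_K4 H "\<lambda>i. i" "subdiv_path l"
  proof
    have e: "{i, j} \<in> edges (complete_graph 4)" if "i < 4" "j < 4" "i \<noteq> j" for i j
      using that by (auto simp: edges_complete_graph_4)
    show "inj_on (\<lambda>i. i) {..<4}" by simp
    show "2 \<le> length (subdiv_path l {i, j}) \<and> distinct (subdiv_path l {i, j}) \<and>
        {hd (subdiv_path l {i, j}), last (subdiv_path l {i, j})} = {i, j} \<and>
        inner_verts (subdiv_path l {i, j}) \<inter> (\<lambda>i. i) ` {..<4} = {}"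
      if "i < 4" "j < 4" "i \<noteq> j" for i j
      using subdiv_path_props[OF e[OF that]] by simp
    show "inner_verts (subdiv_path l {i, j}) \<inter> inner_verts (subdiv_path l {k, m}) = {}"
      if "i < 4" "j < 4" "k < 4" "m < 4" "i \<noteq> j" "k \<noteq> m" "{i, j} \<noteq> {k, m}" for i j k m
      using subdiv_path_inner_disjoint[OF e[OF that(1,2,5)] e[OF that(3,4,6)] that(7)] .
    have "edges (complete_graph 4) = (\<Union>i<4. \<Union>j\<in>{..<4} - {i}. {{i, j}})"
      unfolding set_eq_iff edges_complete_graph_4 by blast
    then show "edges H = (\<Union>i<4. \<Union>j\<in>{..<4} - {i}. path_edges (subdiv_path l {i, j}))"
      by (simp add: H_def subdiv_graph_def)
  qed
  have len: "length (R i j) = length (edge_list (S.Q i j))" if ij: "i < 4" "j < 4" "i \<noteq> j" for i j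
  proof -
    have "length (subdiv_path l {i, j}) = Suc (l i j)"
    proof (cases "i < j")
      case True
      then show ?thesis using pos[OF ij] by (simp add: subdiv_path_def)
    next
      case False
      then show ?thesis using pos[OF ij] sym[OF ij] ij by (simp add: subdiv_path_def)
    qed
    then show ?thesis using S.length_path[OF ij] by (simp add: l_def)
  qed
  obtain f where f: "bij_betw f (K4_verts R) (edges H)"
    "\<forall>u \<in> K4_verts R. \<forall>v \<in> K4_verts R. adj G u v \<longleftrightarrow> adj (line_graph H) (f u) (f v)"
    using K4_paths_iso[OF G.sym_rel_axioms sym_rel_line_graph R S.line_graph_K4_paths len]
    unfolding S.K4_verts_edges by blast
  have "graph_iso (induced G (K4_verts R)) (line_graph H)"
  proof -
    have "verts (induced G (K4_verts R)) = K4_verts R" "verts (line_graph H) = edges H"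
      by (simp_all add: induced_def line_graph_def)
    then show ?thesis
      unfolding graph_iso_adj using f by (intro exI[of _ f]) (simp add: adj_induced)
  qed
  then show ?thesis
    unfolding is_line_graph_of_bip_subdiv_K4_def using sd \<open>bipartite H\<close> by blast
qed

section \<open>Verifying programs\<close>

definition runs :: "nat \<Rightarrow> prog \<Rightarrow> store \<Rightarrow> nat \<Rightarrow> (store \<Rightarrow> bool) \<Rightarrow> bool" where
  "runs W P s t Q \<longleftrightarrow> (\<exists>t' s'. exec W P s t' s' \<and> t' \<le> t \<and> Q s')"

definition upd :: "store \<Rightarrow> nat \<Rightarrow> nat \<Rightarrow> nat \<Rightarrow> store" where
  "upd s a i v = s(a := (s a)(i := v))"

lemma upd_same [simp]: "upd s a i v a = (s a)(i := v)"
  by (simp add: upd_def)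

lemma upd_other [simp]: "b \<noteq> a \<Longrightarrow> upd s a i v b = s b"
  by (simp add: upd_def)

primrec writes :: "prog \<Rightarrow> nat set" where
  "writes Skip = {}"
| "writes (Write a i x) = {a}"
| "writes (Seq P Q) = writes P \<union> writes Q"
| "writes (If x P Q) = writes P \<union> writes Q"
| "writes (While x P) = writes P"

lemma exec_frame: "exec W P s t s' \<Longrightarrow> a \<notin> writes P \<Longrightarrow> s' a = s a"
  by (induction rule: exec.induct) auto

lemma runs_frame:
  assumes "runs W P s t Q" "\<And>s'. (\<And>a. a \<notin> writes P \<Longrightarrow> s' a = s a) \<Longrightarrow> Q s' \<Longrightarrow> Q' s'"
  shows "runs W P s t Q'"
  using assms exec_frame unfolding runs_def by metis

lemma runs_mono: "runs W P s t Q \<Longrightarrow> t \<le> t' \<Longrightarrow> (\<And>s'. Q s' \<Longrightarrow> Q' s') \<Longrightarrow> runs W P s t' Q'"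
  unfolding runs_def by (meson le_trans)

lemma runs_Skip: "Q s \<Longrightarrow> 1 \<le> t \<Longrightarrow> runs W Skip s t Q"
  unfolding runs_def by (blast intro: exec.Skip)

lemma runs_Write:
  "val x s \<le> W \<Longrightarrow> Q (upd s a (val i s) (val x s)) \<Longrightarrow> 1 + cost i + cost x \<le> t \<Longrightarrow> runs W (Write a i x) s t Q"
  unfolding runs_def upd_def by (blast intro: exec.Write)

lemma runs_Seq:
  assumes "runs W P s t (\<lambda>s'. runs W P' s' t' Q)"
  shows "runs W (Seq P P') s (t + t') Q"
  using assms unfolding runs_def by (meson add_mono exec.Seq)

lemma runs_If:
  assumes "val x s \<noteq> 0 \<Longrightarrow> runs W P s t Q" "val x s = 0 \<Longrightarrow> runs W P' s t Q"
  shows "runs W (If x P P') s (1 + cost x + t) Q"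
  using assms exec.IfTrue exec.IfFalse unfolding runs_def by (meson add_left_mono)

definition For :: "nat \<Rightarrow> expr \<Rightarrow> prog \<Rightarrow> prog" where
  "For i b P = Seq (Write i (Const 0) (Const 0))
    (While (Sub b (Read i (Const 0)))
      (Seq P (Write i (Const 0) (Add (Read i (Const 0)) (Const 1)))))"

lemma writes_For [simp]: "writes (For i b P) = insert i (writes P)"
  by (auto simp: For_def)

text \<open>Each round costs the body, \<open>cost b + 4\<close> for the test and 6 for the
  increment; initialisation and the last test fit into one further round, hence
  \<open>Suc N\<close>. The bound \<open>b\<close> may be any expression whose value is fixed by the
  arrays that the loop does not write, and \<open>N \<le> W\<close> lets the counter be
  stored.\<close>

lemma runs_For:
  fixes I :: "nat \<Rightarrow> store \<Rightarrow> bool"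
  assumes i: "i \<notin> writes P"
    and init: "I 0 (upd s i 0 0)"
    and step: "\<And>k s'. k < N \<Longrightarrow> s' i 0 = k \<Longrightarrow> (\<And>a. a \<noteq> i \<Longrightarrow> a \<notin> writes P \<Longrightarrow> s' a = s a) \<Longrightarrow> I k s' \<Longrightarrow>
      runs W P s' t (\<lambda>s''. I (Suc k) (upd s'' i 0 (Suc k)))"
    and bound: "\<And>k s'. (\<And>a. a \<noteq> i \<Longrightarrow> a \<notin> writes P \<Longrightarrow> s' a = s a) \<Longrightarrow> val b s' = N"
    and N: "N \<le> W"
    and fin: "\<And>s'. (\<And>a. a \<noteq> i \<Longrightarrow> a \<notin> writes P \<Longrightarrow> s' a = s a) \<Longrightarrow> I N s' \<Longrightarrow> Q s'"
  shows "runs W (For i b P) s ((t + cost b + 10) * Suc N) Q"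
proof -
  let ?B = "Seq P (Write i (Const 0) (Add (Read i (Const 0)) (Const 1)))"
  let ?L = "While (Sub b (Read i (Const 0))) ?B"
  have loop: "runs W ?L s' (m * (t + cost b + 10) + cost b + 4) (\<lambda>s''. (\<forall>a. a \<noteq> i \<longrightarrow> a \<notin> writes P \<longrightarrow> s'' a = s a) \<and> I N s'')"
    if "k + m = N" "s' i 0 = k" "\<forall>a. a \<noteq> i \<longrightarrow> a \<notin> writes P \<longrightarrow> s' a = s a" "I k s'" for k m s'
    using that
  proof (induction m arbitrary: k s')
    case 0
    then have "val (Sub b (Read i (Const 0))) s' = 0" using bound[of s'] by simp
    from exec.WhileFalse[OF this, of W ?B] 0 show ?case
      unfolding runs_def by (intro exI conjI) auto
  next
    case (Suc m)
    have fr: "s' a = s a" if "a \<noteq> i" "a \<notin> writes P" for a using Suc.prems(3) that by blast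
    have c: "val (Sub b (Read i (Const 0))) s' \<noteq> 0" using Suc.prems bound[OF fr] by simp
    obtain t1 s1 where s1: "exec W P s' t1 s1" "t1 \<le> t" "I (Suc k) (upd s1 i 0 (Suc k))"
      using step[OF _ Suc.prems(2) fr Suc.prems(4)] Suc.prems(1) unfolding runs_def by fastforce
    have f1: "s1 a = s' a" if "a \<notin> writes P" for a using exec_frame[OF s1(1) that] .
    have "s1 i 0 = k" using f1[OF i] Suc.prems(2) by simp
    then have w: "exec W (Write i (Const 0) (Add (Read i (Const 0)) (Const 1))) s1 6 (upd s1 i 0 (Suc k))"
      using exec.Write[of "Add (Read i (Const 0)) (Const 1)" s1 W i "Const 0"] Suc.prems(1) N by (simp add: upd_def numeral_eq_Suc)
    have "runs W ?L (upd s1 i 0 (Suc k)) (m * (t + cost b + 10) + cost b + 4) (\<lambda>s''. (\<forall>a. a \<noteq> i \<longrightarrow> a \<notin> writes P \<longrightarrow> s'' a = s a) \<and> I N s'')"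
      by (rule Suc.IH) (use Suc.prems s1(3) f1 in auto)
    then obtain t2 s2 where s2: "exec W ?L (upd s1 i 0 (Suc k)) t2 s2" "t2 \<le> m * (t + cost b + 10) + cost b + 4"
      "\<forall>a. a \<noteq> i \<longrightarrow> a \<notin> writes P \<longrightarrow> s2 a = s a" "I N s2"
      unfolding runs_def by blast
    have "exec W ?L s' (1 + cost (Sub b (Read i (Const 0))) + (t1 + 6) + t2) s2"
      by (rule exec.WhileTrue[OF c exec.Seq[OF s1(1) w] s2(1)])
    moreover have "1 + cost (Sub b (Read i (Const 0))) + (t1 + 6) + t2 \<le> Suc m * (t + cost b + 10) + cost b + 4"
      using s1(2) s2(2) by simp
    ultimately show ?case using s2(3,4) unfolding runs_def by blast
  qed
  have "runs W ?L (upd s i 0 0) (N * (t + cost b + 10) + cost b + 4) (\<lambda>s''. (\<forall>a. a \<noteq> i \<longrightarrow> a \<notin> writes P \<longrightarrow> s'' a = s a) \<and> I N s'')"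
    by (rule loop[of 0]) (use init in auto)
  then obtain t2 s2 where s2: "exec W ?L (upd s i 0 0) t2 s2" "t2 \<le> N * (t + cost b + 10) + cost b + 4"
    "\<forall>a. a \<noteq> i \<longrightarrow> a \<notin> writes P \<longrightarrow> s2 a = s a" "I N s2"
    unfolding runs_def by blast
  have "exec W (Write i (Const 0) (Const 0)) s 3 (upd s i 0 0)"
    using exec.Write[of "Const 0" s W i "Const 0"] by (simp add: upd_def numeral_eq_Suc)
  from exec.Seq[OF this s2(1)] have "exec W (For i b P) s (3 + t2) s2" unfolding For_def .
  moreover have "3 + t2 \<le> (t + cost b + 10) * Suc N" using s2(2) by (simp add: algebra_simps)
  moreover have "Q s2" using fin[of s2] s2(3,4) by blast
  ultimately show ?thesis unfolding runs_def by blast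
qed

fun seqs :: "prog list \<Rightarrow> prog" where
  "seqs [] = Skip"
| "seqs (P # Ps) = Seq P (seqs Ps)"

lemma writes_seqs [simp]: "writes (seqs Ps) = (\<Union>P \<in> set Ps. writes P)"
  by (induction Ps) auto

text \<open>The invariant is indexed by the items already processed, so that it can record what has
  been done for each of them.\<close>

lemma runs_seqs:
  fixes I :: "'a list \<Rightarrow> store \<Rightarrow> bool"
  assumes step: "\<And>xs x ys s. zs = xs @ x # ys \<Longrightarrow> I xs s \<Longrightarrow> runs W (f x) s (t x) (\<lambda>s'. I (xs @ [x]) s')"
    and init: "I [] s"
  shows "runs W (seqs (map f zs)) s (sum_list (map t zs) + 1) (I zs)"
proof -
  have "runs W (seqs (map f ys)) s (sum_list (map t ys) + 1) (I zs)" if "zs = xs @ ys" "I xs s" for xs ys s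
    using that
  proof (induction ys arbitrary: xs s)
    case Nil
    then show ?case by (simp add: runs_Skip)
  next
    case (Cons y ys)
    have "runs W (f y) s (t y) (\<lambda>s'. I (xs @ [y]) s')" using step Cons.prems by blast
    then have "runs W (f y) s (t y) (\<lambda>s'. runs W (seqs (map f ys)) s' (sum_list (map t ys) + 1) (I zs))"
      by (rule runs_mono) (use Cons in auto)
    from runs_Seq[OF this] show ?case by (simp add: add.assoc)
  qed
  from this[of "[]"] init show ?thesis by simp
qed

fun nest :: "nat list \<Rightarrow> prog \<Rightarrow> prog" where
  "nest [] P = P"
| "nest (x # xs) P = For x (Read 0 (Const 0)) (nest xs P)"

lemma writes_nest [simp]: "writes (nest xs P) = set xs \<union> writes P"
  by (induction xs) auto

text \<open>
  \<open>J\<close> is an invariant of the body and \<open>A \<tau>\<close> is what the body achieves when the loop variables have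
  the values \<open>\<tau>\<close>, and never destroys.
\<close>

lemma runs_nest:
  assumes "distinct xs" "set xs \<inter> writes P = {}" "0 \<notin> set xs" "0 \<notin> writes P" "n \<le> W"
    and "\<And>s. J s \<Longrightarrow> s 0 0 = n"
    and "\<And>s x v. x \<in> set xs \<Longrightarrow> J s \<Longrightarrow> J (upd s x 0 v)"
    and "\<And>s x v \<tau>. x \<in> set xs \<Longrightarrow> A \<tau> (upd s x 0 v) = A \<tau> s"
    and "\<And>s. J s \<Longrightarrow> (\<And>x. x \<in> set xs \<Longrightarrow> s x 0 < n) \<Longrightarrow>
      runs W P s t (\<lambda>s'. J s' \<and> (\<forall>\<tau>. A \<tau> s \<longrightarrow> A \<tau> s') \<and> A (pre @ map (\<lambda>x. s x 0) xs) s')"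
    and "J s"
  shows "runs W (nest xs P) s ((t + 12 * length xs) * Suc n ^ length xs)
    (\<lambda>s'. J s' \<and> (\<forall>\<tau>. A \<tau> s \<longrightarrow> A \<tau> s') \<and>
      (\<forall>\<tau>. length \<tau> = length xs \<longrightarrow> set \<tau> \<subseteq> {..<n} \<longrightarrow> A (pre @ \<tau>) s'))"
  using assms
proof (induction xs arbitrary: pre J s)
  case Nil
  then show ?case by simp
next
  case (Cons x xs)
  let ?t = "(t + 12 * length xs) * Suc n ^ length xs"
  let ?I = "\<lambda>k s'. J s' \<and> (\<forall>\<tau>. A \<tau> s \<longrightarrow> A \<tau> s') \<and>
      (\<forall>m \<tau>. m < k \<longrightarrow> length \<tau> = length xs \<longrightarrow> set \<tau> \<subseteq> {..<n} \<longrightarrow> A (pre @ m # \<tau>) s')"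
  have xP: "x \<notin> writes P" "x \<notin> set xs" using Cons.prems(1,2) by auto
  have n: "n \<le> W" by (rule Cons.prems(5))
  have "runs W (For x (Read 0 (Const 0)) (nest xs P)) s ((?t + cost (Read 0 (Const 0)) + 10) * Suc n)
    (\<lambda>s'. J s' \<and> (\<forall>\<tau>. A \<tau> s \<longrightarrow> A \<tau> s') \<and>
      (\<forall>\<tau>. length \<tau> = length (x # xs) \<longrightarrow> set \<tau> \<subseteq> {..<n} \<longrightarrow> A (pre @ \<tau>) s'))"
  proof (rule runs_For[where I = ?I])
    show "x \<notin> writes (nest xs P)" using xP by simp
    show "?I 0 (upd s x 0 0)" using Cons.prems(7,8,10) by simp
  next
    fix k s' assume k: "k < n" "s' x 0 = k" and I: "?I k s'"
    have "runs W (nest xs P) s' ?t (\<lambda>s''. (J s'' \<and> s'' x 0 = k) \<and> (\<forall>\<tau>. A \<tau> s' \<longrightarrow> A \<tau> s'') \<and>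
      (\<forall>\<tau>. length \<tau> = length xs \<longrightarrow> set \<tau> \<subseteq> {..<n} \<longrightarrow> A ((pre @ [k]) @ \<tau>) s''))"
    \<comment> \<open>The invariant is strengthened by the value of the outer variable, because the
      inner loops have to achieve \<open>A\<close> for lists that contain it.\<close>
    proof (rule Cons.IH[where J = "\<lambda>s. J s \<and> s x 0 = k"])
      show "distinct xs" "set xs \<inter> writes P = {}" "0 \<notin> set xs" "0 \<notin> writes P" "n \<le> W"
        using Cons.prems(1-5) by auto
      show "J s' \<and> s' x 0 = k" using I k by simp
      show "s 0 0 = n" if "J s \<and> s x 0 = k" for s using Cons.prems(6) that by blast
      show "J (upd s y 0 v) \<and> upd s y 0 v x 0 = k" if "y \<in> set xs" "J s \<and> s x 0 = k" for s y v
      proof -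
        have "x \<noteq> y" using that(1) xP by auto
        then show ?thesis using Cons.prems(7)[of y s v] that by simp
      qed
      show "A \<tau> (upd s y 0 v) = A \<tau> s" if "y \<in> set xs" for s y v \<tau>
        using Cons.prems(8) that by simp
      show "runs W P s t (\<lambda>s'. (J s' \<and> s' x 0 = k) \<and> (\<forall>\<tau>. A \<tau> s \<longrightarrow> A \<tau> s') \<and> A ((pre @ [k]) @ map (\<lambda>x. s x 0) xs) s')"
        if s: "J s \<and> s x 0 = k" "\<And>y. y \<in> set xs \<Longrightarrow> s y 0 < n" for s
      proof -
        have "runs W P s t (\<lambda>s'. J s' \<and> (\<forall>\<tau>. A \<tau> s \<longrightarrow> A \<tau> s') \<and> A (pre @ map (\<lambda>x. s x 0) (x # xs)) s')"
          by (rule Cons.prems(9)) (use s k in auto)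
        then show ?thesis by (rule runs_frame) (use xP s in auto)
      qed
    qed
    then show "runs W (nest xs P) s' ?t (\<lambda>s''. ?I (Suc k) (upd s'' x 0 (Suc k)))"
      by (rule runs_mono) (use I Cons.prems(7,8) in \<open>auto simp: less_Suc_eq\<close>)
  next
    fix s' assume "?I n s'"
    then show "J s' \<and> (\<forall>\<tau>. A \<tau> s \<longrightarrow> A \<tau> s') \<and>
      (\<forall>\<tau>. length \<tau> = length (x # xs) \<longrightarrow> set \<tau> \<subseteq> {..<n} \<longrightarrow> A (pre @ \<tau>) s')"
      by (auto simp: length_Suc_conv)
  next
    show "val (Read 0 (Const 0)) s' = n" if "\<And>a. a \<noteq> x \<Longrightarrow> a \<notin> writes (nest xs P) \<Longrightarrow> s' a = s a" for s'
      using that[of 0] Cons.prems(3,4,6,10) by simp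
  qed (rule n)
  \<comment> \<open>The overhead of 12 per loop is 10 from \<open>runs_For\<close> and 2 for reading
    the bound.\<close>
  moreover have "(?t + cost (Read 0 (Const 0)) + 10) * Suc n \<le> (t + 12 * length (x # xs)) * Suc n ^ length (x # xs)"
  proof -
    have "12 \<le> 12 * Suc n ^ length xs" by simp
    then have "?t + 12 \<le> (t + 12 * length (x # xs)) * Suc n ^ length xs" by (simp add: algebra_simps)
    from mult_le_mono1[OF this, of "Suc n"]
    have "(?t + 12) * Suc n \<le> (t + 12 * length (x # xs)) * Suc n ^ length xs * Suc n" .
    also have "\<dots> = (t + 12 * length (x # xs)) * Suc n ^ length (x # xs)"
      unfolding list.size(4) add_Suc_right add_0_right power_Suc2 by (rule mult.assoc)
    also have "?t + 12 = ?t + cost (Read 0 (Const 0)) + 10" by simp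
    finally show ?thesis .
  qed
  ultimately show ?case unfolding nest.simps by (rule runs_mono)
qed

definition var :: "nat \<Rightarrow> expr" where
  "var a = Read a (Const 0)"

definition eqE :: "expr \<Rightarrow> expr \<Rightarrow> expr" where
  "eqE x y = Sub (Sub (Const 1) (Sub x y)) (Sub y x)"

lemma val_var [simp]: "val (var a) s = s a 0"
  by (simp add: var_def)

lemma cost_var [simp]: "cost (var a) = 2"
  by (simp add: var_def)

lemma val_eqE [simp]: "val (eqE x y) s = (if val x s = val y s then 1 else 0)"
  by (simp add: eqE_def)

fun prodE :: "expr list \<Rightarrow> expr" where
  "prodE [] = Const 1"
| "prodE (x # xs) = Mul x (prodE xs)"

lemma val_prodE: "val (prodE xs) s \<noteq> 0 \<longleftrightarrow> (\<forall>x \<in> set xs. val x s \<noteq> 0)"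
  by (induction xs) auto

definition adjE :: "expr \<Rightarrow> expr \<Rightarrow> expr" where
  "adjE x y = Read 1 (Add (Mul x (var 0)) y)"

definition has_input :: "nat \<Rightarrow> nat graph \<Rightarrow> store \<Rightarrow> bool" where
  "has_input n G s \<longleftrightarrow> s 0 0 = n \<and> s 1 = input n G 1"

lemma val_adjE:
  assumes "has_input n G s" "val x s < n" "val y s < n"
  shows "val (adjE x y) s = (if adj G (val x s) (val y s) then 1 else 0)"
proof -
  have "val x s * n + val y s < n * n"
  proof -
    have "val x s * n + val y s < Suc (val x s) * n" using assms(3) by simp
    also have "\<dots> \<le> n * n" using assms(2) by (intro mult_le_mono1) simp
    finally show ?thesis .
  qed
  then show ?thesis
    using assms by (simp add: adjE_def has_input_def input_def adj_def)
qed

section \<open>Breadth-first search\<close>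

text \<open>
  \<open>d v\<close> is one more than the distance of \<open>v\<close> from the source \<open>S\<close>, or 0, along paths whose
  vertices except the last satisfy \<open>K\<close>; \<open>p v\<close> is the predecessor of \<open>v\<close>. The edge \<open>u'v'\<close> has
  been scanned if \<open>d u' \<le> k\<close>, or \<open>d u' = Suc k\<close> and \<open>(v', u')\<close> is before \<open>(v, u)\<close>.
\<close>

definition bfs_inv :: "(nat \<Rightarrow> nat \<Rightarrow> bool) \<Rightarrow> (nat \<Rightarrow> bool) \<Rightarrow> nat \<Rightarrow> nat \<Rightarrow> nat \<Rightarrow> nat \<Rightarrow> nat \<Rightarrow>
    (nat \<Rightarrow> nat) \<Rightarrow> (nat \<Rightarrow> nat) \<Rightarrow> bool" where
  "bfs_inv E K n S k v u d p \<longleftrightarrow>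
    d S = 1 \<and> (\<forall>x<n. d x \<le> k + 2 \<and> p x < n) \<and>
    (\<forall>x<n. d x \<noteq> 0 \<longrightarrow> x = S \<and> d x = 1 \<or> d x = Suc (d (p x)) \<and> d (p x) \<noteq> 0 \<and> E (p x) x \<and> K (p x)) \<and>
    (\<forall>u'<n. \<forall>v'<n. d u' \<noteq> 0 \<longrightarrow> K u' \<longrightarrow> E u' v' \<longrightarrow>
      d u' \<le> k \<or> d u' = Suc k \<and> (v' < v \<or> v' = v \<and> u' < u) \<longrightarrow> d v' \<noteq> 0 \<and> d v' \<le> Suc (d u'))"

lemma bfs_invI:
  assumes "d S = 1" "\<And>x. x < n \<Longrightarrow> d x \<le> k + 2 \<and> p x < n"
    and "\<And>x. x < n \<Longrightarrow> d x \<noteq> 0 \<Longrightarrow> x = S \<and> d x = 1 \<or> d x = Suc (d (p x)) \<and> d (p x) \<noteq> 0 \<and> E (p x) x \<and> K (p x)"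
    and "\<And>x y. x < n \<Longrightarrow> y < n \<Longrightarrow> d x \<noteq> 0 \<Longrightarrow> K x \<Longrightarrow> E x y \<Longrightarrow>
      d x \<le> k \<or> d x = Suc k \<and> (y < v \<or> y = v \<and> x < u) \<Longrightarrow> d y \<noteq> 0 \<and> d y \<le> Suc (d x)"
  shows "bfs_inv E K n S k v u d p"
  unfolding bfs_inv_def by (intro conjI allI impI assms(1,3,4) assms(2)[THEN conjunct1] assms(2)[THEN conjunct2])

lemma bfs_invD:
  assumes "bfs_inv E K n S k v u d p"
  shows "d S = 1" "\<And>x. x < n \<Longrightarrow> d x \<le> k + 2 \<and> p x < n"
    and "\<And>x. x < n \<Longrightarrow> d x \<noteq> 0 \<Longrightarrow> x = S \<and> d x = 1 \<or> d x = Suc (d (p x)) \<and> d (p x) \<noteq> 0 \<and> E (p x) x \<and> K (p x)"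
    and "\<And>x y. x < n \<Longrightarrow> y < n \<Longrightarrow> d x \<noteq> 0 \<Longrightarrow> K x \<Longrightarrow> E x y \<Longrightarrow>
      d x \<le> k \<or> d x = Suc k \<and> (y < v \<or> y = v \<and> x < u) \<Longrightarrow> d y \<noteq> 0 \<and> d y \<le> Suc (d x)"
  by (use assms in \<open>unfold bfs_inv_def, blast\<close>)+

lemma bfs_inv_init:
  assumes "S < n" "d S = 1" "\<And>x. x < n \<Longrightarrow> x \<noteq> S \<Longrightarrow> d x = 0" "\<And>x. x < n \<Longrightarrow> p x = 0"
  shows "bfs_inv E K n S 0 0 0 d p"
proof (rule bfs_invI)
  show "d x \<le> 0 + 2 \<and> p x < n" if "x < n" for x using assms that by (cases "x = S") auto
  show "x = S \<and> d x = 1 \<or> d x = Suc (d (p x)) \<and> d (p x) \<noteq> 0 \<and> E (p x) x \<and> K (p x)" if "x < n" "d x \<noteq> 0" for x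
    using assms(2) assms(3)[OF that(1)] that(2) by blast
  show "d S = 1" by (rule assms(2))
qed simp

lemma bfs_inv_mono:
  assumes I: "bfs_inv E K n S k v u d p" and k: "k \<le> k'"
    and "\<And>x y. x < n \<Longrightarrow> y < n \<Longrightarrow> d x \<le> k' \<or> d x = Suc k' \<and> (y < v' \<or> y = v' \<and> x < u') \<Longrightarrow>
      d x \<le> k \<or> d x = Suc k \<and> (y < v \<or> y = v \<and> x < u)"
  shows "bfs_inv E K n S k' v' u' d p"
proof (rule bfs_invI)
  show "d S = 1" by (rule bfs_invD(1)[OF I])
  show "d x \<le> k' + 2 \<and> p x < n" if "x < n" for x using bfs_invD(2)[OF I that] k by simp
  show "x = S \<and> d x = 1 \<or> d x = Suc (d (p x)) \<and> d (p x) \<noteq> 0 \<and> E (p x) x \<and> K (p x)" if "x < n" "d x \<noteq> 0" for x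
    by (rule bfs_invD(3)[OF I that])
  show "d y \<noteq> 0 \<and> d y \<le> Suc (d x)"
    if "x < n" "y < n" "d x \<noteq> 0" "K x" "E x y" "d x \<le> k' \<or> d x = Suc k' \<and> (y < v' \<or> y = v' \<and> x < u')" for x y
    by (rule bfs_invD(4)[OF I that(1-5) assms(3)[OF that(1,2,6)]])
qed

lemma bfs_inv_next_vertex: "bfs_inv E K n S k v n d p \<Longrightarrow> bfs_inv E K n S k (Suc v) 0 d p"
  by (erule bfs_inv_mono) auto

lemma bfs_inv_next_level: "bfs_inv E K n S k n 0 d p \<Longrightarrow> bfs_inv E K n S (Suc k) 0 0 d p"
  by (erule bfs_inv_mono) auto

text \<open>If the edge from \<open>u\<close> to \<open>v\<close> is due at level \<open>k\<close>
  but \<open>v\<close> is already labelled, nothing remains to be done: no label exceeds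
  \<open>k + 2\<close>, which is \<open>Suc (d u)\<close>.\<close>

lemma bfs_inv_skip:
  assumes I: "bfs_inv E K n S k v u d p" and v: "v < n" and no: "\<not> (d v = 0 \<and> d u = Suc k \<and> E u v \<and> K u)"
  shows "bfs_inv E K n S k v (Suc u) d p"
proof (rule bfs_invI)
  fix x y assume xy: "x < n" "y < n" "d x \<noteq> 0" "K x" "E x y"
    "d x \<le> k \<or> d x = Suc k \<and> (y < v \<or> y = v \<and> x < Suc u)"
  show "d y \<noteq> 0 \<and> d y \<le> Suc (d x)"
  proof (cases "x = u \<and> y = v \<and> d x = Suc k")
    case True
    then show ?thesis using no xy bfs_invD(2)[OF I v] by auto
  next
    case False
    then show ?thesis by (intro bfs_invD(4)[OF I xy(1-5)]) (use xy(6) in \<open>auto simp: less_Suc_eq\<close>)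
  qed
next
  show "d S = 1" by (rule bfs_invD(1)[OF I])
  show "d x \<le> k + 2 \<and> p x < n" if "x < n" for x by (rule bfs_invD(2)[OF I that])
  show "x = S \<and> d x = 1 \<or> d x = Suc (d (p x)) \<and> d (p x) \<noteq> 0 \<and> E (p x) x \<and> K (p x)" if "x < n" "d x \<noteq> 0" for x
    by (rule bfs_invD(3)[OF I that])
qed

text \<open>Labelling \<open>v\<close> breaks no earlier promise: its label \<open>k + 2\<close>
  lies beyond the level being scanned, and no admissible vertex with a nonzero label at most
  \<open>k\<close> is adjacent to \<open>v\<close>, for then \<open>v\<close> would have been
  labelled before.\<close>

lemma bfs_inv_set:
  assumes I: "bfs_inv E K n S k v u d p" and uv: "u < n" "v < n" "d v = 0" "d u = Suc k" "E u v" "K u"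
  shows "bfs_inv E K n S k v (Suc u) (d(v := k + 2)) (p(v := u))"
proof -
  note D = bfs_invD[OF I]
  have vS: "v \<noteq> S" "u \<noteq> v" using D(1) uv by auto
  show ?thesis
  proof (rule bfs_invI)
    show "(d(v := k + 2)) S = 1" using vS D(1) by simp
    show "(d(v := k + 2)) x \<le> k + 2 \<and> (p(v := u)) x < n" if "x < n" for x
      using D(2)[OF that] uv by simp
    show "x = S \<and> (d(v := k + 2)) x = 1 \<or>
        (d(v := k + 2)) x = Suc ((d(v := k + 2)) ((p(v := u)) x)) \<and> (d(v := k + 2)) ((p(v := u)) x) \<noteq> 0 \<and>
        E ((p(v := u)) x) x \<and> K ((p(v := u)) x)" if x: "x < n" "(d(v := k + 2)) x \<noteq> 0" for x
    proof (cases "x = v")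
      case True
      then show ?thesis using uv vS by simp
    next
      case False
      then have "x = S \<and> d x = 1 \<or> d x = Suc (d (p x)) \<and> d (p x) \<noteq> 0 \<and> E (p x) x \<and> K (p x)"
        using D(3) x by simp
      moreover have "p x \<noteq> v" if "d (p x) \<noteq> 0" using that uv(3) by auto
      ultimately show ?thesis using False by auto
    qed
    show "(d(v := k + 2)) y \<noteq> 0 \<and> (d(v := k + 2)) y \<le> Suc ((d(v := k + 2)) x)"
      if h: "x < n" "y < n" "(d(v := k + 2)) x \<noteq> 0" "K x" "E x y"
        "(d(v := k + 2)) x \<le> k \<or> (d(v := k + 2)) x = Suc k \<and> (y < v \<or> y = v \<and> x < Suc u)" for x y
    proof -
      have x: "x \<noteq> v" using h(6) by auto
      have dx: "d x \<noteq> 0" using h(3) x by simp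
      show ?thesis
      proof (cases "y = v")
        case True
        have "\<not> d x \<le> k"
          using D(4)[OF h(1,2) dx h(4,5)] uv(3) True by auto
        then have "d x = Suc k" using h(6) x by simp
        then show ?thesis using True x by simp
      next
        case False
        then have "d x \<le> k \<or> d x = Suc k \<and> (y < v \<or> y = v \<and> x < u)" using h(6) x by simp
        then show ?thesis using D(4)[OF h(1,2) dx h(4,5)] False x by simp
      qed
    qed
  qed
qed

section \<open>The algorithm\<close>

text \<open>
  Apart from the input and output, arrays 4 to 8 serve as loop variables, current vertex and
  flag. For indices \<open>i\<close>, \<open>j\<close> of branch vertices, array \<open>arr t i j\<close> holds the first vertex of the
  path from \<open>i\<close> to \<open>j\<close> (\<open>t = 0\<close>), its middle vertex (\<open>t = 1\<close>), the distances and predecessors of a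
  search from the first vertex (\<open>t = 2, 3\<close>), and the path itself and its length (\<open>t = 4, 5\<close>).
\<close>

definition arr :: "nat \<Rightarrow> nat \<Rightarrow> nat \<Rightarrow> nat" where
  "arr t i j = 10 + 8 * prod_encode (i, j) + t"

lemma arr_eq: "t < 8 \<Longrightarrow> t' < 8 \<Longrightarrow> arr t i j = arr t' i' j' \<longleftrightarrow> t = t' \<and> i = i' \<and> j = j'"
proof -
  assume t: "t < 8" "t' < 8"
  have "(8 * x + t) div 8 = x" "(8 * x + t) mod 8 = t" "(8 * x + t') div 8 = x" "(8 * x + t') mod 8 = t'" for x :: nat
    using t by simp_all
  then have "8 * x + t = 8 * y + t' \<longleftrightarrow> x = y \<and> t = t'" for x y :: nat by metis
  from this[of "prod_encode (i, j)" "prod_encode (i', j')"] show ?thesis by (auto simp: arr_def)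
qed

lemma arr_neq [simp]: "k < 10 \<Longrightarrow> arr t i j \<noteq> k" "k < 10 \<Longrightarrow> k \<noteq> arr t i j"
  by (simp_all add: arr_def)

definition pairs :: "(nat \<times> nat) list" where
  "pairs = [(0, 1), (0, 2), (0, 3), (1, 0), (1, 2), (1, 3), (2, 0), (2, 1), (2, 3), (3, 0), (3, 1), (3, 2)]"

definition up_pairs :: "(nat \<times> nat) list" where
  "up_pairs = [(0, 1), (0, 2), (0, 3), (1, 2), (1, 3), (2, 3)]"

lemma set_pairs: "(i, j) \<in> set pairs \<longleftrightarrow> i < 4 \<and> j < 4 \<and> i \<noteq> j"
proof
  assume "i < 4 \<and> j < 4 \<and> i \<noteq> j"
  then have "i = 0 \<or> i = 1 \<or> i = 2 \<or> i = 3" "j = 0 \<or> j = 1 \<or> j = 2 \<or> j = 3" "i \<noteq> j" by linarith+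
  then show "(i, j) \<in> set pairs" by (elim disjE) (simp_all add: pairs_def)
qed (auto simp: pairs_def)

lemma set_up_pairs: "(i, j) \<in> set up_pairs \<longleftrightarrow> i < j \<and> j < 4"
proof
  assume "i < j \<and> j < 4"
  then have "i = 0 \<or> i = 1 \<or> i = 2" "j = 1 \<or> j = 2 \<or> j = 3" "i < j" by linarith+
  then show "(i, j) \<in> set up_pairs" by (elim disjE) (simp_all add: up_pairs_def)
qed (auto simp: up_pairs_def)

definition addE :: "expr \<Rightarrow> nat \<Rightarrow> expr" where
  "addE x k = Add x (Const k)"

lemma val_addE [simp]: "val (addE x k) s = val x s + k"
  by (simp add: addE_def)

lemma cost_addE [simp]: "cost (addE x k) = cost x + 2"
  by (simp add: addE_def)

subsection \<open>Searching from the ends of the paths\<close>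

text \<open>The vertices that a search from \<open>c i j\<close> may pass through. The source is
  exempted because it is adjacent to the two other ends in its triangle. As \<open>bfs_inv\<close>
  does not test the last vertex of a path, the restriction is that of
  \<open>half_path\<close>.\<close>

definition free :: "nat graph \<Rightarrow> (nat \<Rightarrow> nat \<Rightarrow> nat) \<Rightarrow> nat \<Rightarrow> nat \<Rightarrow> nat \<Rightarrow> bool" where
  "free G c i j u \<longleftrightarrow> u = c i j \<or> (\<forall>k<4. \<forall>l<4. k \<noteq> l \<longrightarrow> {k, l} \<noteq> {i, j} \<longrightarrow> \<not> adj G u (c k l))"

definition freeE :: "nat \<Rightarrow> nat \<Rightarrow> expr \<Rightarrow> expr" where
  "freeE i j u = Add (eqE u (var (arr 0 i j)))
    (prodE (map (\<lambda>(k, l). Sub (Const 1) (adjE u (var (arr 0 k l)))) (filter (\<lambda>(k, l). {k, l} \<noteq> {i, j}) pairs)))"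

text \<open>Arrays 4, 5 and 6 hold the level \<open>k\<close>, the vertex \<open>v\<close> to be
  labelled and its possible predecessor \<open>u\<close>.\<close>

definition scanE :: "nat \<Rightarrow> nat \<Rightarrow> expr" where
  "scanE i j = prodE [eqE (Read (arr 2 i j) (var 5)) (Const 0), eqE (Read (arr 2 i j) (var 6)) (addE (var 4) 1),
    adjE (var 6) (var 5), freeE i j (var 6)]"

definition bfs :: "nat \<Rightarrow> nat \<Rightarrow> prog" where
  "bfs i j =
    Seq (For 5 (var 0) (Seq (Write (arr 2 i j) (var 5) (Const 0)) (Write (arr 3 i j) (var 5) (Const 0))))
    (Seq (Write (arr 2 i j) (var (arr 0 i j)) (Const 1))
      (For 4 (var 0) (For 5 (var 0) (For 6 (var 0)
        (If (scanE i j)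
          (Seq (Write (arr 2 i j) (var 5) (addE (var 4) 2)) (Write (arr 3 i j) (var 5) (var 6)))
          Skip)))))"

definition bfs_time :: "nat \<times> nat \<Rightarrow> nat \<Rightarrow> nat" where
  "bfs_time ij n = (cost (scanE (fst ij) (snd ij)) + 80) * Suc n ^ 3"

lemma writes_bfs: "writes (bfs i j) = {4, 5, 6, arr 2 i j, arr 3 i j}"
  by (auto simp: bfs_def)

lemma val_prodE_filter:
  "val (prodE (map f (filter P xs))) s \<noteq> 0 \<longleftrightarrow> (\<forall>x \<in> set xs. P x \<longrightarrow> val (f x) s \<noteq> 0)"
  by (induction xs) auto

lemma val_freeE:
  assumes s: "has_input n G s" and c: "\<And>k l. k < 4 \<Longrightarrow> l < 4 \<Longrightarrow> k \<noteq> l \<Longrightarrow> s (arr 0 k l) 0 < n"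
    and u: "val u s < n"
  shows "val (freeE i j u) s \<noteq> 0 \<longleftrightarrow> free G (\<lambda>k l. s (arr 0 k l) 0) i j (val u s)"
proof -
  have "val (prodE (map (\<lambda>(k, l). Sub (Const 1) (adjE u (var (arr 0 k l)))) (filter (\<lambda>(k, l). {k, l} \<noteq> {i, j}) pairs))) s \<noteq> 0
    \<longleftrightarrow> (\<forall>(k, l) \<in> set pairs. {k, l} \<noteq> {i, j} \<longrightarrow> val (Sub (Const 1) (adjE u (var (arr 0 k l)))) s \<noteq> 0)"
    unfolding val_prodE_filter by (intro ball_cong refl) (simp add: split_beta)
  also have "\<dots> \<longleftrightarrow> (\<forall>k l. (k, l) \<in> set pairs \<longrightarrow> {k, l} \<noteq> {i, j} \<longrightarrow> \<not> adj G (val u s) (s (arr 0 k l) 0))"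
  proof -
    have "val (Sub (Const 1) (adjE u (var (arr 0 k l)))) s \<noteq> 0 \<longleftrightarrow> \<not> adj G (val u s) (s (arr 0 k l) 0)"
      if "(k, l) \<in> set pairs" for k l
      using val_adjE[OF s u, of "var (arr 0 k l)"] c that unfolding set_pairs by auto
    then show ?thesis by (simp only: Ball_def split_paired_All prod.case) blast
  qed
  also have "\<dots> \<longleftrightarrow> (\<forall>k<4. \<forall>l<4. k \<noteq> l \<longrightarrow> {k, l} \<noteq> {i, j} \<longrightarrow> \<not> adj G (val u s) (s (arr 0 k l) 0))"
    unfolding set_pairs by blast
  finally have p: "val (prodE (map (\<lambda>(k, l). Sub (Const 1) (adjE u (var (arr 0 k l)))) (filter (\<lambda>(k, l). {k, l} \<noteq> {i, j}) pairs))) s \<noteq> 0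
    \<longleftrightarrow> (\<forall>k<4. \<forall>l<4. k \<noteq> l \<longrightarrow> {k, l} \<noteq> {i, j} \<longrightarrow> \<not> adj G (val u s) (s (arr 0 k l) 0))" .
  have e: "val (eqE u (var (arr 0 i j))) s \<noteq> 0 \<longleftrightarrow> val u s = s (arr 0 i j) 0" by simp
  have "a + b \<noteq> 0 \<longleftrightarrow> X \<or> Y" if "b \<noteq> 0 \<longleftrightarrow> Y" "a \<noteq> 0 \<longleftrightarrow> X" for a b :: nat and X Y
    using that by auto
  from this[OF p e] show ?thesis
    unfolding freeE_def free_def val.simps(3) .
qed

text \<open>The three loop counters are the parameters \<open>k\<close>, \<open>v\<close>,
  \<open>u\<close> of \<open>bfs_inv\<close>: an innermost round is \<open>bfs_inv_set\<close> or
  \<open>bfs_inv_skip\<close>, and the end of a loop advances the next outer parameter.\<close>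

lemma runs_bfs:
  assumes s: "has_input n G s" and c: "\<And>k l. k < 4 \<Longrightarrow> l < 4 \<Longrightarrow> k \<noteq> l \<Longrightarrow> s (arr 0 k l) 0 = c k l \<and> c k l < n"
    and W: "n + 2 \<le> W" and ij: "i < 4" "j < 4" "i \<noteq> j"
  shows "runs W (bfs i j) s (bfs_time (i, j) n)
    (\<lambda>s'. bfs_inv (adj G) (free G c i j) n (c i j) n 0 0 (s' (arr 2 i j)) (s' (arr 3 i j)))"
proof -
  let ?d = "arr 2 i j" and ?p = "arr 3 i j" and ?S = "c i j"
  let ?inv = "\<lambda>k v u s'. bfs_inv (adj G) (free G c i j) n ?S k v u (s' ?d) (s' ?p)"
  let ?cs = "cost (scanE i j)"
  let ?body = "If (scanE i j)
          (Seq (Write ?d (var 5) (addE (var 4) 2)) (Write ?p (var 5) (var 6))) Skip"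
  have dp: "?d \<noteq> ?p" "?p \<noteq> ?d" by (simp_all add: arr_eq)
  have cd: "arr 0 k l \<noteq> ?d" "arr 0 k l \<noteq> ?p" for k l by (simp_all add: arr_eq)
  have n: "s 0 0 = n" using s by (simp add: has_input_def)
  have Sn: "?S < n" using c ij by blast
  have body: "runs W ?body s' (?cs + 13) (?inv k v (Suc u))"
    if fr: "\<And>a. a \<notin> {4, 5, 6, ?d, ?p} \<Longrightarrow> s' a = s a" and loc: "s' 4 0 = k" "s' 5 0 = v" "s' 6 0 = u" "k < n" "v < n" "u < n"
      and I: "?inv k v u s'" for s' k v u
  proof -
    have s': "has_input n G s'" using s fr[of 0] fr[of 1] by (simp add: has_input_def)
    have c': "s' (arr 0 k l) 0 = c k l" "s' (arr 0 k l) 0 < n" if "k < 4" "l < 4" "k \<noteq> l" for k l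
      using fr[of "arr 0 k l"] c[OF that] cd by simp_all
    have "free G (\<lambda>k l. s' (arr 0 k l) 0) i j u \<longleftrightarrow> free G c i j u"
      using c' ij unfolding free_def by auto
    then have test: "val (scanE i j) s' \<noteq> 0 \<longleftrightarrow> s' ?d v = 0 \<and> s' ?d u = Suc k \<and> adj G u v \<and> free G c i j u"
      using val_freeE[OF s' c'(2), of "var 6" i j] val_adjE[OF s', of "var 6" "var 5"] loc
      unfolding scanE_def val_prodE by auto
    have "runs W ?body s' (1 + ?cs + 12) (?inv k v (Suc u))"
    proof (rule runs_If)
      assume "val (scanE i j) s' \<noteq> 0"
      then have t: "s' ?d v = 0" "s' ?d u = Suc k" "adj G u v" "free G c i j u" using test by auto
      have I': "bfs_inv (adj G) (free G c i j) n ?S k v (Suc u) ((s' ?d)(v := k + 2)) ((s' ?p)(v := u))"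
        by (rule bfs_inv_set[OF I loc(6,5) t])
      have "runs W (Seq (Write ?d (var 5) (addE (var 4) 2)) (Write ?p (var 5) (var 6))) s' (7 + 5) (?inv k v (Suc u))"
        by (rule runs_Seq, rule runs_Write) (use loc W dp I' in \<open>auto intro!: runs_Write simp: fun_upd_def\<close>)
      then show "runs W (Seq (Write ?d (var 5) (addE (var 4) 2)) (Write ?p (var 5) (var 6))) s' 12 (?inv k v (Suc u))"
        by simp
    next
      assume "val (scanE i j) s' = 0"
      then have "\<not> (s' ?d v = 0 \<and> s' ?d u = Suc k \<and> adj G u v \<and> free G c i j u)" using test by auto
      then have "?inv k v (Suc u) s'" by (rule bfs_inv_skip[OF I loc(5)])
      then show "runs W Skip s' 12 (?inv k v (Suc u))" by (intro runs_Skip) simp_all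
    qed
    then show ?thesis by (rule runs_mono) simp_all
  qed
  have wb: "writes ?body = {?d, ?p}" by auto
  have loop_u: "runs W (For 6 (var 0) ?body) s' ((?cs + 13 + cost (var 0) + 10) * Suc n) (?inv k (Suc v) 0)"
    if fr: "\<And>a. a \<notin> {4, 5, 6, ?d, ?p} \<Longrightarrow> s' a = s a" and loc: "s' 4 0 = k" "s' 5 0 = v" "k < n" "v < n"
      and I: "?inv k v 0 s'" for s' k v
  proof (rule runs_For[where I = "?inv k v"])
    show "runs W ?body s'' (?cs + 13) (\<lambda>s'''. ?inv k v (Suc u) (upd s''' 6 0 (Suc u)))"
      if u: "u < n" "s'' 6 0 = u" "\<And>a. a \<noteq> 6 \<Longrightarrow> a \<notin> writes ?body \<Longrightarrow> s'' a = s' a" "?inv k v u s''" for u s''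
    proof -
      have "runs W ?body s'' (?cs + 13) (?inv k v (Suc u))"
        by (rule body) (use u fr loc in \<open>auto simp: wb\<close>)
      then show ?thesis by simp
    qed
    show "val (var 0) s'' = n" if "\<And>a. a \<noteq> 6 \<Longrightarrow> a \<notin> writes ?body \<Longrightarrow> s'' a = s' a" for s''
      using that[of 0] fr[of 0] n by (simp add: wb)
    show "?inv k (Suc v) 0 s''" if "?inv k v n s''" for s'' using that by (rule bfs_inv_next_vertex)
  qed (use I W in \<open>auto simp: wb\<close>)
  let ?tu = "(?cs + 13 + cost (var 0) + 10) * Suc n"
  let ?Pu = "For 6 (var 0) ?body"
  have loop_v: "runs W (For 5 (var 0) ?Pu) s' ((?tu + cost (var 0) + 10) * Suc n) (?inv (Suc k) 0 0)"
    if fr: "\<And>a. a \<notin> {4, 5, 6, ?d, ?p} \<Longrightarrow> s' a = s a" and loc: "s' 4 0 = k" "k < n"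
      and I: "?inv k 0 0 s'" for s' k
  proof (rule runs_For[where I = "\<lambda>v. ?inv k v 0"])
    show "runs W ?Pu s'' ?tu (\<lambda>s'''. ?inv k (Suc v) 0 (upd s''' 5 0 (Suc v)))"
      if v: "v < n" "s'' 5 0 = v" "\<And>a. a \<noteq> 5 \<Longrightarrow> a \<notin> writes ?Pu \<Longrightarrow> s'' a = s' a" "?inv k v 0 s''" for v s''
    proof -
      have "runs W ?Pu s'' ?tu (?inv k (Suc v) 0)"
        by (rule loop_u) (use v fr loc in \<open>auto simp: wb\<close>)
      then show ?thesis by simp
    qed
    show "val (var 0) s'' = n" if "\<And>a. a \<noteq> 5 \<Longrightarrow> a \<notin> writes ?Pu \<Longrightarrow> s'' a = s' a" for s''
      using that[of 0] fr[of 0] n by (simp add: wb)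
    show "?inv (Suc k) 0 0 s''" if "?inv k n 0 s''" for s'' using that by (rule bfs_inv_next_level)
  qed (use I W in \<open>auto simp: wb\<close>)
  let ?tv = "(?tu + cost (var 0) + 10) * Suc n"
  let ?Pv = "For 5 (var 0) ?Pu"
  have loop_k: "runs W (For 4 (var 0) ?Pv) s' ((?tv + cost (var 0) + 10) * Suc n) (?inv n 0 0)"
    if fr: "\<And>a. a \<notin> {4, 5, 6, ?d, ?p} \<Longrightarrow> s' a = s a" and I: "?inv 0 0 0 s'" for s'
  proof (rule runs_For[where I = "\<lambda>k. ?inv k 0 0"])
    show "runs W ?Pv s'' ?tv (\<lambda>s'''. ?inv (Suc k) 0 0 (upd s''' 4 0 (Suc k)))"
      if k: "k < n" "s'' 4 0 = k" "\<And>a. a \<noteq> 4 \<Longrightarrow> a \<notin> writes ?Pv \<Longrightarrow> s'' a = s' a" "?inv k 0 0 s''" for k s''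
    proof -
      have "runs W ?Pv s'' ?tv (?inv (Suc k) 0 0)"
        by (rule loop_v) (use k fr in \<open>auto simp: wb\<close>)
      then show ?thesis by simp
    qed
    show "val (var 0) s'' = n" if "\<And>a. a \<noteq> 4 \<Longrightarrow> a \<notin> writes ?Pv \<Longrightarrow> s'' a = s' a" for s''
      using that[of 0] fr[of 0] n by (simp add: wb)
  qed (use I W in \<open>auto simp: wb\<close>)
  let ?tk = "(?tv + cost (var 0) + 10) * Suc n"
  let ?Pk = "For 4 (var 0) ?Pv"
  let ?clear = "Seq (Write ?d (var 5) (Const 0)) (Write ?p (var 5) (Const 0))"
  have wc: "writes ?clear = {?d, ?p}" by auto
  have mid: "runs W (Seq (Write ?d (var (arr 0 i j)) (Const 1)) ?Pk) s' (4 + ?tk) (?inv n 0 0)"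
    if fr: "\<And>a. a \<notin> {4, 5, 6, ?d, ?p} \<Longrightarrow> s' a = s a" and z: "\<And>v. v < n \<Longrightarrow> s' ?d v = 0 \<and> s' ?p v = 0" for s'
  proof (rule runs_Seq, rule runs_Write)
    have S: "val (var (arr 0 i j)) s' = ?S" using fr[of "arr 0 i j"] c[OF ij] cd by simp
    show "runs W ?Pk (upd s' ?d (val (var (arr 0 i j)) s') (val (Const 1) s')) ?tk (?inv n 0 0)"
    proof (rule loop_k)
      show "upd s' ?d (val (var (arr 0 i j)) s') (val (Const 1) s') a = s a" if "a \<notin> {4, 5, 6, ?d, ?p}" for a
        using that fr by simp
      show "?inv 0 0 0 (upd s' ?d (val (var (arr 0 i j)) s') (val (Const 1) s'))"
        unfolding S by (rule bfs_inv_init) (use Sn z dp in auto)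
    qed
  qed (use W in simp_all)
  have "runs W (For 5 (var 0) ?clear) s ((8 + cost (var 0) + 10) * Suc n)
    (\<lambda>s'. runs W (Seq (Write ?d (var (arr 0 i j)) (Const 1)) ?Pk) s' (4 + ?tk) (?inv n 0 0))"
  proof (rule runs_For[where I = "\<lambda>k s'. \<forall>v<k. s' ?d v = 0 \<and> s' ?p v = 0"])
    show "runs W ?clear s' 8 (\<lambda>s''. \<forall>v<Suc k. (upd s'' 5 0 (Suc k)) ?d v = 0 \<and> (upd s'' 5 0 (Suc k)) ?p v = 0)"
      if "k < n" "s' 5 0 = k" "\<forall>v<k. s' ?d v = 0 \<and> s' ?p v = 0" for k s'
    proof -
      have "runs W ?clear s' (4 + 4) (\<lambda>s''. \<forall>v<Suc k. (upd s'' 5 0 (Suc k)) ?d v = 0 \<and> (upd s'' 5 0 (Suc k)) ?p v = 0)"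
        by (rule runs_Seq, rule runs_Write) (use that dp in \<open>auto intro!: runs_Write simp: less_Suc_eq\<close>)
      then show ?thesis by simp
    qed
    show "val (var 0) s' = n" if "\<And>a. a \<noteq> 5 \<Longrightarrow> a \<notin> writes ?clear \<Longrightarrow> s' a = s a" for s'
      using that[of 0] n by (simp add: wc)
    show "runs W (Seq (Write ?d (var (arr 0 i j)) (Const 1)) ?Pk) s' (4 + ?tk) (?inv n 0 0)"
      if "\<And>a. a \<noteq> 5 \<Longrightarrow> a \<notin> writes ?clear \<Longrightarrow> s' a = s a" "\<forall>v<n. s' ?d v = 0 \<and> s' ?p v = 0" for s'
      by (rule mid) (use that in \<open>auto simp: wc\<close>)
  qed (use W in \<open>auto simp: wc\<close>)
  from runs_Seq[OF this]
  have "runs W (bfs i j) s ((8 + cost (var 0) + 10) * Suc n + (4 + ?tk)) (?inv n 0 0)"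
    unfolding bfs_def .
  \<comment> \<open>Besides \<open>?cs\<close> the coefficients add up to 73, below the 80 in
    \<open>bfs_time\<close>.\<close>
  moreover have "(8 + cost (var 0) + 10) * Suc n + (4 + ?tk) \<le> bfs_time (i, j) n"
  proof -
    have "(8 + cost (var 0) + 10) * Suc n + (4 + ?tk) =
        4 + 20 * Suc n + 12 * Suc n + 12 * Suc n ^ 2 + (?cs + 25) * Suc n ^ 3"
      by (simp add: power2_eq_square power3_eq_cube algebra_simps)
    moreover have "Suc n \<le> Suc n ^ 3" "Suc n ^ 2 \<le> Suc n ^ 3" "1 \<le> Suc n ^ 3"
      by (simp_all add: self_le_power power_increasing)
    ultimately show ?thesis by (simp add: bfs_time_def add_mult_distrib)
  qed
  ultimately show ?thesis by (rule runs_mono)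
qed

subsection \<open>Building a candidate\<close>

text \<open>\<open>d\<close> predecessor steps lead from \<open>m\<close> back to the source; the
  reversal gives the path from the source to \<open>m\<close>.\<close>

definition half :: "(nat \<Rightarrow> nat) \<Rightarrow> nat \<Rightarrow> nat \<Rightarrow> nat list" where
  "half p d m = rev (map (\<lambda>k. (p ^^ k) m) [0..<Suc d])"

lemma length_half [simp]: "length (half p d m) = Suc d"
  by (simp add: half_def)

lemma half_nth: "x \<le> d \<Longrightarrow> half p d m ! x = (p ^^ (d - x)) m"
  using nth_upt[of 0 "d - x" "Suc d"] by (simp add: half_def rev_nth del: upt_Suc)

lemma tl_rev_half: "tl (rev (half p d m)) = map (\<lambda>k. (p ^^ k) m) [1..<Suc d]"
  by (simp add: half_def map_tl[symmetric] tl_upt del: upt_Suc)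

text \<open>A path has one middle vertex, stored for its increasing pair of indices and shared by
  both orientations.\<close>

definition mid_var :: "nat \<Rightarrow> nat \<Rightarrow> expr" where
  "mid_var i j = var (arr 1 (min i j) (max i j))"

text \<open>Labels are one more than distances. An unreached middle vertex has label 0 and gets
  distance 0 by truncation; whatever candidate arises then is left to the check.\<close>

definition distE :: "nat \<Rightarrow> nat \<Rightarrow> expr" where
  "distE i j = Sub (Read (arr 2 i j) (mid_var i j)) (Const 1)"

text \<open>The first half is written downwards from position \<open>distE i j\<close> to 0,
  following predecessors from the middle towards \<open>i\<close>; the second half is written
  upwards from the same position, towards \<open>j\<close>. The middle vertex is thus written twice,
  in the same place.\<close>

definition build :: "nat \<Rightarrow> nat \<Rightarrow> prog" where
  "build i j =
    Seq (Write 7 (Const 0) (mid_var i j))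
    (Seq (For 4 (addE (distE i j) 1)
      (Seq (Write (arr 4 i j) (Sub (distE i j) (var 4)) (var 7)) (Write 7 (Const 0) (Read (arr 3 i j) (var 7)))))
    (Seq (Write 7 (Const 0) (mid_var i j))
    (Seq (For 4 (addE (distE j i) 1)
      (Seq (Write (arr 4 i j) (Add (distE i j) (var 4)) (var 7)) (Write 7 (Const 0) (Read (arr 3 j i) (var 7)))))
    (Write (arr 5 i j) (Const 0) (addE (Add (distE i j) (distE j i)) 1)))))"

definition cand :: "store \<Rightarrow> nat \<Rightarrow> nat \<Rightarrow> nat list" where
  "cand s i j = map (s (arr 4 i j)) [0..<s (arr 5 i j) 0]"

definition build_time :: "nat \<Rightarrow> nat" where
  "build_time n = 400 * Suc n"

lemma writes_build: "writes (build i j) = {4, 7, arr 4 i j, arr 5 i j}"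
  by (auto simp: build_def)

lemma cost_distE [simp]: "cost (distE i j) = 5"
  by (simp add: distE_def mid_var_def)

lemma cost_mid_var [simp]: "cost (mid_var i j) = 2"
  by (simp add: mid_var_def)

lemma runs_build:
  assumes ij: "i < j"
    and m: "s (arr 1 i j) 0 = m" "m < n" and d: "s (arr 2 i j) m \<le> n + 2" "s (arr 2 j i) m \<le> n + 2"
    and p: "\<And>x. x < n \<Longrightarrow> s (arr 3 i j) x < n" "\<And>x. x < n \<Longrightarrow> s (arr 3 j i) x < n"
    and W: "12 * n + 30 \<le> W"
  shows "runs W (build i j) s (build_time n)
    (\<lambda>s'. cand s' i j = half (s (arr 3 i j)) (s (arr 2 i j) m - 1) m @
        tl (rev (half (s (arr 3 j i)) (s (arr 2 j i) m - 1) m)))"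
proof -
  let ?r = "arr 4 i j"
  define D where "D = s (arr 2 i j) m - 1"
  define D' where "D' = s (arr 2 j i) m - 1"
  define q where "q = s (arr 3 i j)"
  define q' where "q' = s (arr 3 j i)"
  have D: "D \<le> n + 1" "D' \<le> n + 1" using d by (simp_all add: D_def D'_def)
  have q: "(q ^^ k) m < n" "(q' ^^ k) m < n" for k
    by (induction k) (use m p in \<open>auto simp: q_def q'_def\<close>)
  have mm: "min i j = i" "max i j = j" "min j i = i" "max j i = j" using ij by auto
  have a: "arr 1 i j \<noteq> ?r" "arr 2 i j \<noteq> ?r" "arr 2 j i \<noteq> ?r" "arr 3 i j \<noteq> ?r" "arr 3 j i \<noteq> ?r" "arr 5 i j \<noteq> ?r"
    "?r \<noteq> arr 5 i j"
    by (simp_all add: arr_eq)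
  let ?fr = "\<lambda>s'. \<forall>b. b \<notin> {4, 7, ?r} \<longrightarrow> s' b = s b"
  have v: "val (mid_var i j) s' = m" "val (distE i j) s' = D" "val (distE j i) s' = D'" "s' (arr 3 i j) = q" "s' (arr 3 j i) = q'"
    if "?fr s'" for s'
    using that m a by (simp_all add: mid_var_def distE_def mm D_def D'_def q_def q'_def)
  let ?b1 = "Seq (Write ?r (Sub (distE i j) (var 4)) (var 7)) (Write 7 (Const 0) (Read (arr 3 i j) (var 7)))"
  let ?b2 = "Seq (Write ?r (Add (distE i j) (var 4)) (var 7)) (Write 7 (Const 0) (Read (arr 3 j i) (var 7)))"
  have w12: "writes ?b1 = {7, ?r}" "writes ?b2 = {7, ?r}" by auto
  let ?I1 = "\<lambda>k s'. s' 7 0 = (q ^^ k) m \<and> (\<forall>x<k. s' ?r (D - x) = (q ^^ x) m)"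
  let ?I2 = "\<lambda>k s'. s' 7 0 = (q' ^^ k) m \<and> (\<forall>x\<le>D. s' ?r (D - x) = (q ^^ x) m) \<and> (\<forall>x<k. s' ?r (D + x) = (q' ^^ x) m)"
  let ?Q = "\<lambda>s'. s' (arr 5 i j) 0 = D + D' + 1 \<and> (\<forall>x\<le>D. s' ?r (D - x) = (q ^^ x) m) \<and> (\<forall>x\<le>D'. s' ?r (D + x) = (q' ^^ x) m)"
  have last: "runs W (Write (arr 5 i j) (Const 0) (addE (Add (distE i j) (distE j i)) 1)) s' 20 ?Q"
    if "?fr s'" "?I2 (D' + 1) s'" for s'
    by (rule runs_Write) (use that v[OF that(1)] a D W in auto)
  have l2: "runs W (For 4 (addE (distE j i) 1) ?b2) s' ((20 + cost (addE (distE j i) 1) + 10) * Suc (D' + 1))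
      (\<lambda>s'. runs W (Write (arr 5 i j) (Const 0) (addE (Add (distE i j) (distE j i)) 1)) s' 20 ?Q)"
    if f: "?fr s'" and I: "?I2 0 s'" for s'
  proof (rule runs_For[where I = ?I2])
    show "runs W ?b2 s'' 20 (\<lambda>t. ?I2 (Suc k) (upd t 4 0 (Suc k)))"
      if k: "k < D' + 1" "s'' 4 0 = k" "\<And>a. a \<noteq> 4 \<Longrightarrow> a \<notin> writes ?b2 \<Longrightarrow> s'' a = s' a" "?I2 k s''" for k s''
    proof -
      have f'': "?fr s''" using k(3) f by (auto simp: w12)
      have "runs W ?b2 s'' (11 + 9) (\<lambda>t. ?I2 (Suc k) (upd t 4 0 (Suc k)))"
      proof (rule runs_Seq, rule runs_Write)
        let ?s = "upd s'' ?r (val (Add (distE i j) (var 4)) s'') (val (var 7) s'')"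
        have s: "?s = upd s'' ?r (D + k) ((q' ^^ k) m)" using v(2)[OF f''] k by simp
        have q3: "?s (arr 3 j i) = q'" using v(5)[OF f''] a by simp
        show "runs W (Write 7 (Const 0) (Read (arr 3 j i) (var 7))) ?s 9 (\<lambda>t. ?I2 (Suc k) (upd t 4 0 (Suc k)))"
        proof (rule runs_Write)
          have val: "val (Read (arr 3 j i) (var 7)) ?s = (q' ^^ Suc k) m" using q3 k(4) by simp
          show "val (Read (arr 3 j i) (var 7)) ?s \<le> W" unfolding val using q(2)[of "Suc k"] W by simp
          \<comment> \<open>The second loop overwrites a position of the first half only at the
            middle, where both hold \<open>m\<close>.\<close>
          have "(q' ^^ k) m = (q ^^ x) m" if "D - x = D + k" "x \<le> D" for x
          proof -
            have "x = 0" "k = 0" using that by linarith+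
            then show ?thesis by simp
          qed
          then show "?I2 (Suc k) (upd (upd ?s 7 (val (Const 0) ?s) (val (Read (arr 3 j i) (var 7)) ?s)) 4 0 (Suc k))"
            unfolding val unfolding s using k(4) by (auto simp: less_Suc_eq)
        qed simp
        show "val (var 7) s'' \<le> W" using k(4) q(2)[of k] W by simp
      qed simp
      then show ?thesis by simp
    qed
    show "val (addE (distE j i) 1) s'' = D' + 1" if "\<And>a. a \<noteq> 4 \<Longrightarrow> a \<notin> writes ?b2 \<Longrightarrow> s'' a = s' a" for s''
    proof -
      have "?fr s''" using that f by (auto simp: w12)
      then show ?thesis using v(3) by simp
    qed
    show "runs W (Write (arr 5 i j) (Const 0) (addE (Add (distE i j) (distE j i)) 1)) s'' 20 ?Q"
      if "\<And>a. a \<noteq> 4 \<Longrightarrow> a \<notin> writes ?b2 \<Longrightarrow> s'' a = s' a" "?I2 (D' + 1) s''" for s''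
    proof -
      have "?fr s''" using that f by (auto simp: w12)
      then show ?thesis using last that(2) by blast
    qed
  qed (use I D W in \<open>auto simp: w12\<close>)
  let ?t2 = "(20 + cost (addE (distE j i) 1) + 10) * Suc (D' + 1)"
  let ?P2 = "Seq (For 4 (addE (distE j i) 1) ?b2) (Write (arr 5 i j) (Const 0) (addE (Add (distE i j) (distE j i)) 1))"
  have s3: "runs W (Seq (Write 7 (Const 0) (mid_var i j)) ?P2) s' (4 + (?t2 + 20)) ?Q"
    if f: "?fr s'" and I: "?I1 (D + 1) s'" for s'
  proof (rule runs_Seq, rule runs_Write)
    have vm: "val (mid_var i j) s' = m" using v(1)[OF f] .
    show "val (mid_var i j) s' \<le> W" unfolding vm using m W by simp
    show "runs W ?P2 (upd s' 7 (val (Const 0) s') (val (mid_var i j) s')) (?t2 + 20) ?Q"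
      unfolding vm by (rule runs_Seq[OF l2]) (use f I in \<open>auto simp: less_Suc_eq_le\<close>)
  qed simp
  let ?P3 = "Seq (Write 7 (Const 0) (mid_var i j)) ?P2"
  have l1: "runs W (For 4 (addE (distE i j) 1) ?b1) s' ((20 + cost (addE (distE i j) 1) + 10) * Suc (D + 1))
      (\<lambda>s'. runs W ?P3 s' (4 + (?t2 + 20)) ?Q)"
    if f: "?fr s'" and I: "?I1 0 s'" for s'
  proof (rule runs_For[where I = ?I1])
    show "runs W ?b1 s'' 20 (\<lambda>t. ?I1 (Suc k) (upd t 4 0 (Suc k)))"
      if k: "k < D + 1" "s'' 4 0 = k" "\<And>a. a \<noteq> 4 \<Longrightarrow> a \<notin> writes ?b1 \<Longrightarrow> s'' a = s' a" "?I1 k s''" for k s''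
    proof -
      have f'': "?fr s''" using k(3) f by (auto simp: w12)
      have "runs W ?b1 s'' (11 + 9) (\<lambda>t. ?I1 (Suc k) (upd t 4 0 (Suc k)))"
      proof (rule runs_Seq, rule runs_Write)
        let ?s = "upd s'' ?r (val (Sub (distE i j) (var 4)) s'') (val (var 7) s'')"
        have s: "?s = upd s'' ?r (D - k) ((q ^^ k) m)" using v(2)[OF f''] k by simp
        have q3: "?s (arr 3 i j) = q" using v(4)[OF f''] a by simp
        show "runs W (Write 7 (Const 0) (Read (arr 3 i j) (var 7))) ?s 9 (\<lambda>t. ?I1 (Suc k) (upd t 4 0 (Suc k)))"
        proof (rule runs_Write)
          have val: "val (Read (arr 3 i j) (var 7)) ?s = (q ^^ Suc k) m" using q3 k(4) by simp
          show "val (Read (arr 3 i j) (var 7)) ?s \<le> W" unfolding val using q(1)[of "Suc k"] W by simp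
          have "D - x \<noteq> D - k" if "x < k" for x using that k(1) by linarith
          then show "?I1 (Suc k) (upd (upd ?s 7 (val (Const 0) ?s) (val (Read (arr 3 i j) (var 7)) ?s)) 4 0 (Suc k))"
            unfolding val unfolding s using k(4) by (auto simp: less_Suc_eq)
        qed simp
        show "val (var 7) s'' \<le> W" using k(4) q(1)[of k] W by simp
      qed simp
      then show ?thesis by simp
    qed
    show "val (addE (distE i j) 1) s'' = D + 1" if "\<And>a. a \<noteq> 4 \<Longrightarrow> a \<notin> writes ?b1 \<Longrightarrow> s'' a = s' a" for s''
    proof -
      have "?fr s''" using that f by (auto simp: w12)
      then show ?thesis using v(2) by simp
    qed
    show "runs W ?P3 s'' (4 + (?t2 + 20)) ?Q"
      if "\<And>a. a \<noteq> 4 \<Longrightarrow> a \<notin> writes ?b1 \<Longrightarrow> s'' a = s' a" "?I1 (D + 1) s''" for s''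
    proof -
      have "?fr s''" using that f by (auto simp: w12)
      then show ?thesis using s3 that(2) by blast
    qed
  qed (use I D W in \<open>auto simp: w12\<close>)
  let ?t1 = "(20 + cost (addE (distE i j) 1) + 10) * Suc (D + 1)"
  have "runs W (build i j) s (4 + (?t1 + (4 + (?t2 + 20)))) ?Q"
    unfolding build_def
  proof (rule runs_Seq, rule runs_Write)
    have vm: "val (mid_var i j) s = m" by (rule v(1)) simp
    show "val (mid_var i j) s \<le> W" unfolding vm using m W by simp
    show "runs W (Seq (For 4 (addE (distE i j) 1) ?b1) ?P3) (upd s 7 (val (Const 0) s) (val (mid_var i j) s)) (?t1 + (4 + (?t2 + 20))) ?Q"
      unfolding vm by (rule runs_Seq[OF l1]) auto
  qed simp
  moreover have "4 + (?t1 + (4 + (?t2 + 20))) \<le> build_time n"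
    using D by (simp add: build_time_def)
  moreover have "cand s' i j = half q D m @ tl (rev (half q' D' m))" if Q: "?Q s'" for s'
  proof (rule nth_equalityI)
    show "length (cand s' i j) = length (half q D m @ tl (rev (half q' D' m)))"
      using Q by (simp add: cand_def tl_rev_half del: upt_Suc)
    fix x assume "x < length (cand s' i j)"
    then have x: "x < D + D' + 1" using Q by (simp add: cand_def)
    then have c: "cand s' i j ! x = s' ?r x" using Q by (simp add: cand_def del: upt_Suc)
    have Q1: "\<And>y. y \<le> D \<Longrightarrow> s' ?r (D - y) = (q ^^ y) m" and Q2: "\<And>y. y \<le> D' \<Longrightarrow> s' ?r (D + y) = (q' ^^ y) m"
      using Q by blast+
    show "cand s' i j ! x = (half q D m @ tl (rev (half q' D' m))) ! x"
    proof (cases "x \<le> D")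
      case True
      then have "s' ?r (D - (D - x)) = (q ^^ (D - x)) m" by (intro Q1) simp
      moreover have "(half q D m @ tl (rev (half q' D' m))) ! x = (q ^^ (D - x)) m"
        using True by (simp add: nth_append half_nth)
      ultimately show ?thesis using c True by simp
    next
      case False
      then have "s' ?r (D + (x - D)) = (q' ^^ (x - D)) m" by (intro Q2) (use x in simp)
      moreover have "(half q D m @ tl (rev (half q' D' m))) ! x = (q' ^^ (x - D)) m"
        using False x nth_upt[of 1 "x - Suc D" "Suc D'"] by (simp add: tl_rev_half nth_append Suc_diff_Suc del: upt_Suc)
      ultimately show ?thesis using c False by simp
    qed
  qed
  ultimately show ?thesis
    unfolding D_def[symmetric] D'_def[symmetric] q_def[symmetric] q'_def[symmetric] by (rule runs_mono)
qed

subsection \<open>Checking a candidate\<close>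

definition end_pos :: "nat \<Rightarrow> nat \<Rightarrow> nat \<Rightarrow> nat \<Rightarrow> bool" where
  "end_pos i c L a \<longleftrightarrow> (if c = i then a = 0 else Suc a = L)"

text \<open>The adjacency that \<open>K4_paths\<close> prescribes, in terms of positions:
  consecutive positions on one path, the two ends at a common branch vertex, and nothing on opposite
  paths.\<close>

definition touch :: "nat \<Rightarrow> nat \<Rightarrow> nat \<Rightarrow> nat \<Rightarrow> nat \<Rightarrow> nat \<Rightarrow> nat \<Rightarrow> nat \<Rightarrow> bool" where
  "touch i j k l L L' a b \<longleftrightarrow>
    (if i = k \<and> j = l then b = Suc a \<or> a = Suc b
     else if i = k \<or> i = l then end_pos i i L a \<and> end_pos k i L' b
     else if j = k \<or> j = l then end_pos i j L a \<and> end_pos k j L' b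
     else False)"

definition pair_ok :: "nat graph \<Rightarrow> nat \<Rightarrow> nat \<Rightarrow> nat \<Rightarrow> nat \<Rightarrow> nat \<Rightarrow> nat list \<Rightarrow> nat list \<Rightarrow> bool" where
  "pair_ok G n i j k l p q \<longleftrightarrow> (\<forall>a<length p. \<forall>b<length q. p ! a < n \<and> q ! b < n \<and>
    (adj G (p ! a) (q ! b) \<longleftrightarrow> touch i j k l (length p) (length q) a b) \<and>
    (p ! a = q ! b \<longleftrightarrow> i = k \<and> j = l \<and> a = b))"

definition endE :: "nat \<Rightarrow> nat \<Rightarrow> expr \<Rightarrow> expr \<Rightarrow> expr" where
  "endE i c L a = (if c = i then eqE a (Const 0) else eqE (addE a 1) L)"

definition touchE :: "nat \<Rightarrow> nat \<Rightarrow> nat \<Rightarrow> nat \<Rightarrow> expr" where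
  "touchE i j k l =
    (if i = k \<and> j = l then Add (eqE (var 5) (addE (var 4) 1)) (eqE (var 4) (addE (var 5) 1))
     else if i = k \<or> i = l then Mul (endE i i (var (arr 5 i j)) (var 4)) (endE k i (var (arr 5 k l)) (var 5))
     else if j = k \<or> j = l then Mul (endE i j (var (arr 5 i j)) (var 4)) (endE k j (var (arr 5 k l)) (var 5))
     else Const 0)"

definition okE :: "nat \<Rightarrow> nat \<Rightarrow> nat \<Rightarrow> nat \<Rightarrow> expr" where
  "okE i j k l = (let x = Read (arr 4 i j) (var 4); y = Read (arr 4 k l) (var 5) in
    prodE [Sub (var 0) x, Sub (var 0) y, eqE (adjE x y) (touchE i j k l),
      eqE (eqE x y) (if i = k \<and> j = l then eqE (var 4) (var 5) else Const 0)])"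

text \<open>The flag in array 8 is only ever cleared, so that after all checks it tells whether
  every one of them succeeded.\<close>

definition check :: "nat \<Rightarrow> nat \<Rightarrow> nat \<Rightarrow> nat \<Rightarrow> prog" where
  "check i j k l = For 4 (var (arr 5 i j)) (For 5 (var (arr 5 k l))
    (If (okE i j k l) Skip (Write 8 (Const 0) (Const 0))))"

definition check_time :: "nat \<Rightarrow> nat \<Rightarrow> nat \<Rightarrow> nat \<Rightarrow> nat \<Rightarrow> nat" where
  "check_time i j k l n = (cost (okE i j k l) + 40) * (2 * n + 4) ^ 2"

lemma writes_check: "writes (check i j k l) = {4, 5, 8}"
  by (auto simp: check_def)

lemma val_endE: "val (endE i c L a) s = of_bool (end_pos i c (val L s) (val a s))"
  by (simp add: endE_def end_pos_def)

lemma val_touchE: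
  "val (touchE i j k l) s = of_bool (touch i j k l (s (arr 5 i j) 0) (s (arr 5 k l) 0) (s 4 0) (s 5 0))"
proof -
  consider "i = k \<and> j = l" | "\<not> (i = k \<and> j = l)" "i = k \<or> i = l" | "\<not> (i = k \<and> j = l)" "\<not> (i = k \<or> i = l)" "j = k \<or> j = l"
    | "\<not> (i = k \<and> j = l)" "\<not> (i = k \<or> i = l)" "\<not> (j = k \<or> j = l)" by blast
  then show ?thesis
  proof cases
    case 1
    then show ?thesis unfolding touchE_def touch_def by (simp only: if_P) auto
  next
    case 2
    then show ?thesis unfolding touchE_def touch_def if_not_P[OF 2(1)] if_P[OF 2(2)] val.simps(5) val_endE
      by (simp only: val_var of_bool_conj)
  next
    case 3
    then show ?thesis unfolding touchE_def touch_def if_not_P[OF 3(1)] if_not_P[OF 3(2)] if_P[OF 3(3)] val.simps(5) val_endE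
      by (simp only: val_var of_bool_conj)
  next
    case 4
    then show ?thesis unfolding touchE_def touch_def if_not_P[OF 4(1)] if_not_P[OF 4(2)] if_not_P[OF 4(3)] by simp
  qed
qed

text \<open>On the bound \<open>2 * n + 3\<close>: labels are at most \<open>n + 2\<close>, so each
  half has at most \<open>n + 2\<close> vertices, and the two halves share the middle.\<close>

lemma runs_check:
  assumes s: "has_input n G s" and L: "s (arr 5 i j) 0 \<le> 2 * n + 3" "s (arr 5 k l) 0 \<le> 2 * n + 3" and W: "12 * n + 30 \<le> W"
  shows "runs W (check i j k l) s (check_time i j k l n)
    (\<lambda>s'. s' 8 0 \<noteq> 0 \<longleftrightarrow> s 8 0 \<noteq> 0 \<and> pair_ok G n i j k l (cand s i j) (cand s k l))"
proof -
  let ?p = "cand s i j" and ?q = "cand s k l"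
  let ?t = "cost (okE i j k l) + 4"
  define ok where "ok a b \<longleftrightarrow> ?p ! a < n \<and> ?q ! b < n \<and>
    (adj G (?p ! a) (?q ! b) \<longleftrightarrow> touch i j k l (length ?p) (length ?q) a b) \<and>
    (?p ! a = ?q ! b \<longleftrightarrow> i = k \<and> j = l \<and> a = b)" for a b
  have len: "length ?p = s (arr 5 i j) 0" "length ?q = s (arr 5 k l) 0" by (simp_all add: cand_def)
  let ?b = "If (okE i j k l) Skip (Write 8 (Const 0) (Const 0))"
  have body: "runs W ?b s' ?t (\<lambda>s''. s'' 8 0 \<noteq> 0 \<longleftrightarrow> s' 8 0 \<noteq> 0 \<and> ok a b)"
    if fr: "\<And>c. c \<notin> {4, 5, 8} \<Longrightarrow> s' c = s c" and ab: "s' 4 0 = a" "s' 5 0 = b" "a < length ?p" "b < length ?q" for s' a b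
  proof -
    have s': "has_input n G s'" using s fr[of 0] fr[of 1] by (simp add: has_input_def)
    have x: "s' (arr 4 i j) a = ?p ! a" "s' (arr 4 k l) b = ?q ! b"
      using ab(3,4) fr by (simp_all add: cand_def)
    have n: "s' 0 0 = n" using s' by (simp add: has_input_def)
    have vx: "val (Read (arr 4 i j) (var 4)) s' = ?p ! a" "val (Read (arr 4 k l) (var 5)) s' = ?q ! b"
      using x ab by simp_all
    have vt: "val (touchE i j k l) s' = of_bool (touch i j k l (length ?p) (length ?q) a b)"
      unfolding val_touchE len using fr ab by simp
    have "val (okE i j k l) s' \<noteq> 0 \<longleftrightarrow> ok a b"
    proof (cases "?p ! a < n \<and> ?q ! b < n")
      case True
      then have va: "val (adjE (Read (arr 4 i j) (var 4)) (Read (arr 4 k l) (var 5))) s' = of_bool (adj G (?p ! a) (?q ! b))"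
        using val_adjE[OF s', of "Read (arr 4 i j) (var 4)" "Read (arr 4 k l) (var 5)"] vx by simp
      have ve: "val (if i = k \<and> j = l then eqE (var 4) (var 5) else Const 0) s' = of_bool (i = k \<and> j = l \<and> a = b)"
        using ab by auto
      have v1: "val (eqE (adjE (Read (arr 4 i j) (var 4)) (Read (arr 4 k l) (var 5))) (touchE i j k l)) s' \<noteq> 0 \<longleftrightarrow>
          (adj G (?p ! a) (?q ! b) \<longleftrightarrow> touch i j k l (length ?p) (length ?q) a b)"
        unfolding val_eqE va vt by simp
      have v2: "val (eqE (eqE (Read (arr 4 i j) (var 4)) (Read (arr 4 k l) (var 5)))
          (if i = k \<and> j = l then eqE (var 4) (var 5) else Const 0)) s' \<noteq> 0 \<longleftrightarrow> (?p ! a = ?q ! b \<longleftrightarrow> i = k \<and> j = l \<and> a = b)"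
        unfolding val_eqE ve vx by simp
      have v3: "val (Sub (var 0) (Read (arr 4 i j) (var 4))) s' \<noteq> 0" "val (Sub (var 0) (Read (arr 4 k l) (var 5))) s' \<noteq> 0"
        unfolding val.simps(4) vx using True n by simp_all
      have "val (okE i j k l) s' \<noteq> 0 \<longleftrightarrow> (adj G (?p ! a) (?q ! b) \<longleftrightarrow> touch i j k l (length ?p) (length ?q) a b) \<and>
        (?p ! a = ?q ! b \<longleftrightarrow> i = k \<and> j = l \<and> a = b)"
        unfolding okE_def Let_def val_prodE list.set ball_simps(7) using v1 v2 v3 by blast
      then show ?thesis using True by (simp add: ok_def)
    next
      \<comment> \<open>An entry outside the graph makes the value of \<open>adjE\<close>
        meaningless, but then one of the first two factors is 0 and annuls the product.\<close>
      case False
      then have "val (Sub (var 0) (Read (arr 4 i j) (var 4))) s' = 0 \<or> val (Sub (var 0) (Read (arr 4 k l) (var 5))) s' = 0"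
        unfolding val.simps(4) vx using n by auto
      then have "val (okE i j k l) s' = 0"
        unfolding okE_def Let_def prodE.simps val.simps(5) by auto
      then show ?thesis using False by (auto simp: ok_def)
    qed
    then have "runs W ?b s' (1 + cost (okE i j k l) + 3) (\<lambda>s''. s'' 8 0 \<noteq> 0 \<longleftrightarrow> s' 8 0 \<noteq> 0 \<and> ok a b)"
      by (intro runs_If) (auto intro!: runs_Skip runs_Write)
    then show ?thesis by (rule runs_mono) simp_all
  qed
  have wb: "writes ?b = {8}" by simp
  let ?M = "length ?q" and ?N = "length ?p"
  let ?Pb = "For 5 (var (arr 5 k l)) ?b"
  let ?tb = "(?t + cost (var (arr 5 k l)) + 10) * Suc ?M"
  have loop_b: "runs W ?Pb s' ?tb (\<lambda>s''. s'' 8 0 \<noteq> 0 \<longleftrightarrow> s' 8 0 \<noteq> 0 \<and> (\<forall>b<?M. ok a b))"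
    if fr: "\<And>c. c \<notin> {4, 5, 8} \<Longrightarrow> s' c = s c" and a: "s' 4 0 = a" "a < ?N" for s' a
  proof (rule runs_For[where I = "\<lambda>m s''. s'' 8 0 \<noteq> 0 \<longleftrightarrow> s' 8 0 \<noteq> 0 \<and> (\<forall>b<m. ok a b)"])
    show "runs W ?b s'' ?t (\<lambda>s'''. upd s''' 5 0 (Suc b) 8 0 \<noteq> 0 \<longleftrightarrow> s' 8 0 \<noteq> 0 \<and> (\<forall>y<Suc b. ok a y))"
      if b: "b < ?M" "s'' 5 0 = b" "\<And>c. c \<noteq> 5 \<Longrightarrow> c \<notin> writes ?b \<Longrightarrow> s'' c = s' c"
        "s'' 8 0 \<noteq> 0 \<longleftrightarrow> s' 8 0 \<noteq> 0 \<and> (\<forall>y<b. ok a y)" for b s''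
    proof -
      have "runs W ?b s'' ?t (\<lambda>s'''. s''' 8 0 \<noteq> 0 \<longleftrightarrow> s'' 8 0 \<noteq> 0 \<and> ok a b)"
        by (rule body) (use b fr a in \<open>auto simp: wb\<close>)
      then show ?thesis by (rule runs_mono) (use b(4) in \<open>auto simp: less_Suc_eq\<close>)
    qed
    show "val (var (arr 5 k l)) s'' = ?M" if "\<And>c. c \<noteq> 5 \<Longrightarrow> c \<notin> writes ?b \<Longrightarrow> s'' c = s' c" for s''
      using that[of "arr 5 k l"] fr[of "arr 5 k l"] by (simp add: wb len)
  qed (use W L in \<open>auto simp: wb len\<close>)
  have wB: "writes ?Pb = {5, 8}" by auto
  have "runs W (check i j k l) s ((?tb + cost (var (arr 5 i j)) + 10) * Suc ?N)
    (\<lambda>s'. s' 8 0 \<noteq> 0 \<longleftrightarrow> s 8 0 \<noteq> 0 \<and> pair_ok G n i j k l ?p ?q)"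
    unfolding check_def
  proof (rule runs_For[where I = "\<lambda>m s''. s'' 8 0 \<noteq> 0 \<longleftrightarrow> s 8 0 \<noteq> 0 \<and> (\<forall>a<m. \<forall>b<?M. ok a b)"])
    show "runs W ?Pb s'' ?tb (\<lambda>s'''. upd s''' 4 0 (Suc a) 8 0 \<noteq> 0 \<longleftrightarrow> s 8 0 \<noteq> 0 \<and> (\<forall>x<Suc a. \<forall>b<?M. ok x b))"
      if a: "a < ?N" "s'' 4 0 = a" "\<And>c. c \<noteq> 4 \<Longrightarrow> c \<notin> writes ?Pb \<Longrightarrow> s'' c = s c"
        "s'' 8 0 \<noteq> 0 \<longleftrightarrow> s 8 0 \<noteq> 0 \<and> (\<forall>x<a. \<forall>b<?M. ok x b)" for a s''
    proof -
      have "runs W ?Pb s'' ?tb (\<lambda>s'''. s''' 8 0 \<noteq> 0 \<longleftrightarrow> s'' 8 0 \<noteq> 0 \<and> (\<forall>b<?M. ok a b))"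
        by (rule loop_b) (use a in \<open>auto simp: wB\<close>)
      then show ?thesis by (rule runs_mono) (use a(4) in \<open>auto simp: less_Suc_eq\<close>)
    qed
    show "val (var (arr 5 i j)) s'' = ?N" if "\<And>c. c \<noteq> 4 \<Longrightarrow> c \<notin> writes ?Pb \<Longrightarrow> s'' c = s c" for s''
      using that[of "arr 5 i j"] by (simp add: wB len)
    show "s'' 8 0 \<noteq> 0 \<longleftrightarrow> s 8 0 \<noteq> 0 \<and> pair_ok G n i j k l ?p ?q"
      if "s'' 8 0 \<noteq> 0 \<longleftrightarrow> s 8 0 \<noteq> 0 \<and> (\<forall>a<?N. \<forall>b<?M. ok a b)" for s''
      using that unfolding pair_ok_def ok_def by blast
  qed (use W L in \<open>auto simp: wB len\<close>)
  moreover have "(?tb + cost (var (arr 5 i j)) + 10) * Suc ?N \<le> check_time i j k l n"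
  proof -
    have "?tb + 12 \<le> (cost (okE i j k l) + 28) * (2 * n + 4)"
    proof -
      have "?tb \<le> (cost (okE i j k l) + 16) * (2 * n + 4)" using L by (intro mult_le_mono) (simp_all add: len)
      then show ?thesis by (simp add: add_mult_distrib)
    qed
    then have "(?tb + 12) * Suc ?N \<le> (cost (okE i j k l) + 28) * (2 * n + 4) * (2 * n + 4)"
      using L by (intro mult_le_mono) (simp_all add: len)
    also have "\<dots> \<le> check_time i j k l n"
      unfolding check_time_def power2_eq_square mult.assoc[symmetric] by (intro mult_le_mono) simp_all
    finally show ?thesis by simp
  qed
  ultimately show ?thesis by (rule runs_mono)
qed

text \<open>The counterpart of \<open>touch\<close> in terms of vertices: the contacts permitted
  between a path \<open>p\<close> from \<open>i\<close> to \<open>j\<close> and a path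
  \<open>q\<close> from \<open>k\<close> to \<open>l\<close>.\<close>

definition joint :: "nat \<Rightarrow> nat \<Rightarrow> nat \<Rightarrow> nat \<Rightarrow> 'a list \<Rightarrow> 'a list \<Rightarrow> ('a \<times> 'a) set" where
  "joint i j k l p q =
    (if i = k \<or> i = l then {(hd p, if i = k then hd q else last q)}
     else if j = k \<or> j = l then {(last p, if j = k then hd q else last q)} else {})"

lemma nth_eq_last: "distinct p \<Longrightarrow> a < length p \<Longrightarrow> p ! a = last p \<longleftrightarrow> Suc a = length p"
proof -
  assume p: "distinct p" "a < length p"
  then have "p \<noteq> []" by auto
  then have "last p = p ! (length p - 1)" by (rule last_conv_nth)
  moreover have "p ! a = p ! (length p - 1) \<longleftrightarrow> a = length p - 1"
    using p by (intro nth_eq_iff_index_eq) auto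
  ultimately show ?thesis using p(2) by auto
qed

text \<open>On lists without repetition, being an end vertex and being at an end position are the
  same. Both lists must be nonempty, as \<open>pair_ok\<close> says nothing about one list if the
  other is empty.\<close>

lemma pair_ok_iff_con:
  assumes G: "simple_graph G" and ij: "\<not> (i = k \<and> j = l)" "i \<noteq> j" "k \<noteq> l" and d: "distinct p" "distinct q"
    and ne: "p \<noteq> []" "q \<noteq> []"
  shows "pair_ok G n i j k l p q \<longleftrightarrow> set p \<subseteq> {..<n} \<and> set q \<subseteq> {..<n} \<and> sym_rel.con (adj G) (set p) (set q) (joint i j k l p q)"
proof -
  interpret sym_rel "adj G" by (rule sym_rel_adj[OF G])
  have t: "touch i j k l (length p) (length q) a b \<longleftrightarrow> (p ! a, q ! b) \<in> joint i j k l p q"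
    if "a < length p" "b < length q" for a b
  proof -
    note ends = nth_eq_hd[OF d(1) that(1)] nth_eq_hd[OF d(2) that(2)] nth_eq_last[OF d(1) that(1)] nth_eq_last[OF d(2) that(2)]
    consider "i = k \<or> i = l" | "\<not> (i = k \<or> i = l)" "j = k \<or> j = l" | "\<not> (i = k \<or> i = l)" "\<not> (j = k \<or> j = l)"
      by blast
    then show ?thesis
    proof cases
      case 1
      show ?thesis unfolding touch_def joint_def if_not_P[OF ij(1)] if_P[OF 1] end_pos_def
        by (cases "i = k") (simp_all add: ends)
    next
      case 2
      show ?thesis unfolding touch_def joint_def if_not_P[OF ij(1)] if_not_P[OF 2(1)] if_P[OF 2(2)] end_pos_def
        using ij(2) by (cases "j = k") (simp_all add: ends)
    next
      case 3
      show ?thesis unfolding touch_def joint_def if_not_P[OF ij(1)] if_not_P[OF 3(1)] if_not_P[OF 3(2)] by simp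
    qed
  qed
  have "pair_ok G n i j k l p q \<longleftrightarrow> (\<forall>a<length p. \<forall>b<length q. p ! a < n \<and> q ! b < n \<and>
    (adj G (p ! a) (q ! b) \<longleftrightarrow> (p ! a, q ! b) \<in> joint i j k l p q) \<and> p ! a \<noteq> q ! b)"
    unfolding pair_ok_def using t ij(1) by auto
  also have "\<dots> \<longleftrightarrow> (\<forall>x\<in>set p. \<forall>y\<in>set q. x < n \<and> y < n \<and> (adj G x y \<longleftrightarrow> (x, y) \<in> joint i j k l p q) \<and> x \<noteq> y)"
    by (simp only: all_set_conv_all_nth)
  also have "\<dots> \<longleftrightarrow> set p \<subseteq> {..<n} \<and> set q \<subseteq> {..<n} \<and> con (set p) (set q) (joint i j k l p q)"
  proof
    assume h: "\<forall>x\<in>set p. \<forall>y\<in>set q. x < n \<and> y < n \<and> (adj G x y \<longleftrightarrow> (x, y) \<in> joint i j k l p q) \<and> x \<noteq> y"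
    have "x < n" if "x \<in> set p" for x using h that hd_in_set[OF ne(2)] by blast
    moreover have "y < n" if "y \<in> set q" for y using h that hd_in_set[OF ne(1)] by blast
    ultimately show "set p \<subseteq> {..<n} \<and> set q \<subseteq> {..<n} \<and> con (set p) (set q) (joint i j k l p q)"
      using h unfolding con_def by blast
  qed (auto simp: con_def)
  finally show ?thesis .
qed

lemma pair_ok_same:
  assumes G: "simple_graph G" and p: "p \<noteq> []"
  shows "pair_ok G n i j i j p p \<longleftrightarrow> set p \<subseteq> {..<n} \<and> sym_rel.ipath (adj G) p"
proof -
  interpret sym_rel "adj G" by (rule sym_rel_adj[OF G])
  show ?thesis
  proof
    assume h: "pair_ok G n i j i j p p"
    have "set p \<subseteq> {..<n}" using h unfolding pair_ok_def by (auto simp: in_set_conv_nth)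
    moreover have "distinct p" using h unfolding pair_ok_def distinct_conv_nth by blast
    ultimately show "set p \<subseteq> {..<n} \<and> ipath p"
      using h p unfolding ipath_nth pair_ok_def touch_def by simp
  next
    assume h: "set p \<subseteq> {..<n} \<and> ipath p"
    then have d: "distinct p" by (simp add: ipath_distinct)
    have "p ! a < n" if "a < length p" for a using h that nth_mem by blast
    then show "pair_ok G n i j i j p p"
      using h nth_eq_iff_index_eq[OF d] unfolding ipath_nth pair_ok_def touch_def by simp
  qed
qed

definition all_ok :: "nat graph \<Rightarrow> nat \<Rightarrow> (nat \<Rightarrow> nat \<Rightarrow> nat list) \<Rightarrow> bool" where
  "all_ok G n p \<longleftrightarrow> (\<forall>((i, j), (k, l)) \<in> set (List.product up_pairs up_pairs). pair_ok G n i j k l (p i j) (p k l))"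

lemma all_okD:
  "all_ok G n p \<Longrightarrow> i < j \<Longrightarrow> j < 4 \<Longrightarrow> k < l \<Longrightarrow> l < 4 \<Longrightarrow> pair_ok G n i j k l (p i j) (p k l)"
  unfolding all_ok_def using set_up_pairs[of i j] set_up_pairs[of k l] by auto

text \<open>Soundness of the check: it covers the six paths and the fifteen contacts that
  \<open>K4_ofI\<close> asks for.\<close>

lemma all_ok_K4_of:
  assumes G: "simple_graph G" and ok: "all_ok G n p" and ne: "\<And>i j. i < j \<Longrightarrow> j < 4 \<Longrightarrow> p i j \<noteq> []"
  shows "sym_rel.K4_paths (adj G) (K4_of (p 0 1) (p 0 2) (p 0 3) (p 1 2) (p 1 3) (p 2 3))"
proof -
  interpret sym_rel "adj G" by (rule sym_rel_adj[OF G])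
  have ip: "ipath (p i j)" if "i < j" "j < 4" for i j
    using all_okD[OF ok that that] pair_ok_same[OF G ne[OF that]] by blast
  have con: "con (set (p i j)) (set (p k l)) (joint i j k l (p i j) (p k l))"
    if "i < j" "j < 4" "k < l" "l < 4" "\<not> (i = k \<and> j = l)" for i j k l
    using all_okD[OF ok that(1-4)]
      pair_ok_iff_con[OF G that(5) _ _ ipath_distinct[OF ip[OF that(1,2)]] ipath_distinct[OF ip[OF that(3,4)]] ne[OF that(1,2)] ne[OF that(3,4)]]
      that by auto
  show ?thesis
    by (rule K4_ofI)
      (use ip con[of 0 1 0 2] con[of 0 1 0 3] con[of 0 2 0 3] con[of 0 1 1 2] con[of 0 1 1 3] con[of 1 2 1 3]
        con[of 0 2 1 2] con[of 0 2 2 3] con[of 1 2 2 3] con[of 0 3 1 3] con[of 0 3 2 3] con[of 1 3 2 3]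
        con[of 0 1 2 3] con[of 0 2 1 3] con[of 0 3 1 2] in \<open>simp_all add: joint_def\<close>)
qed

text \<open>Completeness of the check: a true structure inside the graph is never rejected. The
  cases are the ways in which two increasing index pairs can overlap.\<close>

lemma K4_paths_all_ok:
  assumes G: "simple_graph G" and R: "sym_rel.K4_paths (adj G) R" and V: "K4_verts R \<subseteq> {..<n}"
    and p: "\<And>i j. i < j \<Longrightarrow> j < 4 \<Longrightarrow> p i j = R i j"
  shows "all_ok G n p"
proof -
  interpret sym_rel "adj G" by (rule sym_rel_adj[OF G])
  have sub: "set (R i j) \<subseteq> {..<n}" if "i < j" "j < 4" for i j
    using V that unfolding K4_verts_def by fastforce
  have ok: "pair_ok G n i j k l (R i j) (R k l)" if ij: "i < j" "j < 4" and kl: "k < l" "l < 4" for i j k l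
  proof -
    have b: "i < 4" "k < 4" "i \<noteq> j" "k \<noteq> l" using ij kl by auto
    have ip: "ipath (R i j)" "ipath (R k l)" using K4_ipath[OF R] b ij kl by blast+
    note ne = ipath_nonempty[OF ip(1)] ipath_nonempty[OF ip(2)]
    note d = ipath_distinct[OF ip(1)] ipath_distinct[OF ip(2)]
    have e: "set (R j i) = set (R i j)" "hd (R j i) = last (R i j)" "set (R l k) = set (R k l)" "hd (R l k) = last (R k l)"
      using K4_set[OF R b(1) ij(2) b(3)] K4_last[OF R b(1) ij(2) b(3)] K4_set[OF R b(2) kl(2) b(4)] K4_last[OF R b(2) kl(2) b(4)]
      by simp_all
    show ?thesis
    proof (cases "i = k \<and> j = l")
      case True
      then show ?thesis using pair_ok_same[OF G ne(1)] sub[OF ij] ip by simp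
    next
      case False
      consider "i = k" "j \<noteq> l" | "i = l" | "j = k" | "j = l" "i \<noteq> k" | "distinct [i, j, k, l]"
        using False ij kl by fastforce
      then have "con (set (R i j)) (set (R k l)) (joint i j k l (R i j) (R k l))"
      proof cases
        case 1
        then show ?thesis using K4_con[OF R b(1) ij(2) kl(2) b(3)] b by (simp add: joint_def)
      next
        case 2
        then show ?thesis using K4_con[OF R b(1) ij(2) b(2) b(3)] b e ij kl by (simp add: joint_def)
      next
        case 3
        then show ?thesis using K4_con[OF R ij(2) b(1) kl(2)] b e ij kl by (simp add: joint_def)
      next
        case 4
        then show ?thesis using K4_con[OF R ij(2) b(1) b(2)] b e ij kl by (simp add: joint_def)
      next
        case 5
        then show ?thesis using K4_con_opp[OF R b(1) ij(2) b(2) kl(2) 5] by (simp add: joint_def)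
      qed
      then show ?thesis
        using pair_ok_iff_con[OF G False b(3,4) d ne] sub[OF ij] sub[OF kl] by blast
    qed
  qed
  show ?thesis
    unfolding all_ok_def
  proof (clarsimp)
    fix i j k l assume "(i, j) \<in> set up_pairs" "(k, l) \<in> set up_pairs"
    then show "pair_ok G n i j k l (p i j) (p k l)"
      unfolding set_up_pairs using ok p by simp
  qed
qed

text \<open>What the search finds is a shortest admissible path, so it is at most as long as half of \<open>R i j\<close>.\<close>

lemma bfs_half_path:
  assumes G: "simple_graph G" and R: "sym_rel.K4_paths (adj G) R" and V: "K4_verts R \<subseteq> {..<n}"
    and ij: "i < 4" "j < 4" "i \<noteq> j" and a: "a < length (R i j)" "2 * a \<le> length (R i j)" and m: "m = R i j ! a"
    and c: "\<And>k l. k < 4 \<Longrightarrow> l < 4 \<Longrightarrow> k \<noteq> l \<Longrightarrow> c k l = hd (R k l)"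
    and I: "bfs_inv (adj G) (free G c i j) n (c i j) n 0 0 d p"
  shows "sym_rel.half_path (adj G) R i j a (half p (d m - 1) m)"
proof -
  interpret sym_rel "adj G" by (rule sym_rel_adj[OF G])
  note D = bfs_invD[OF I]
  let ?r = "R i j"
  have ip: "ipath ?r" by (rule K4_ipath[OF R ij])
  note dist = ipath_distinct[OF ip]
  have sub: "set ?r \<subseteq> {..<n}" using V ij unfolding K4_verts_def by fastforce
  \<comment> \<open>The search stops after \<open>n\<close> levels; as the path has at most
    \<open>n\<close> vertices, every label needed along it has been scanned.\<close>
  have len: "length ?r \<le> n"
    using card_mono[OF _ sub] distinct_card[OF dist] by simp
  have "?r \<noteq> []" using a(1) by force
  then have hd0: "hd ?r = ?r ! 0" by (simp add: hd_conv_nth)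
  have S: "c i j = ?r ! 0" using c[OF ij] hd0 by simp
  have in_n: "?r ! t < n" if "t < length ?r" for t using sub nth_mem[OF that] by blast
  have free_iff: "free G c i j u \<longleftrightarrow> u = c i j \<or> (\<forall>k<4. \<forall>l<4. k \<noteq> l \<longrightarrow> {k, l} \<noteq> {i, j} \<longrightarrow> \<not> adj G u (hd (R k l)))" for u
    unfolding free_def using c by auto
  \<comment> \<open>Inner vertices of \<open>R i j\<close> are detached from the other paths, in
    particular from their ends, so the search can follow \<open>R i j\<close> itself; this bounds
    the labels along it.\<close>
  have fr: "free G c i j (?r ! t)" if "t < a" for t
  proof (cases "t = 0")
    case True
    then show ?thesis using S by (simp add: free_def)
  next
    case False
    have t: "t < length ?r" "Suc t \<noteq> length ?r" using that a by linarith+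
    have "detached R i j (?r ! t)"
    proof (rule K4_inner_detached[OF R ij])
      show "?r ! t \<in> set ?r" using t by simp
      show "?r ! t \<noteq> hd ?r" using nth_eq_hd[OF dist t(1)] False by simp
      show "?r ! t \<noteq> last ?r" using nth_eq_last[OF dist t(1)] t(2) by simp
    qed
    then have "\<not> adj G (?r ! t) (hd (R k l))" if "k < 4" "l < 4" "k \<noteq> l" "{k, l} \<noteq> {i, j}" for k l
      using detachedD that K4_hd[OF R that(1-3)] by blast
    then show ?thesis unfolding free_iff by blast
  qed
  have up: "d (?r ! t) \<noteq> 0 \<and> d (?r ! t) \<le> Suc t" if "t \<le> a" for t
    using that
  proof (induction t)
    case 0
    then show ?case using D(1) S by simp
  next
    case (Suc t)
    then have IH: "d (?r ! t) \<noteq> 0" "d (?r ! t) \<le> Suc t" by auto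
    have t: "t < length ?r" "Suc t < length ?r" using Suc.prems a by linarith+
    have "adj G (?r ! t) (?r ! Suc t)" using ipath_walk[OF ip] t(2) by (simp add: walk_nth)
    then have "d (?r ! Suc t) \<noteq> 0 \<and> d (?r ! Suc t) \<le> Suc (d (?r ! t))"
      using D(4)[OF in_n[OF t(1)] in_n[OF t(2)] IH(1) fr] Suc.prems IH(2) t len by simp
    then show ?case using IH(2) by simp
  qed
  have dm: "d m \<noteq> 0" "d m \<le> Suc a" "m < n" using up[of a] in_n[OF a(1)] m by auto
  \<comment> \<open>The chain of predecessors from the middle: labels drop by one at each step until
    label 1 is reached, which only the source has.\<close>
  define y where "y k = (p ^^ k) m" for k
  have y: "y k < n \<and> d (y k) = d m - k" if "k < d m" for k
    using that
  proof (induction k)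
    case 0
    then show ?case using dm by (simp add: y_def)
  next
    case (Suc k)
    then have IH: "y k < n" "d (y k) = d m - k" by auto
    then have "d (y k) \<ge> 2" using Suc.prems by simp
    then have "d (y k) = Suc (d (p (y k)))" using D(3)[OF IH(1)] by auto
    moreover have "p (y k) < n" using D(2)[OF IH(1)] by blast
    ultimately show ?case using IH by (simp add: y_def)
  qed
  have step: "adj G (y (Suc k)) (y k) \<and> free G c i j (y (Suc k))" if "Suc k < d m" for k
  proof -
    have k: "y k < n" "d (y k) = d m - k" using y[of k] that by auto
    then have "d (y k) \<ge> 2" using that by simp
    then show ?thesis using D(3)[OF k(1)] by (auto simp: y_def)
  qed
  have lastS: "y (d m - 1) = c i j"
  proof -
    have k: "y (d m - 1) < n" "d (y (d m - 1)) = 1" using y[of "d m - 1"] dm by auto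
    then show ?thesis using D(3)[OF k(1)] by auto
  qed
  let ?P = "half p (d m - 1) m"
  have P: "?P ! t = y (d m - 1 - t)" if "t < d m" for t
    unfolding y_def by (rule half_nth) (use that in simp)
  have lenP: "length ?P = d m" using dm by simp
  have Pne: "?P \<noteq> []" using lenP dm(1) by (metis list.size(3))
  have "walk ?P"
    unfolding walk_nth
  proof (intro conjI allI impI Pne)
    fix t assume t: "Suc t < length ?P"
    then have "Suc (d m - 1 - Suc t) = d m - 1 - t" using lenP by simp
    then show "adj G (?P ! t) (?P ! Suc t)"
      using step[of "d m - 1 - Suc t"] P[of t] P[of "Suc t"] t lenP by simp
  qed
  moreover have "hd ?P = hd ?r"
    using P[of 0] dm lastS S hd0 Pne by (simp add: hd_conv_nth)
  moreover have "last ?P = ?r ! a"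
    using P[of "d m - 1"] dm m Pne lenP by (simp add: last_conv_nth y_def)
  moreover have "\<not> adj G (?P ! t) (hd (R k l))"
    if t: "0 < t" "Suc t < length ?P" and kl: "k < 4" "l < 4" "k \<noteq> l" "{k, l} \<noteq> {i, j}" for t k l
  proof -
    define s where "s = d m - 1 - Suc t"
    have s: "Suc s = d m - 1 - t" "Suc s < d m" using t lenP by (simp_all add: s_def)
    have "?P ! t = y (Suc s)" using P[of t] t lenP s by simp
    moreover have "d (y (Suc s)) = d m - Suc s" using y[OF s(2)] by blast
    \<comment> \<open>The label exceeds 1, so the exemption of the source in \<open>free\<close>
      does not apply.\<close>
    then have "y (Suc s) \<noteq> c i j" using D(1) s t(1) by auto
    ultimately show ?thesis using step[OF s(2)] kl unfolding free_iff by auto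
  qed
  ultimately show ?thesis
    using a lenP dm(2) unfolding half_path_def by simp
qed

subsection \<open>Recording a candidate\<close>

definition sizeE :: expr where
  "sizeE = Add (Add (Add (var (arr 5 0 1)) (var (arr 5 0 2))) (Add (var (arr 5 0 3)) (var (arr 5 1 2))))
    (Add (var (arr 5 1 3)) (var (arr 5 2 3)))"

definition mark :: "nat \<Rightarrow> nat \<Rightarrow> prog" where
  "mark i j = For 4 (var (arr 5 i j)) (Write 3 (Read (arr 4 i j) (var 4)) (Const 1))"

definition save_cand :: prog where
  "save_cand = Seq (Write 2 (Const 0) sizeE)
    (Seq (For 5 (var 0) (Write 3 (var 5) (Const 0))) (seqs (map (\<lambda>x. mark (fst x) (snd x)) up_pairs)))"

definition K4_cand :: "store \<Rightarrow> nat \<Rightarrow> nat \<Rightarrow> nat list" where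
  "K4_cand s = K4_of (cand s 0 1) (cand s 0 2) (cand s 0 3) (cand s 1 2) (cand s 1 3) (cand s 2 3)"

text \<open>Array 2 holds the size of the recorded structure, which doubles as the nonzero answer
  flag.\<close>

definition best_ok :: "nat graph \<Rightarrow> nat \<Rightarrow> store \<Rightarrow> bool" where
  "best_ok G n s \<longleftrightarrow> s 2 0 = 0 \<or> (\<exists>R. sym_rel.K4_paths (adj G) R \<and> K4_size R \<noteq> 6 \<and> K4_size R = s 2 0 \<and>
    {v. v < n \<and> s 3 v \<noteq> 0} = K4_verts R)"

definition save_time :: "nat \<Rightarrow> nat" where
  "save_time n = 600 * Suc n"

lemma val_sizeE: "val sizeE s = K4_size (K4_cand s)"
  by (simp add: sizeE_def K4_size_def K4_cand_def K4_of_def cand_def)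

lemma writes_mark: "writes (mark i j) = {3, 4}"
  by (auto simp: mark_def)

lemma writes_save: "writes save_cand = {2, 3, 4, 5}"
  by (auto simp: save_cand_def writes_mark up_pairs_def)

lemma runs_mark:
  assumes L: "s (arr 5 i j) 0 \<le> 2 * n + 3" and W: "12 * n + 30 \<le> W"
  shows "runs W (mark i j) s (17 * (2 * n + 4)) (\<lambda>s'. \<forall>v. s' 3 v \<noteq> 0 \<longleftrightarrow> s 3 v \<noteq> 0 \<or> v \<in> set (cand s i j))"
proof -
  let ?L = "s (arr 5 i j) 0" and ?r = "s (arr 4 i j)"
  let ?b = "Write 3 (Read (arr 4 i j) (var 4)) (Const 1)"
  have "runs W (mark i j) s ((5 + cost (var (arr 5 i j)) + 10) * Suc ?L)
    (\<lambda>s'. \<forall>v. s' 3 v \<noteq> 0 \<longleftrightarrow> s 3 v \<noteq> 0 \<or> v \<in> set (cand s i j))"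
    unfolding mark_def
  proof (rule runs_For[where I = "\<lambda>k s'. \<forall>v. s' 3 v \<noteq> 0 \<longleftrightarrow> s 3 v \<noteq> 0 \<or> v \<in> ?r ` {..<k}"])
    show "runs W ?b s' 5 (\<lambda>t. \<forall>v. upd t 4 0 (Suc k) 3 v \<noteq> 0 \<longleftrightarrow> s 3 v \<noteq> 0 \<or> v \<in> ?r ` {..<Suc k})"
      if k: "k < ?L" "s' 4 0 = k" "\<And>a. a \<noteq> 4 \<Longrightarrow> a \<notin> writes ?b \<Longrightarrow> s' a = s a"
        "\<forall>v. s' 3 v \<noteq> 0 \<longleftrightarrow> s 3 v \<noteq> 0 \<or> v \<in> ?r ` {..<k}" for k s'
    proof (rule runs_Write)
      have "s' (arr 4 i j) = ?r" using k(3) by simp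
      then show "\<forall>v. upd (upd s' 3 (val (Read (arr 4 i j) (var 4)) s') (val (Const 1) s')) 4 0 (Suc k) 3 v \<noteq> 0 \<longleftrightarrow>
          s 3 v \<noteq> 0 \<or> v \<in> ?r ` {..<Suc k}"
        using k(2,4) by (auto simp: lessThan_Suc)
    qed (use W in simp_all)
    show "val (var (arr 5 i j)) s' = ?L" if "\<And>a. a \<noteq> 4 \<Longrightarrow> a \<notin> writes ?b \<Longrightarrow> s' a = s a" for s'
      using that by simp
    show "\<forall>v. s' 3 v \<noteq> 0 \<longleftrightarrow> s 3 v \<noteq> 0 \<or> v \<in> set (cand s i j)"
      if "\<forall>v. s' 3 v \<noteq> 0 \<longleftrightarrow> s 3 v \<noteq> 0 \<or> v \<in> ?r ` {..<?L}" for s'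
      using that by (simp add: cand_def atLeast0LessThan)
  qed (use L W in auto)
  moreover have "(5 + cost (var (arr 5 i j)) + 10) * Suc ?L \<le> 17 * (2 * n + 4)"
    using L by simp
  ultimately show ?thesis by (rule runs_mono)
qed

lemma runs_save:
  assumes s: "has_input n G s" and G: "simple_graph G" and L: "\<And>i j. i < j \<Longrightarrow> j < 4 \<Longrightarrow> s (arr 5 i j) 0 \<le> 2 * n + 3"
    and K: "sym_rel.K4_paths (adj G) (K4_cand s)" "K4_size (K4_cand s) \<noteq> 6" "K4_verts (K4_cand s) \<subseteq> {..<n}"
    and W: "12 * n + 30 \<le> W"
  shows "runs W save_cand s (save_time n) (\<lambda>s'. s' 2 0 = K4_size (K4_cand s) \<and> best_ok G n s')"
proof -
  interpret sym_rel "adj G" by (rule sym_rel_adj[OF G])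
  let ?z = "K4_size (K4_cand s)"
  let ?fr = "\<lambda>s'. (\<forall>a. a \<notin> {2, 3, 4, 5} \<longrightarrow> s' a = s a) \<and> s' 2 0 = ?z"
  let ?m = "\<lambda>x. mark (fst x) (snd x)"
  let ?V = "\<lambda>xs. \<Union>x \<in> set xs. set (cand s (fst x) (snd x))"
  have V: "?V up_pairs = K4_verts (K4_cand s)"
    unfolding K4_verts_eq[OF K(1)] by (auto simp: up_pairs_def K4_cand_def K4_of_def)
  have marks: "runs W (seqs (map ?m up_pairs)) s1 (sum_list (map (\<lambda>x. 17 * (2 * n + 4)) up_pairs) + 1)
      (\<lambda>s'. s' 2 0 = ?z \<and> best_ok G n s')"
    if fr: "?fr s1" and z: "\<forall>v<n. s1 3 v = 0" for s1
  proof -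
    let ?I = "\<lambda>xs s'. ?fr s' \<and> (\<forall>v<n. s' 3 v \<noteq> 0 \<longleftrightarrow> v \<in> ?V xs)"
    have "runs W (seqs (map ?m up_pairs)) s1 (sum_list (map (\<lambda>x. 17 * (2 * n + 4)) up_pairs) + 1) (?I up_pairs)"
    proof (rule runs_seqs[where I = ?I])
      fix xs x ys s' assume x: "up_pairs = xs @ x # ys" and I: "?I xs s'"
      obtain i j where ij: "x = (i, j)" by force
      have "(i, j) \<in> set up_pairs" unfolding x ij by simp
      then have b: "i < j" "j < 4" unfolding set_up_pairs by auto
      have same: "s' (arr 5 i j) = s (arr 5 i j)" "s' (arr 4 i j) = s (arr 4 i j)" using I by simp_all
      then have "cand s' i j = cand s i j" by (simp add: cand_def)
      moreover have "runs W (mark i j) s' (17 * (2 * n + 4)) (\<lambda>s''. \<forall>v. s'' 3 v \<noteq> 0 \<longleftrightarrow> s' 3 v \<noteq> 0 \<or> v \<in> set (cand s' i j))"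
        by (rule runs_mark) (use same L[OF b] W in simp_all)
      ultimately show "runs W (?m x) s' (17 * (2 * n + 4)) (?I (xs @ [x]))"
        unfolding ij fst_conv snd_conv
        by (elim runs_frame) (use I in \<open>auto simp: writes_mark\<close>)
    qed (use fr z in auto)
    then show ?thesis
    proof (rule runs_mono)
      fix s' assume "?I up_pairs s'"
      then have "s' 2 0 = ?z" "{v. v < n \<and> s' 3 v \<noteq> 0} = K4_verts (K4_cand s)"
        using V K(3) by auto
      then show "s' 2 0 = ?z \<and> best_ok G n s'" unfolding best_ok_def using K by metis
    qed simp
  qed
  let ?tm = "sum_list (map (\<lambda>x. 17 * (2 * n + 4)) up_pairs) + 1"
  let ?c = "Write 3 (var 5) (Const 0)"
  have clear: "runs W (For 5 (var 0) ?c) s1 ((4 + cost (var 0) + 10) * Suc n)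
      (\<lambda>s'. runs W (seqs (map ?m up_pairs)) s' ?tm (\<lambda>s'. s' 2 0 = ?z \<and> best_ok G n s'))"
    if fr: "?fr s1" for s1
  proof (rule runs_For[where I = "\<lambda>k s'. \<forall>v<k. s' 3 v = 0"])
    show "runs W ?c s' 4 (\<lambda>t. \<forall>v<Suc k. upd t 5 0 (Suc k) 3 v = 0)"
      if "s' 5 0 = k" "\<forall>v<k. s' 3 v = 0" for k s'
      by (rule runs_Write) (use that in \<open>auto simp: less_Suc_eq\<close>)
    show "val (var 0) s' = n" if "\<And>a. a \<noteq> 5 \<Longrightarrow> a \<notin> writes ?c \<Longrightarrow> s' a = s1 a" for s'
      using that[of 0] fr s by (simp add: has_input_def)
    show "runs W (seqs (map ?m up_pairs)) s' ?tm (\<lambda>s'. s' 2 0 = ?z \<and> best_ok G n s')"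
      if "\<And>a. a \<noteq> 5 \<Longrightarrow> a \<notin> writes ?c \<Longrightarrow> s' a = s1 a" "\<forall>v<n. s' 3 v = 0" for s'
      by (rule marks) (use that fr in auto)
  qed (use W in auto)
  \<comment> \<open>The origin of the word bound \<open>12 * n + 30\<close>: six paths of at most
    \<open>2 * n + 3\<close> vertices have at most \<open>12 * n + 18\<close> in all.\<close>
  have "?z \<le> W"
    using L[of 0 1] L[of 0 2] L[of 0 3] L[of 1 2] L[of 1 3] L[of 2 3] W
    by (simp add: K4_size_def K4_cand_def K4_of_def cand_def)
  then have "runs W save_cand s (2 + cost sizeE + ((4 + cost (var 0) + 10) * Suc n + ?tm)) (\<lambda>s'. s' 2 0 = ?z \<and> best_ok G n s')"
    unfolding save_cand_def
    by (intro runs_Seq runs_Write) (use clear[of "upd s 2 0 ?z"] in \<open>auto simp: val_sizeE\<close>)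
  moreover have "2 + cost sizeE + ((4 + cost (var 0) + 10) * Suc n + ?tm) \<le> save_time n"
    by (simp add: save_time_def sizeE_def up_pairs_def)
  ultimately show ?thesis by (rule runs_mono)
qed

subsection \<open>The complete search\<close>

text \<open>Every structure has size at least 6, so \<open>Sub sizeE (Const 6)\<close> tests for the
  excluded size. The last factor is nonzero if nothing is recorded yet or the candidate is strictly
  smaller.\<close>

definition improveE :: expr where
  "improveE = prodE [var 8, Sub sizeE (Const 6), Add (eqE (var 2) (Const 0)) (Sub (var 2) sizeE)]"

definition try_mids :: prog where
  "try_mids = Seq (seqs (map (\<lambda>x. build (fst x) (snd x)) up_pairs))
    (Seq (Write 8 (Const 0) (Const 1))
    (Seq (seqs (map (\<lambda>x. check (fst (fst x)) (snd (fst x)) (fst (snd x)) (snd (snd x))) (List.product up_pairs up_pairs)))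
      (If improveE save_cand Skip)))"

definition try_time :: "nat \<Rightarrow> nat" where
  "try_time n = (sum_list (map (\<lambda>x. build_time n) up_pairs) + 1) + (3 +
    ((sum_list (map (\<lambda>x. check_time (fst (fst x)) (snd (fst x)) (fst (snd x)) (snd (snd x)) n) (List.product up_pairs up_pairs)) + 1) +
      (1 + cost improveE + save_time n)))"

lemma writes_try_mids: "a \<in> writes try_mids \<Longrightarrow> a \<in> {2, 3, 4, 5, 7, 8} \<or> (\<exists>i j. a = arr 4 i j \<or> a = arr 5 i j)"
  unfolding try_mids_def writes.simps writes_seqs writes_save by (auto simp: writes_build writes_check split: if_splits)

lemma val_improveE:
  "val improveE s \<noteq> 0 \<longleftrightarrow> s 8 0 \<noteq> 0 \<and> 6 < K4_size (K4_cand s) \<and> (s 2 0 = 0 \<or> K4_size (K4_cand s) < s 2 0)"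
  unfolding improveE_def val_prodE by (auto simp: val_sizeE)

text \<open>The last clause is the completeness of one trial. It holds whether or not the candidate
  is saved, since a true structure is declined only in favour of one that is at most as
  large.\<close>

lemma runs_try_mids:
  assumes s: "has_input n G s" and G: "simple_graph G" and W: "12 * n + 30 \<le> W"
    and d: "\<And>i j x. i < 4 \<Longrightarrow> j < 4 \<Longrightarrow> i \<noteq> j \<Longrightarrow> x < n \<Longrightarrow> s (arr 2 i j) x \<le> n + 2 \<and> s (arr 3 i j) x < n"
    and m: "\<And>i j. i < j \<Longrightarrow> j < 4 \<Longrightarrow> s (arr 1 i j) 0 = m i j \<and> m i j < n"
    and best: "best_ok G n s"
    and B: "\<And>i j. i < j \<Longrightarrow> j < 4 \<Longrightarrow> B i j = half (s (arr 3 i j)) (s (arr 2 i j) (m i j) - 1) (m i j) @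
      tl (rev (half (s (arr 3 j i)) (s (arr 2 j i) (m i j) - 1) (m i j)))"
  shows "runs W try_mids s (try_time n) (\<lambda>s'. best_ok G n s' \<and> (s 2 0 \<noteq> 0 \<longrightarrow> s' 2 0 \<noteq> 0 \<and> s' 2 0 \<le> s 2 0) \<and>
    (\<forall>R. sym_rel.K4_paths (adj G) R \<longrightarrow> K4_size R \<noteq> 6 \<longrightarrow> K4_verts R \<subseteq> {..<n} \<longrightarrow>
      (\<forall>i j. i < j \<longrightarrow> j < 4 \<longrightarrow> R i j = B i j) \<longrightarrow> s' 2 0 \<noteq> 0 \<and> s' 2 0 \<le> K4_size R))"
    (is "runs W try_mids s _ ?Post")
proof -
  interpret sym_rel "adj G" by (rule sym_rel_adj[OF G])
  let ?fr1 = "\<lambda>s'. \<forall>a. a \<notin> {4, 7} \<longrightarrow> (\<forall>i j. a \<noteq> arr 4 i j \<and> a \<noteq> arr 5 i j) \<longrightarrow> s' a = s a"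
  have lenB: "length (B i j) \<le> 2 * n + 3" "B i j \<noteq> []" if "i < j" "j < 4" for i j
  proof -
    have "s (arr 2 i j) (m i j) \<le> n + 2" "s (arr 2 j i) (m i j) \<le> n + 2"
      using d[of i j "m i j"] d[of j i "m i j"] m[OF that] that by auto
    then show "length (B i j) \<le> 2 * n + 3" unfolding B[OF that] by simp
    show "B i j \<noteq> []" unfolding B[OF that] half_def by simp
  qed
  let ?cB = "\<lambda>s'. \<forall>i j. i < j \<longrightarrow> j < 4 \<longrightarrow> cand s' i j = B i j"
  let ?size = "length (B 0 1) + length (B 0 2) + length (B 0 3) + length (B 1 2) + length (B 1 3) + length (B 2 3)"
  let ?K = "K4_of (B 0 1) (B 0 2) (B 0 3) (B 1 2) (B 1 3) (B 2 3)"
  have final: "runs W (If improveE save_cand Skip) s3 (1 + cost improveE + save_time n) ?Post"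
    if fr: "\<And>a. a \<notin> {4, 5, 7, 8} \<Longrightarrow> (\<And>i j. a \<noteq> arr 4 i j \<and> a \<noteq> arr 5 i j) \<Longrightarrow> s3 a = s a"
      and cB: "?cB s3" and ok: "s3 8 0 \<noteq> 0 \<longleftrightarrow> all_ok G n B" for s3
  proof -
    have e: "s3 0 = s 0" "s3 1 = s 1" "s3 2 = s 2" "s3 3 = s 3" by (rule fr; simp)+
    have s3: "has_input n G s3" using s e by (simp add: has_input_def)
    have K: "K4_cand s3 = ?K" using cB by (simp add: K4_cand_def)
    have len3: "s3 (arr 5 i j) 0 \<le> 2 * n + 3" if "i < j" "j < 4" for i j
    proof -
      have "s3 (arr 5 i j) 0 = length (cand s3 i j)" by (simp add: cand_def)
      then show ?thesis using lenB(1)[OF that] cB that by simp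
    qed
    have best3: "best_ok G n s3" using best unfolding best_ok_def e .
    show ?thesis
    proof (rule runs_If)
      assume v: "val improveE s3 \<noteq> 0"
      then have all: "all_ok G n B" and size: "K4_size ?K \<noteq> 6" "s 2 0 = 0 \<or> K4_size ?K < s 2 0"
        unfolding val_improveE using ok K e by auto
      have KP: "K4_paths ?K" by (rule all_ok_K4_of[OF G all lenB(2)])
      have "K4_verts ?K \<subseteq> {..<n}"
      proof -
        have "set (B i j) \<subseteq> {..<n}" if "i < j" "j < 4" for i j
          using all_okD[OF all that that] pair_ok_same[OF G lenB(2)[OF that]] by blast
        then show ?thesis unfolding K4_verts_eq[OF KP] by (simp add: K4_of_def)
      qed
      then have "runs W save_cand s3 (save_time n) (\<lambda>s'. s' 2 0 = K4_size ?K \<and> best_ok G n s')"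
        using runs_save[OF s3 G len3 _ _ _ W] KP size(1) unfolding K by blast
      then show "runs W save_cand s3 (save_time n) ?Post"
      proof (rule runs_mono)
        fix s' assume s': "s' 2 0 = K4_size ?K \<and> best_ok G n s'"
        have "K4_size R = K4_size ?K" if "\<forall>i j. i < j \<longrightarrow> j < 4 \<longrightarrow> R i j = B i j" for R
          using that by (simp add: K4_size_def K4_of_def)
        moreover have "K4_size ?K \<noteq> 0" using K4_size_ge[OF KP] by simp
        ultimately show "?Post s'" using s' size(2) by auto
      qed simp
    next
      assume v: "val improveE s3 = 0"
      have post: "?Post s3"
      proof (intro conjI allI impI)
        show "best_ok G n s3" by (rule best3)
        show "s3 2 0 \<noteq> 0" "s3 2 0 \<le> s 2 0" if "s 2 0 \<noteq> 0" using that e by simp_all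
        fix R assume R: "K4_paths R" "K4_size R \<noteq> 6" "K4_verts R \<subseteq> {..<n}" "\<forall>i j. i < j \<longrightarrow> j < 4 \<longrightarrow> R i j = B i j"
        have "all_ok G n B" by (rule K4_paths_all_ok[OF G R(1,3)]) (use R(4) in simp)
        moreover have "K4_size ?K = K4_size R" using R(4) by (simp add: K4_size_def K4_of_def)
        moreover have "6 < K4_size R" using K4_size_ge[OF R(1)] R(2) by simp
        ultimately show "s3 2 0 \<noteq> 0" "s3 2 0 \<le> K4_size R"
          using v val_improveE[of s3] ok unfolding K by auto
      qed
      show "runs W Skip s3 (save_time n) ?Post"
      proof (rule runs_Skip)
        show "?Post s3" by (fact post)
      qed (simp add: save_time_def)
    qed
  qed
  let ?chk = "\<lambda>x. check (fst (fst x)) (snd (fst x)) (fst (snd x)) (snd (snd x))"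
  let ?ct = "\<lambda>x. check_time (fst (fst x)) (snd (fst x)) (fst (snd x)) (snd (snd x)) n"
  let ?ps = "List.product up_pairs up_pairs"
  let ?rest = "Seq (seqs (map ?chk ?ps)) (If improveE save_cand Skip)"
  let ?trest = "(sum_list (map ?ct ?ps) + 1) + (1 + cost improveE + save_time n)"
  have checks: "runs W ?rest s2 ?trest ?Post"
    if fr: "\<And>a. a \<notin> {4, 7, 8} \<Longrightarrow> (\<And>i j. a \<noteq> arr 4 i j \<and> a \<noteq> arr 5 i j) \<Longrightarrow> s2 a = s a" and cB: "?cB s2" and one: "s2 8 0 = 1" for s2
  proof (rule runs_Seq)
    let ?ok = "\<lambda>x. pair_ok G n (fst (fst x)) (snd (fst x)) (fst (snd x)) (snd (snd x))
      (B (fst (fst x)) (snd (fst x))) (B (fst (snd x)) (snd (snd x)))"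
    let ?I = "\<lambda>xs s'. (\<forall>a. a \<notin> {4, 5, 8} \<longrightarrow> s' a = s2 a) \<and> (s' 8 0 \<noteq> 0 \<longleftrightarrow> (\<forall>x\<in>set xs. ?ok x))"
    have "runs W (seqs (map ?chk ?ps)) s2 (sum_list (map ?ct ?ps) + 1) (?I ?ps)"
    proof (rule runs_seqs[where I = ?I])
      fix xs x ys s' assume x: "?ps = xs @ x # ys" and I: "?I xs s'"
      obtain i j k l where ij: "x = ((i, j), (k, l))" by (metis prod.collapse)
      have "x \<in> set ?ps" unfolding x by simp
      then have "(i, j) \<in> set up_pairs" "(k, l) \<in> set up_pairs" unfolding ij by auto
      then have b: "i < j" "j < 4" "k < l" "l < 4" unfolding set_up_pairs by auto
      have e: "s' (arr t i j) = s2 (arr t i j)" for t i j using I by simp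
      have c: "cand s' i j = B i j" "cand s' k l = B k l"
        using cB b e unfolding cand_def by simp_all
      have L: "s' (arr 5 i j) 0 \<le> 2 * n + 3" "s' (arr 5 k l) 0 \<le> 2 * n + 3"
      proof -
        have "s' (arr 5 i j) 0 = length (cand s' i j)" "s' (arr 5 k l) 0 = length (cand s' k l)" by (simp_all add: cand_def)
        then show "s' (arr 5 i j) 0 \<le> 2 * n + 3" "s' (arr 5 k l) 0 \<le> 2 * n + 3"
          unfolding c using lenB(1) b by simp_all
      qed
      have in2: "has_input n G s2" using s fr[of 0] fr[of 1] by (simp add: has_input_def)
      have "s' 0 = s2 0" "s' 1 = s2 1" using I by simp_all
      then have "has_input n G s'" using in2 by (simp add: has_input_def)
      from runs_check[OF this L W]
      have "runs W (check i j k l) s' (check_time i j k l n) (\<lambda>s''. s'' 8 0 \<noteq> 0 \<longleftrightarrow> s' 8 0 \<noteq> 0 \<and> pair_ok G n i j k l (B i j) (B k l))"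
        unfolding c .
      then show "runs W (?chk x) s' (?ct x) (?I (xs @ [x]))"
        unfolding ij fst_conv snd_conv
        by (rule runs_frame) (use I in \<open>auto simp: writes_check\<close>)
    qed (use one in simp)
    then show "runs W (seqs (map ?chk ?ps)) s2 (sum_list (map ?ct ?ps) + 1)
        (\<lambda>s'. runs W (If improveE save_cand Skip) s' (1 + cost improveE + save_time n) ?Post)"
    proof (rule runs_mono)
      fix s' assume I: "?I ?ps s'"
      have e: "s' (arr t i j) = s2 (arr t i j)" for t i j using I by simp
      show "runs W (If improveE save_cand Skip) s' (1 + cost improveE + save_time n) ?Post"
      proof (rule final)
        show "s' a = s a" if "a \<notin> {4, 5, 7, 8}" "\<And>i j. a \<noteq> arr 4 i j \<and> a \<noteq> arr 5 i j" for a
          using I fr[of a] that by simp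
        show "?cB s'" using cB e unfolding cand_def by simp
        show "s' 8 0 \<noteq> 0 \<longleftrightarrow> all_ok G n B"
          using I unfolding all_ok_def by (simp add: split_beta)
      qed
    qed simp
  qed
  have start: "runs W (Seq (Write 8 (Const 0) (Const 1)) ?rest) s1 (3 + ?trest) ?Post"
    if fr: "?fr1 s1" and cB: "?cB s1" for s1
  proof (rule runs_Seq, rule runs_Write)
    let ?s = "upd s1 8 (val (Const 0) s1) (val (Const 1) s1)"
    show "runs W ?rest ?s ?trest ?Post"
      by (rule checks) (use fr cB in \<open>simp_all add: cand_def\<close>)
  qed (use W in simp_all)
  let ?bld = "\<lambda>x. build (fst x) (snd x)"
  let ?I = "\<lambda>xs s'. ?fr1 s' \<and> (\<forall>x \<in> set xs. cand s' (fst x) (snd x) = B (fst x) (snd x))"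
  have "runs W (seqs (map ?bld up_pairs)) s (sum_list (map (\<lambda>x. build_time n) up_pairs) + 1) (?I up_pairs)"
  proof (rule runs_seqs[where I = ?I])
    fix xs x ys s' assume x: "up_pairs = xs @ x # ys" and I: "?I xs s'"
    obtain i j where ij: "x = (i, j)" by force
    have "(i, j) \<in> set up_pairs" unfolding x ij by simp
    then have b: "i < j" "j < 4" unfolding set_up_pairs by auto
    have e: "s' (arr t k l) = s (arr t k l)" if "t < 4" for t k l
      using I that by (simp add: arr_eq)
    have dd: "s (arr 2 i j) (m i j) \<le> n + 2" "s (arr 2 j i) (m i j) \<le> n + 2"
      using d[of i j "m i j"] d[of j i "m i j"] m[OF b] b by auto
    have "runs W (build i j) s' (build_time n) (\<lambda>s''. cand s'' i j = half (s' (arr 3 i j)) (s' (arr 2 i j) (m i j) - 1) (m i j) @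
        tl (rev (half (s' (arr 3 j i)) (s' (arr 2 j i) (m i j) - 1) (m i j))))"
      by (rule runs_build) (use b m[OF b] dd d[of i j] d[of j i] W in \<open>simp_all add: e\<close>)
    then have "runs W (build i j) s' (build_time n) (\<lambda>s''. cand s'' i j = B i j)"
      unfolding B[OF b] by (simp add: e)
    then show "runs W (?bld x) s' (build_time n) (?I (xs @ [x]))"
      unfolding ij fst_conv snd_conv
    proof (rule runs_frame)
      fix s'' assume f: "\<And>a. a \<notin> writes (build i j) \<Longrightarrow> s'' a = s' a" and c: "cand s'' i j = B i j"
      have kl: "cand s'' k l = cand s' k l" if "(k, l) \<noteq> (i, j)" for k l
        using f[of "arr 4 k l"] f[of "arr 5 k l"] that by (auto simp: writes_build arr_eq cand_def)
      then have "cand s'' (fst y) (snd y) = B (fst y) (snd y)" if "y \<in> set (xs @ [(i, j)])" for y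
      proof (cases "y = (i, j)")
        case True
        then show ?thesis using c by simp
      next
        case False
        then have "y \<in> set xs" "(fst y, snd y) \<noteq> (i, j)" using that by auto
        then show ?thesis using kl I by metis
      qed
      moreover have "?fr1 s''" using f I by (simp add: writes_build)
      ultimately show "?I (xs @ [(i, j)]) s''" by blast
    qed
  qed simp
  then have "runs W (seqs (map ?bld up_pairs)) s (sum_list (map (\<lambda>x. build_time n) up_pairs) + 1)
      (\<lambda>s'. runs W (Seq (Write 8 (Const 0) (Const 1)) ?rest) s' (3 + ?trest) ?Post)"
  proof (rule runs_mono)
    fix s' assume I: "?I up_pairs s'"
    have "?cB s'"
    proof (intro allI impI)
      fix i j :: nat assume "i < j" "j < 4"
      then have "(i, j) \<in> set up_pairs" by (simp add: set_up_pairs)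
      then show "cand s' i j = B i j" using I by force
    qed
    then show "runs W (Seq (Write 8 (Const 0) (Const 1)) ?rest) s' (3 + ?trest) ?Post"
      using I start by blast
  qed simp
  from runs_Seq[OF this] show ?thesis unfolding try_mids_def try_time_def .
qed

section \<open>The loops over all guesses\<close>

definition corners :: "nat list" where
  "corners = map (\<lambda>x. arr 0 (fst x) (snd x)) pairs"

definition mids :: "nat list" where
  "mids = map (\<lambda>x. arr 1 (fst x) (snd x)) up_pairs"

definition try_corners :: prog where
  "try_corners = Seq (seqs (map (\<lambda>x. bfs (fst x) (snd x)) pairs)) (nest mids try_mids)"

definition search :: prog where
  "search = nest corners try_corners"

text \<open>3010 covers six times \<open>build_time\<close> (2400), \<open>save_time\<close> (600)
  and the remaining single steps; 16 is the square of the 4 in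
  \<open>2 * n + 4 \<le> 4 * Suc n\<close>.\<close>

definition try_const :: nat where
  "try_const = 3010 + cost improveE +
    16 * sum_list (map (\<lambda>x. cost (okE (fst (fst x)) (snd (fst x)) (fst (snd x)) (snd (snd x))) + 40) (List.product up_pairs up_pairs))"

definition bfs_const :: nat where
  "bfs_const = sum_list (map (\<lambda>x. cost (scanE (fst x) (snd x)) + 80) pairs)"

lemma try_time_le: "try_time n \<le> try_const * Suc n ^ 2"
proof -
  let ?ps = "List.product up_pairs up_pairs"
  let ?f = "\<lambda>x. cost (okE (fst (fst x)) (snd (fst x)) (fst (snd x)) (snd (snd x))) + 40"
  have q: "(2 * n + 4) ^ 2 \<le> 16 * Suc n ^ 2"
  proof -
    have "(2 * n + 4) ^ 2 \<le> (4 * Suc n) ^ 2" by (intro power_mono) simp_all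
    also have "\<dots> = 16 * Suc n ^ 2" unfolding power_mult_distrib by simp
    finally show ?thesis .
  qed
  have "sum_list (map (\<lambda>x. check_time (fst (fst x)) (snd (fst x)) (fst (snd x)) (snd (snd x)) n) ?ps)
      = sum_list (map ?f ?ps) * (2 * n + 4) ^ 2"
    unfolding check_time_def sum_list_mult_const ..
  also have "\<dots> \<le> sum_list (map ?f ?ps) * (16 * Suc n ^ 2)" using q by (rule mult_le_mono2)
  finally have c: "sum_list (map (\<lambda>x. check_time (fst (fst x)) (snd (fst x)) (fst (snd x)) (snd (snd x)) n) ?ps)
      \<le> 16 * sum_list (map ?f ?ps) * Suc n ^ 2" by (simp add: mult_ac)
  have b: "sum_list (map (\<lambda>x. build_time n) up_pairs) = 2400 * Suc n" by (simp add: up_pairs_def build_time_def)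
  have le: "2400 * N + 1 + (3 + (X + 1 + (1 + C + 600 * N))) \<le> 3010 * M + C * M + X"
    if "N \<le> M" "1 \<le> M" "C \<le> C * M" for X N M C :: nat
    using that by linarith
  have "Suc n \<le> Suc n ^ 2" "1 \<le> Suc n ^ 2" "cost improveE \<le> cost improveE * Suc n ^ 2"
    by (simp_all add: power2_eq_square)
  from le[OF this] have "try_time n \<le> 3010 * Suc n ^ 2 + cost improveE * Suc n ^ 2 +
      sum_list (map (\<lambda>x. check_time (fst (fst x)) (snd (fst x)) (fst (snd x)) (snd (snd x)) n) ?ps)"
    unfolding try_time_def b save_time_def .
  then show ?thesis
    unfolding try_const_def add_mult_distrib using c by linarith
qed

lemma bfs_times: "sum_list (map (\<lambda>x. bfs_time x n) pairs) = bfs_const * Suc n ^ 3"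
  unfolding bfs_time_def bfs_const_def sum_list_mult_const ..

text \<open>\<open>K4_paths\<close> speaks of adjacency only. But each vertex of a structure has a
  neighbour, on its path or, if the path is a single vertex, in a triangle, and the ends of edges
  are vertices of \<open>G\<close>.\<close>

lemma K4_verts_subset:
  assumes G: "simple_graph G" and R: "sym_rel.K4_paths (adj G) R"
  shows "K4_verts R \<subseteq> verts G"
proof
  interpret sym_rel "adj G" by (rule sym_rel_adj[OF G])
  fix v assume "v \<in> K4_verts R"
  then obtain i j t where ij: "i < 4" "j < 4" "i \<noteq> j" and t: "t < length (R i j)" "R i j ! t = v"
    unfolding in_K4_verts by blast
  have ip: "ipath (R i j)" by (rule K4_ipath[OF R ij])
  have "\<exists>u. adj G v u"
  proof -
    consider "Suc t < length (R i j)" | "0 < t" | "t = 0" "length (R i j) = 1" using t by linarith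
    then show ?thesis
    proof cases
      case 1
      then show ?thesis using ipath_walk[OF ip] t by (auto simp: walk_nth)
    next
      case 2
      then have "Suc (t - 1) < length (R i j)" "Suc (t - 1) = t" using t by simp_all
      then show ?thesis using ipath_walk[OF ip] t E_commute unfolding walk_nth by metis
    next
      case 3
      obtain k l where k: "k < 4" "l < 4" "distinct [i, j, k, l]" using other_indices[OF ij] .
      then have d: "i \<noteq> k" "j \<noteq> k" by auto
      have "v = hd (R i j)" using 3 t nth_eq_hd[OF ipath_distinct[OF ip] t(1)] by simp
      then have "adj G v (hd (R i k))"
        using conD[OF K4_con[OF R ij(1,2) k(1) ij(3) d] K4_hd[OF R ij] K4_hd[OF R ij(1) k(1) d(1)]] by simp
      then show ?thesis ..
    qed
  qed
  then show "v \<in> verts G" using G unfolding simple_graph_def adj_def by auto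
qed

text \<open>\<open>\<tau>\<close> lists the ends and middle vertices of a smallest structure, of size \<open>z\<close>.\<close>

definition good :: "nat graph \<Rightarrow> nat list \<Rightarrow> nat \<Rightarrow> bool" where
  "good G \<tau> z \<longleftrightarrow> (\<exists>R a. sym_rel.least_K4 (adj G) R \<and> K4_size R = z \<and>
    (\<forall>i<4. \<forall>j<4. i \<noteq> j \<longrightarrow> Suc (a i j + a j i) = length (R i j) \<and> 2 * a i j \<le> length (R i j)) \<and>
    \<tau> = map (\<lambda>x. hd (R (fst x) (snd x))) pairs @ map (\<lambda>x. R (fst x) (snd x) ! a (fst x) (snd x)) up_pairs)"

text \<open>Stated in terms of the recorded size alone, so that it survives all later trials: once
  nonzero, that size never vanishes or grows.\<close>

definition achieved :: "nat graph \<Rightarrow> nat list \<Rightarrow> store \<Rightarrow> bool" where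
  "achieved G \<tau> s \<longleftrightarrow> (\<forall>z. good G \<tau> z \<longrightarrow> s 2 0 \<noteq> 0 \<and> s 2 0 \<le> z)"

text \<open>The invariant of the loops over the middle vertices: the results of the twelve searches
  stay in place, as \<open>try_mids\<close> writes none of their arrays.\<close>

definition corners_set :: "nat graph \<Rightarrow> nat \<Rightarrow> (nat \<Rightarrow> nat \<Rightarrow> nat) \<Rightarrow> store \<Rightarrow> bool" where
  "corners_set G n c s \<longleftrightarrow> has_input n G s \<and> best_ok G n s \<and>
    (\<forall>i<4. \<forall>j<4. i \<noteq> j \<longrightarrow> s (arr 0 i j) 0 = c i j \<and>
      bfs_inv (adj G) (free G c i j) n (c i j) n 0 0 (s (arr 2 i j)) (s (arr 3 i j)))"

text \<open>If the guess consists of the ends and middle vertices of a smallest structure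
  \<open>R\<close>, the halves built are half paths of \<open>R\<close> by
  \<open>bfs_half_path\<close>, so the candidate is a structure of the same size by
  \<open>all_halves_replace\<close>, and something at most as large is recorded.\<close>

lemma runs_try_mids_good:
  assumes G: "simple_graph G" "\<not> contains_odd_hole G" "verts G = {..<n}" and W: "12 * n + 30 \<le> W"
    and J: "corners_set G n c s" and x: "\<And>x. x \<in> set mids \<Longrightarrow> s x 0 < n"
  shows "runs W try_mids s (try_time n) (\<lambda>s'. corners_set G n c s' \<and> (\<forall>\<tau>. achieved G \<tau> s \<longrightarrow> achieved G \<tau> s') \<and>
    achieved G (map (\<lambda>x. c (fst x) (snd x)) pairs @ map (\<lambda>x. s x 0) mids) s')"
proof -
  interpret even_holes "adj G" by (rule even_holes_adj[OF G(1,2)])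
  define m where "m i j = s (arr 1 i j) 0" for i j
  define B where "B i j = half (s (arr 3 i j)) (s (arr 2 i j) (m i j) - 1) (m i j) @
      tl (rev (half (s (arr 3 j i)) (s (arr 2 j i) (m i j) - 1) (m i j)))" for i j
  have mn: "m i j < n" if "i < j" "j < 4" for i j
  proof -
    have "(i, j) \<in> set up_pairs" using that by (simp add: set_up_pairs)
    then have "arr 1 i j \<in> set mids" unfolding mids_def by force
    then show ?thesis using x by (simp add: m_def)
  qed
  have inv: "bfs_inv (adj G) (free G c i j) n (c i j) n 0 0 (s (arr 2 i j)) (s (arr 3 i j))" if "i < 4" "j < 4" "i \<noteq> j" for i j
    using J that unfolding corners_set_def by blast
  have in_s: "has_input n G s" "best_ok G n s" using J by (simp_all add: corners_set_def)
  have "runs W try_mids s (try_time n) (\<lambda>s'. best_ok G n s' \<and> (s 2 0 \<noteq> 0 \<longrightarrow> s' 2 0 \<noteq> 0 \<and> s' 2 0 \<le> s 2 0) \<and>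
    (\<forall>R. K4_paths R \<longrightarrow> K4_size R \<noteq> 6 \<longrightarrow> K4_verts R \<subseteq> {..<n} \<longrightarrow>
      (\<forall>i j. i < j \<longrightarrow> j < 4 \<longrightarrow> R i j = B i j) \<longrightarrow> s' 2 0 \<noteq> 0 \<and> s' 2 0 \<le> K4_size R))"
  proof (rule runs_try_mids[OF in_s(1) G(1) W _ _ in_s(2)])
    show "s (arr 2 i j) x \<le> n + 2 \<and> s (arr 3 i j) x < n" if "i < 4" "j < 4" "i \<noteq> j" "x < n" for i j x
      using bfs_invD(2)[OF inv[OF that(1-3)] that(4)] .
    show "s (arr 1 i j) 0 = m i j \<and> m i j < n" if "i < j" "j < 4" for i j
      using mn[OF that] by (simp add: m_def)
  qed (simp add: B_def)
  then show ?thesis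
  proof (rule runs_frame)
    fix s' assume fr: "\<And>a. a \<notin> writes try_mids \<Longrightarrow> s' a = s a"
      and P: "best_ok G n s' \<and> (s 2 0 \<noteq> 0 \<longrightarrow> s' 2 0 \<noteq> 0 \<and> s' 2 0 \<le> s 2 0) \<and>
        (\<forall>R. K4_paths R \<longrightarrow> K4_size R \<noteq> 6 \<longrightarrow> K4_verts R \<subseteq> {..<n} \<longrightarrow>
          (\<forall>i j. i < j \<longrightarrow> j < 4 \<longrightarrow> R i j = B i j) \<longrightarrow> s' 2 0 \<noteq> 0 \<and> s' 2 0 \<le> K4_size R)"
    have keep: "s' (arr t i j) = s (arr t i j)" if "t < 4" for t i j
      by (rule fr) (use writes_try_mids[of "arr t i j"] that in \<open>auto simp: arr_eq\<close>)
    have keep01: "s' 0 = s 0" "s' 1 = s 1"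
      by (rule fr; use writes_try_mids[of 0] writes_try_mids[of 1] in auto)+
    have "corners_set G n c s'"
      using J P keep keep01 unfolding corners_set_def has_input_def by simp
    moreover have "achieved G \<tau> s'" if "achieved G \<tau> s" for \<tau>
      using that P unfolding achieved_def by (meson le_trans)
    moreover have "s' 2 0 \<noteq> 0 \<and> s' 2 0 \<le> z"
      if good: "good G (map (\<lambda>x. c (fst x) (snd x)) pairs @ map (\<lambda>x. s x 0) mids) z" for z
    proof -
      obtain R a where R: "least_K4 R" "K4_size R = z"
        and a: "\<And>i j. i < 4 \<Longrightarrow> j < 4 \<Longrightarrow> i \<noteq> j \<Longrightarrow> Suc (a i j + a j i) = length (R i j) \<and> 2 * a i j \<le> length (R i j)"
        and \<tau>: "map (\<lambda>x. c (fst x) (snd x)) pairs @ map (\<lambda>x. s x 0) mids =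
          map (\<lambda>x. hd (R (fst x) (snd x))) pairs @ map (\<lambda>x. R (fst x) (snd x) ! a (fst x) (snd x)) up_pairs"
        using good unfolding good_def by blast
      have KR: "K4_paths R" "K4_size R \<noteq> 6" using R by (simp_all add: least_K4_def)
      have \<tau>': "map (\<lambda>x. c (fst x) (snd x)) pairs = map (\<lambda>x. hd (R (fst x) (snd x))) pairs"
        "map (\<lambda>x. s x 0) mids = map (\<lambda>x. R (fst x) (snd x) ! a (fst x) (snd x)) up_pairs"
        using \<tau> by (simp_all add: append_eq_append_conv)
      have c: "c i j = hd (R i j)" if "i < 4" "j < 4" "i \<noteq> j" for i j
      proof -
        have "(i, j) \<in> set pairs" using that by (simp add: set_pairs)
        then show ?thesis using \<tau>'(1) unfolding map_eq_conv by force
      qed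
      have m: "m i j = R i j ! a i j" if "i < j" "j < 4" for i j
      proof -
        have "(i, j) \<in> set up_pairs" using that by (simp add: set_up_pairs)
        then show ?thesis using \<tau>'(2) unfolding mids_def map_map comp_def map_eq_conv m_def by force
      qed
      \<comment> \<open>The same middle vertex counted from the other end; the search from
        \<open>j\<close> needs it as a position on \<open>R j i\<close>.\<close>
      have m': "m i j = R j i ! a j i" if "i < j" "j < 4" for i j
      proof -
        have ij: "i < 4" "i \<noteq> j" using that by auto
        have "R j i ! a j i = R i j ! (length (R i j) - Suc (a j i))"
          using K4_rev[OF KR(1) ij(1) that(2) ij(2)] a[OF ij(1) that(2) ij(2)] by (simp add: rev_nth)
        also have "length (R i j) - Suc (a j i) = a i j" using a[OF ij(1) that(2) ij(2)] by linarith
        finally show ?thesis using m[OF that] by simp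
      qed
      define P' where "P' i j = half (s (arr 3 i j)) (s (arr 2 i j) (R i j ! a i j) - 1) (R i j ! a i j)" for i j
      have V: "K4_verts R \<subseteq> {..<n}" using K4_verts_subset[OF G(1) KR(1)] G(3) by simp
      have hp: "half_path R i j (a i j) (P' i j)" if ij: "i < 4" "j < 4" "i \<noteq> j" for i j
        unfolding P'_def
        by (rule bfs_half_path[OF G(1) KR(1) V ij _ _ refl c inv[OF ij]]) (use a[OF ij] in auto)
      define R' where "R' i j = P' i j @ tl (rev (P' j i))" for i j
      have R': "K4_paths R'" "K4_size R' = K4_size R"
        using all_halves_replace[OF R(1) _ hp, of R'] a by (simp_all add: R'_def)
      moreover have "K4_verts R' \<subseteq> {..<n}" using K4_verts_subset[OF G(1) R'(1)] G(3) by simp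
      moreover have "R' i j = B i j" if "i < j" "j < 4" for i j
        using m[OF that] m'[OF that] by (simp add: R'_def P'_def B_def)
      ultimately show ?thesis using P KR(2) R(2) by metis
    qed
    ultimately show "corners_set G n c s' \<and> (\<forall>\<tau>. achieved G \<tau> s \<longrightarrow> achieved G \<tau> s') \<and>
      achieved G (map (\<lambda>x. c (fst x) (snd x)) pairs @ map (\<lambda>x. s x 0) mids) s'"
      unfolding achieved_def by blast
  qed
qed

lemma mem_mids: "x \<in> set mids \<longleftrightarrow> (\<exists>i j. x = arr 1 i j \<and> i < j \<and> j < 4)"
proof -
  have "x \<in> set mids \<longleftrightarrow> (\<exists>i j. x = arr 1 i j \<and> (i, j) \<in> set up_pairs)"
    unfolding mids_def set_map image_iff by (simp only: Bex_def split_paired_Ex fst_conv snd_conv conj_commute)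
  then show ?thesis unfolding set_up_pairs .
qed

lemma mem_corners: "x \<in> set corners \<longleftrightarrow> (\<exists>i j. x = arr 0 i j \<and> i < 4 \<and> j < 4 \<and> i \<noteq> j)"
proof -
  have "x \<in> set corners \<longleftrightarrow> (\<exists>i j. x = arr 0 i j \<and> (i, j) \<in> set pairs)"
    unfolding corners_def set_map image_iff by (simp only: Bex_def split_paired_Ex fst_conv snd_conv conj_commute)
  then show ?thesis unfolding set_pairs .
qed

lemma inj_arr: "t < 8 \<Longrightarrow> inj_on (\<lambda>x. arr t (fst x) (snd x)) A"
  by (rule inj_onI) (simp add: arr_eq prod_eq_iff)

lemma distinct_mids: "distinct mids"
  unfolding mids_def distinct_map by (intro conjI inj_arr) (simp_all add: up_pairs_def)

lemma distinct_corners: "distinct corners"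
  unfolding corners_def distinct_map by (intro conjI inj_arr) (simp_all add: pairs_def)

lemma length_mids: "length mids = 6"
  by (simp add: mids_def up_pairs_def)

lemma length_corners: "length corners = 12"
  by (simp add: corners_def pairs_def)

lemma corners_set_cong:
  assumes "corners_set G n c s" "\<And>a. a < 10 \<Longrightarrow> s' a = s a" "\<And>t i j. t \<in> {0, 2, 3} \<Longrightarrow> s' (arr t i j) = s (arr t i j)"
  shows "corners_set G n c s'"
proof -
  have "s' 0 = s 0" "s' 1 = s 1" "s' 2 = s 2" "s' 3 = s 3" by (rule assms(2); simp)+
  moreover have "s' (arr 0 i j) = s (arr 0 i j)" "s' (arr 2 i j) = s (arr 2 i j)" "s' (arr 3 i j) = s (arr 3 i j)" for i j
    by (rule assms(3); simp)+
  ultimately show ?thesis using assms(1) unfolding corners_set_def has_input_def best_ok_def by simp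
qed

lemma achieved_cong: "s' 2 = s 2 \<Longrightarrow> achieved G \<tau> s' = achieved G \<tau> s"
  unfolding achieved_def by simp

text \<open>The summand 72 is the loop overhead of 12 for each of the six inner variables.\<close>

lemma runs_try_corners:
  assumes G: "simple_graph G" "\<not> contains_odd_hole G" "verts G = {..<n}" and W: "12 * n + 30 \<le> W"
    and s: "has_input n G s" "best_ok G n s" and x: "\<And>x. x \<in> set corners \<Longrightarrow> s x 0 < n"
  shows "runs W try_corners s (bfs_const * Suc n ^ 3 + 1 + (try_time n + 72) * Suc n ^ 6)
    (\<lambda>s'. (has_input n G s' \<and> best_ok G n s') \<and> (\<forall>\<tau>. achieved G \<tau> s \<longrightarrow> achieved G \<tau> s') \<and>
      (\<forall>\<sigma>. length \<sigma> = 6 \<longrightarrow> set \<sigma> \<subseteq> {..<n} \<longrightarrow> achieved G (map (\<lambda>x. s x 0) corners @ \<sigma>) s'))"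
    (is "runs W _ s _ ?Post")
proof -
  define c where "c i j = s (arr 0 i j) 0" for i j
  have cn: "c i j < n" if "i < 4" "j < 4" "i \<noteq> j" for i j
    unfolding c_def using x that unfolding mem_corners by blast
  have pre: "map (\<lambda>x. c (fst x) (snd x)) pairs = map (\<lambda>x. s x 0) corners"
    by (simp add: c_def corners_def)
  define inv where "inv i j s' \<longleftrightarrow> bfs_inv (adj G) (free G c i j) n (c i j) n 0 0 (s' (arr 2 i j)) (s' (arr 3 i j))" for i j s'
  define I where "I xs s' \<longleftrightarrow>
    (\<forall>a. a \<notin> {4, 5, 6} \<longrightarrow> (\<forall>i j. a \<noteq> arr 2 i j \<and> a \<noteq> arr 3 i j) \<longrightarrow> s' a = s a) \<and>
    (\<forall>x \<in> set xs. inv (fst x) (snd x) s')" for xs s'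
  have "runs W (seqs (map (\<lambda>x. bfs (fst x) (snd x)) pairs)) s (sum_list (map (\<lambda>x. bfs_time x n) pairs) + 1) (I pairs)"
  proof (rule runs_seqs[where I = I])
    fix xs x ys s' assume x: "pairs = xs @ x # ys" and I: "I xs s'"
    obtain i j where ij: "x = (i, j)" by force
    have "(i, j) \<in> set pairs" unfolding x ij by simp
    then have b: "i < 4" "j < 4" "i \<noteq> j" unfolding set_pairs by auto
    have fr: "s' a = s a" if "a \<notin> {4, 5, 6}" "\<And>i j. a \<noteq> arr 2 i j \<and> a \<noteq> arr 3 i j" for a
      using I that unfolding I_def by blast
    have e: "s' 0 = s 0" "s' 1 = s 1" "s' (arr 0 k l) = s (arr 0 k l)" for k l
      by (rule fr; simp add: arr_eq)+
    have "has_input n G s'" using s(1) e by (simp add: has_input_def)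
    moreover have "s' (arr 0 k l) 0 = c k l \<and> c k l < n" if "k < 4" "l < 4" "k \<noteq> l" for k l
      using cn[OF that] e by (simp add: c_def)
    moreover have "n + 2 \<le> W" using W by simp
    ultimately have "runs W (bfs i j) s' (bfs_time (i, j) n) (inv i j)"
      unfolding inv_def using runs_bfs b by blast
    then show "runs W (bfs (fst x) (snd x)) s' (bfs_time x n) (\<lambda>s'. I (xs @ [x]) s')"
      unfolding ij fst_conv snd_conv
    proof (rule runs_frame)
      fix s'' assume f: "\<And>a. a \<notin> writes (bfs i j) \<Longrightarrow> s'' a = s' a" and new: "inv i j s''"
      have "inv (fst y) (snd y) s''" if "y \<in> set (xs @ [(i, j)])" for y
      proof (cases "y = (i, j)")
        case True
        then show ?thesis using new by simp
      next
        case False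
        then have y: "y \<in> set xs" "\<not> (fst y = i \<and> snd y = j)" using that by auto
        have "s'' (arr 2 (fst y) (snd y)) = s' (arr 2 (fst y) (snd y))" "s'' (arr 3 (fst y) (snd y)) = s' (arr 3 (fst y) (snd y))"
          by (rule f; use y(2) in \<open>simp add: writes_bfs arr_eq\<close>)+
        then show ?thesis using I y(1) unfolding I_def inv_def by simp
      qed
      moreover have "s'' a = s a" if "a \<notin> {4, 5, 6}" "\<And>i j. a \<noteq> arr 2 i j \<and> a \<noteq> arr 3 i j" for a
        using f[of a] fr[OF that] that by (simp add: writes_bfs)
      ultimately show "I (xs @ [(i, j)]) s''" unfolding I_def by blast
    qed
  qed (simp add: I_def)
  then have "runs W (seqs (map (\<lambda>x. bfs (fst x) (snd x)) pairs)) s (sum_list (map (\<lambda>x. bfs_time x n) pairs) + 1)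
      (\<lambda>s'. runs W (nest mids try_mids) s' ((try_time n + 72) * Suc n ^ 6) ?Post)"
  proof (rule runs_mono)
    fix s1 assume I: "I pairs s1"
    have fr: "s1 a = s a" if "a \<notin> {4, 5, 6}" "\<And>i j. a \<noteq> arr 2 i j \<and> a \<noteq> arr 3 i j" for a
      using I that unfolding I_def by blast
    have e: "s1 0 = s 0" "s1 1 = s 1" "s1 2 = s 2" "s1 3 = s 3" "s1 (arr 0 k l) = s (arr 0 k l)" for k l
      by (rule fr; simp add: arr_eq)+
    have i1: "inv i j s1" if "i < 4" "j < 4" "i \<noteq> j" for i j
    proof -
      have "(i, j) \<in> set pairs" using that by (simp add: set_pairs)
      then show ?thesis using I unfolding I_def by force
    qed
    have J: "corners_set G n c s1"
      using s i1 e unfolding corners_set_def inv_def has_input_def best_ok_def by (simp add: c_def)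
    have "runs W (nest mids try_mids) s1 ((try_time n + 12 * length mids) * Suc n ^ length mids)
      (\<lambda>s'. corners_set G n c s' \<and> (\<forall>\<tau>. achieved G \<tau> s1 \<longrightarrow> achieved G \<tau> s') \<and>
        (\<forall>\<tau>. length \<tau> = length mids \<longrightarrow> set \<tau> \<subseteq> {..<n} \<longrightarrow>
          achieved G (map (\<lambda>x. c (fst x) (snd x)) pairs @ \<tau>) s'))"
    proof (rule runs_nest)
      show "distinct mids" by (rule distinct_mids)
      show "set mids \<inter> writes try_mids = {}"
      proof -
        have "arr 1 i j \<notin> writes try_mids" for i j
          using writes_try_mids[of "arr 1 i j"] by (auto simp: arr_eq)
        then show ?thesis unfolding disjoint_iff mem_mids by blast
      qed
      show "0 \<notin> set mids" using mem_mids by simp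
      show "0 \<notin> writes try_mids" using writes_try_mids[of 0] by auto
      show "n \<le> W" using W by simp
      show "s 0 0 = n" if "corners_set G n c s" for s using that by (simp add: corners_set_def has_input_def)
      show "corners_set G n c (upd s y 0 v)" if "y \<in> set mids" "corners_set G n c s" for s y v
        by (rule corners_set_cong[OF that(2)]) (use that(1) in \<open>auto simp: mem_mids arr_eq\<close>)
      show "achieved G \<tau> (upd s y 0 v) = achieved G \<tau> s" if "y \<in> set mids" for s y v \<tau>
        by (rule achieved_cong) (use that in \<open>auto simp: mem_mids\<close>)
      show "corners_set G n c s1" by (rule J)
      show "runs W try_mids s (try_time n) (\<lambda>s'. corners_set G n c s' \<and> (\<forall>\<tau>. achieved G \<tau> s \<longrightarrow> achieved G \<tau> s') \<and>
          achieved G (map (\<lambda>x. c (fst x) (snd x)) pairs @ map (\<lambda>x. s x 0) mids) s')"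
        if "corners_set G n c s" "\<And>x. x \<in> set mids \<Longrightarrow> s x 0 < n" for s
        by (rule runs_try_mids_good[OF G W that])
    qed
    then show "runs W (nest mids try_mids) s1 ((try_time n + 72) * Suc n ^ 6) ?Post"
    proof (rule runs_mono)
      show "(try_time n + 12 * length mids) * Suc n ^ length mids \<le> (try_time n + 72) * Suc n ^ 6"
        by (simp add: length_mids)
      fix s' assume "corners_set G n c s' \<and> (\<forall>\<tau>. achieved G \<tau> s1 \<longrightarrow> achieved G \<tau> s') \<and>
        (\<forall>\<tau>. length \<tau> = length mids \<longrightarrow> set \<tau> \<subseteq> {..<n} \<longrightarrow>
          achieved G (map (\<lambda>x. c (fst x) (snd x)) pairs @ \<tau>) s')"
      then show "?Post s'"
        unfolding pre length_mids corners_set_def achieved_cong[of s1 s, OF e(3)] by blast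
    qed
  qed simp
  from runs_Seq[OF this] show ?thesis unfolding try_corners_def bfs_times .
qed

lemma runs_search:
  assumes G: "simple_graph G" "\<not> contains_odd_hole G" "verts G = {..<n}" and W: "12 * n + 30 \<le> W"
  shows "runs W search (input n G) ((bfs_const + try_const + 217) * Suc n ^ 20) (\<lambda>s'. best_ok G n s' \<and>
      (\<forall>\<tau>. length \<tau> = 18 \<longrightarrow> set \<tau> \<subseteq> {..<n} \<longrightarrow> achieved G \<tau> s'))"
proof -
  let ?J = "\<lambda>s. has_input n G s \<and> best_ok G n s"
  \<comment> \<open>For the twelve outer loops, a choice of ends is settled once all its extensions
    by six middle vertices are.\<close>
  define A where "A \<tau> s \<longleftrightarrow> (\<forall>\<sigma>. length \<sigma> = 6 \<longrightarrow> set \<sigma> \<subseteq> {..<n} \<longrightarrow> achieved G (\<tau> @ \<sigma>) s)" for \<tau> s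
  let ?t = "bfs_const * Suc n ^ 3 + 1 + (try_time n + 72) * Suc n ^ 6"
  have wr: "a \<in> {2, 3, 4, 5, 6, 7, 8} \<or> (\<exists>t i j. t \<in> {1, 2, 3, 4, 5} \<and> a = arr t i j)" if a: "a \<in> writes try_corners" for a
  proof -
    have "writes (seqs (map (\<lambda>x. bfs (fst x) (snd x)) pairs)) \<subseteq> (\<Union>x\<in>set pairs. writes (bfs (fst x) (snd x)))"
      by (simp add: writes_seqs)
    then consider "a \<in> writes try_mids" | "a \<in> set mids" | x where "a \<in> writes (bfs (fst x) (snd x))"
      using a unfolding try_corners_def writes.simps writes_nest by blast
    then show ?thesis
    proof cases
      case 1
      then show ?thesis using writes_try_mids[of a] by blast
    next
      case 2
      then show ?thesis unfolding mem_mids by blast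
    next
      case 3
      then show ?thesis unfolding writes_bfs by blast
    qed
  qed
  have "runs W (nest corners try_corners) (input n G) ((?t + 12 * length corners) * Suc n ^ length corners)
      (\<lambda>s'. ?J s' \<and> (\<forall>\<tau>. A \<tau> (input n G) \<longrightarrow> A \<tau> s') \<and>
        (\<forall>\<tau>. length \<tau> = length corners \<longrightarrow> set \<tau> \<subseteq> {..<n} \<longrightarrow> A ([] @ \<tau>) s'))"
  proof (rule runs_nest)
    show "distinct corners" by (rule distinct_corners)
    show "set corners \<inter> writes try_corners = {}"
    proof -
      have "arr 0 i j \<notin> writes try_corners" for i j
        using wr[of "arr 0 i j"] by (auto simp: arr_eq)
      then show ?thesis unfolding disjoint_iff mem_corners by blast
    qed
    show "0 \<notin> set corners" using mem_corners by simp
    show "0 \<notin> writes try_corners" using wr[of 0] by auto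
    show "n \<le> W" using W by simp
    show "s 0 0 = n" if "?J s" for s using that by (simp add: has_input_def)
    show "?J (upd s y 0 v)" if "y \<in> set corners" "?J s" for s y v
    proof -
      have "upd s y 0 v a = s a" if "a < 10" for a using \<open>y \<in> set corners\<close> that by (auto simp: mem_corners)
      then show ?thesis using that(2) by (simp add: has_input_def best_ok_def)
    qed
    show "A \<tau> (upd s y 0 v) = A \<tau> s" if "y \<in> set corners" for s y v \<tau>
    proof -
      have "upd s y 0 v 2 = s 2" using that by (auto simp: mem_corners)
      then show ?thesis unfolding A_def by (simp only: achieved_cong[of "upd s y 0 v" s])
    qed
    show "?J (input n G)"
      by (simp add: has_input_def best_ok_def input_def)
    show "runs W try_corners s ?t (\<lambda>s'. ?J s' \<and> (\<forall>\<tau>. A \<tau> s \<longrightarrow> A \<tau> s') \<and> A ([] @ map (\<lambda>x. s x 0) corners) s')"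
      if "?J s" "\<And>x. x \<in> set corners \<Longrightarrow> s x 0 < n" for s
    proof -
      have "has_input n G s" "best_ok G n s" using that(1) by simp_all
      from runs_try_corners[OF G W this that(2)] show ?thesis
        by (rule runs_mono) (simp_all add: A_def)
    qed
  qed
  then show ?thesis unfolding search_def
  proof (rule runs_mono)
    let ?N = "Suc n"
    \<comment> \<open>Each trial is quadratic, so the six inner loops give exponent 8 and the twelve
      outer ones 20. The constant 217 is 72 from the inner overhead plus 145, namely 144 from the
      outer overhead and the 1 in \<open>?t\<close>.\<close>
    have "(try_time n + 72) * ?N ^ 6 \<le> (try_const * ?N ^ 2 + 72 * ?N ^ 2) * ?N ^ 6"
      by (intro mult_le_mono1 add_le_mono try_time_le) simp
    also have "\<dots> = (try_const + 72) * ?N ^ 8"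
      unfolding add_mult_distrib mult.assoc power_add[symmetric] by simp
    finally have a: "(try_time n + 72) * ?N ^ 6 \<le> (try_const + 72) * ?N ^ 8" .
    have "?N ^ 3 \<le> ?N ^ 8" by (rule power_increasing) simp_all
    then have b: "bfs_const * ?N ^ 3 \<le> bfs_const * ?N ^ 8" by (rule mult_le_mono2)
    have c: "145 * 1 \<le> 145 * ?N ^ 8" by (intro mult_le_mono2) simp
    have "?t + 144 \<le> (bfs_const + try_const + 217) * ?N ^ 8"
      using a b c unfolding add_mult_distrib by linarith
    then have "(?t + 144) * ?N ^ 12 \<le> (bfs_const + try_const + 217) * ?N ^ 8 * ?N ^ 12" by (rule mult_le_mono1)
    also have "\<dots> = (bfs_const + try_const + 217) * ?N ^ 20"
      unfolding mult.assoc power_add[symmetric] by simp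
    finally show "(?t + 12 * length corners) * ?N ^ length corners \<le> (bfs_const + try_const + 217) * ?N ^ 20"
      unfolding length_corners by simp
    fix s' assume s': "?J s' \<and> (\<forall>\<tau>. A \<tau> (input n G) \<longrightarrow> A \<tau> s') \<and>
        (\<forall>\<tau>. length \<tau> = length corners \<longrightarrow> set \<tau> \<subseteq> {..<n} \<longrightarrow> A ([] @ \<tau>) s')"
    have "achieved G \<tau> s'" if \<tau>: "length \<tau> = 18" "set \<tau> \<subseteq> {..<n}" for \<tau>
    proof -
      have "A (take 12 \<tau>) s'"
        using s' \<tau> set_take_subset[of 12 \<tau>] by (simp add: length_corners)
      then have "achieved G (take 12 \<tau> @ drop 12 \<tau>) s'"
      proof -
        have "length (drop 12 \<tau>) = 6" "set (drop 12 \<tau>) \<subseteq> {..<n}"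
          using \<tau> set_drop_subset[of 12 \<tau>] by auto
        then show ?thesis using \<open>A (take 12 \<tau>) s'\<close> unfolding A_def by blast
      qed
      then show ?thesis by simp
    qed
    then show "best_ok G n s' \<and> (\<forall>\<tau>. length \<tau> = 18 \<longrightarrow> set \<tau> \<subseteq> {..<n} \<longrightarrow> achieved G \<tau> s')"
      using s' by blast
  qed
qed

text \<open>If there is any structure, there is a smallest one, and the list of its ends and middle
  vertices is among the guesses; having been achieved, it bounds the recorded size.\<close>

lemma least_K4_achieved:
  assumes G: "simple_graph G" "verts G = {..<n}"
    and all: "\<forall>\<tau>. length \<tau> = 18 \<longrightarrow> set \<tau> \<subseteq> {..<n} \<longrightarrow> achieved G \<tau> s"
    and Q: "sym_rel.K4_paths (adj G) Q" "K4_size Q \<noteq> 6"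
  shows "s 2 0 \<noteq> 0 \<and> s 2 0 \<le> K4_size Q"
proof -
  interpret sym_rel "adj G" by (rule sym_rel_adj[OF G(1)])
  let ?P = "\<lambda>R. K4_paths R \<and> K4_size R \<noteq> 6"
  obtain R where R: "?P R" "\<And>R'. ?P R' \<Longrightarrow> K4_size R \<le> K4_size R'"
    using ex_has_least_nat[of ?P Q K4_size] Q by blast
  have KR: "K4_paths R" using R(1) by simp
  have least: "least_K4 R" unfolding least_K4_def using R by blast
  \<comment> \<open>If \<open>R i j\<close> has an even number of vertices, the two positions differ
    by one; the larger one still satisfies \<open>2 * a i j \<le> length (R i j)\<close>, which is
    why \<open>half_path\<close> allows equality there.\<close>
  define a where "a i j = (if i < j then (length (R i j) - 1) div 2 else length (R i j) - 1 - (length (R i j) - 1) div 2)" for i j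
  have a: "Suc (a i j + a j i) = length (R i j) \<and> 2 * a i j \<le> length (R i j)" if ij: "i < 4" "j < 4" "i \<noteq> j" for i j
  proof -
    have L: "length (R j i) = length (R i j)" by (rule K4_length[OF KR ij])
    obtain M where M: "length (R i j) = Suc M" using K4_pos[OF KR ij] by (cases "length (R i j)") simp_all
    have m: "M div 2 \<le> M" "2 * (M div 2) \<le> M" "M \<le> Suc (2 * (M div 2))" by simp_all
    show ?thesis
    proof (cases "i < j")
      case True
      then have "a i j = M div 2" "a j i = M - M div 2" using L M by (simp_all add: a_def)
      then show ?thesis using m M by simp
    next
      case False
      then have "a j i = M div 2" "a i j = M - M div 2" using ij(3) L M by (simp_all add: a_def)
      then show ?thesis using m M by simp
    qed
  qed
  define \<tau> where "\<tau> = map (\<lambda>x. hd (R (fst x) (snd x))) pairs @ map (\<lambda>x. R (fst x) (snd x) ! a (fst x) (snd x)) up_pairs"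
  have V: "K4_verts R \<subseteq> {..<n}" using K4_verts_subset[OF G(1) KR] G(2) by simp
  have "good G \<tau> (K4_size R)"
    unfolding good_def
    by (rule exI[where x = R], rule exI[where x = a], intro conjI least refl \<tau>_def allI impI; rule a[THEN conjunct1] a[THEN conjunct2])
  moreover have "set \<tau> \<subseteq> {..<n}"
  proof -
    have mem: "R i j ! k \<in> {..<n}" if "i < 4" "j < 4" "i \<noteq> j" "k < length (R i j)" for i j k
    proof (rule subsetD[OF V])
      show "R i j ! k \<in> K4_verts R" unfolding in_K4_verts using that by metis
    qed
    have "hd (R i j) \<in> {..<n} \<and> R i j ! a i j \<in> {..<n}" if ij: "i < 4" "j < 4" "i \<noteq> j" for i j
    proof -
      have L: "0 < length (R i j)" using K4_pos[OF KR ij] by linarith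
      then have "a i j < length (R i j)" using a[OF ij] by linarith
      moreover have "hd (R i j) = R i j ! 0" using L by (simp add: hd_conv_nth)
      ultimately show ?thesis using mem[OF ij L] mem[OF ij] by simp
    qed
    moreover have "fst x < 4 \<and> snd x < 4 \<and> fst x \<noteq> snd x" if "x \<in> set pairs \<union> set up_pairs" for x
      using that set_pairs[of "fst x" "snd x"] set_up_pairs[of "fst x" "snd x"] by auto
    ultimately have "hd (R (fst x) (snd x)) \<in> {..<n} \<and> R (fst x) (snd x) ! a (fst x) (snd x) \<in> {..<n}"
      if "x \<in> set pairs \<union> set up_pairs" for x
      using that by metis
    then show ?thesis unfolding \<tau>_def by (simp add: image_subset_iff)
  qed
  moreover have "length \<tau> = 18" by (simp add: \<tau>_def pairs_def up_pairs_def)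
  ultimately have "s 2 0 \<noteq> 0 \<and> s 2 0 \<le> K4_size R" using all unfolding achieved_def by blast
  moreover have "K4_size R \<le> K4_size Q" using R(2) Q by blast
  ultimately show ?thesis by simp
qed

text \<open>By \<open>least_K4_achieved\<close> the recorded size is a lower bound for all
  solutions, and by \<open>best_ok\<close> it is attained; \<open>card_K4_verts\<close> turns sizes
  into numbers of vertices.\<close>

lemma answer_correct:
  assumes G: "simple_graph G" "\<not> contains_odd_hole G" "verts G = {..<n}" and best: "best_ok G n s"
    and all: "\<forall>\<tau>. length \<tau> = 18 \<longrightarrow> set \<tau> \<subseteq> {..<n} \<longrightarrow> achieved G \<tau> s"
  shows "if \<not> (\<exists>X \<subseteq> verts G. is_line_graph_of_bip_subdiv_K4 (induced G X))
            then answer n s = None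
            else (\<exists>X \<subseteq> verts G. answer n s = Some X \<and>
                    is_line_graph_of_bip_subdiv_K4 (induced G X) \<and>
                    (\<forall>Y \<subseteq> verts G. is_line_graph_of_bip_subdiv_K4 (induced G Y) \<longrightarrow>
                       card X \<le> card Y))"
proof -
  interpret sym_rel "adj G" by (rule sym_rel_adj[OF G(1)])
  have lower: "s 2 0 \<noteq> 0 \<and> s 2 0 \<le> card Y" if lg: "is_line_graph_of_bip_subdiv_K4 (induced G Y)" for Y
  proof -
    obtain Q where Q: "K4_paths Q" "K4_size Q \<noteq> 6" "K4_verts Q = Y"
      using K4_paths_of_line_graph[OF G(1) lg] .
    then show ?thesis using least_K4_achieved[OF G(1,3) all Q(1,2)] card_K4_verts[OF Q(1)] by simp
  qed
  show ?thesis
  proof (cases "s 2 0 = 0")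
    case True
    then have "\<not> is_line_graph_of_bip_subdiv_K4 (induced G X)" for X using lower by blast
    then show ?thesis using True by (simp add: answer_def)
  next
    case False
    then have "\<exists>R. K4_paths R \<and> K4_size R \<noteq> 6 \<and> K4_size R = s 2 0 \<and> {v. v < n \<and> s 3 v \<noteq> 0} = K4_verts R"
      using best unfolding best_ok_def by simp
    then obtain R where R: "K4_paths R" "K4_size R \<noteq> 6" "K4_size R = s 2 0" "{v. v < n \<and> s 3 v \<noteq> 0} = K4_verts R"
      by (elim exE conjE)
    have X: "is_line_graph_of_bip_subdiv_K4 (induced G (K4_verts R))" by (rule line_graph_of_K4_paths[OF G(1,2) R(1,2)])
    have "K4_verts R \<subseteq> verts G" by (rule K4_verts_subset[OF G(1) R(1)])
    moreover have "answer n s = Some (K4_verts R)" using False R(4) by (simp add: answer_def)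
    moreover have "card (K4_verts R) \<le> card Y" if "is_line_graph_of_bip_subdiv_K4 (induced G Y)" for Y
      using lower[OF that] card_K4_verts[OF R(1)] R(3) by simp
    ultimately show ?thesis using X by auto
  qed
qed

lemma Suc_power_bigo: "(\<lambda>n. real (k * Suc n ^ d)) \<in> O(\<lambda>n. real n ^ d)"
proof (rule bigoI)
  show "\<forall>\<^sub>F n in sequentially. norm (real (k * Suc n ^ d)) \<le> real k * 2 ^ d * norm (real n ^ d)"
  proof (rule eventually_sequentiallyI)
    fix n :: nat assume "1 \<le> n"
    then have "real (Suc n) ^ d \<le> (2 * real n) ^ d" by (intro power_mono) simp_all
    then have "real k * real (Suc n) ^ d \<le> real k * (2 * real n) ^ d" by (rule mult_left_mono) simp
    then show "norm (real (k * Suc n ^ d)) \<le> real k * 2 ^ d * norm (real n ^ d)"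
      by (simp add: power_mult_distrib mult.assoc del: of_nat_Suc)
  qed
qed

theorem mainTheorem13:
  "\<exists>(P :: prog) (T :: nat \<Rightarrow> nat) (W :: nat \<Rightarrow> nat) (d :: nat).
     (\<lambda>n. real (T n)) \<in> O(\<lambda>n. real n ^ 20) \<and>
     (\<lambda>n. real (W n)) \<in> O(\<lambda>n. real n ^ d) \<and>
     (\<forall>(n :: nat) (G :: nat graph).
        simple_graph G \<and> verts G = {..<n} \<and> \<not> contains_odd_hole G \<longrightarrow>
        (\<exists>t s. exec (W n) P (input n G) t s \<and> t \<le> T n \<and>
           (if \<not> (\<exists>X \<subseteq> verts G. is_line_graph_of_bip_subdiv_K4 (induced G X))
            then answer n s = None
            else (\<exists>X \<subseteq> verts G. answer n s = Some X \<and>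
                    is_line_graph_of_bip_subdiv_K4 (induced G X) \<and>
                    (\<forall>Y \<subseteq> verts G. is_line_graph_of_bip_subdiv_K4 (induced G Y) \<longrightarrow>
                       card X \<le> card Y)))))"
proof (rule exI[where x = search], rule exI[where x = "\<lambda>n. (bfs_const + try_const + 217) * Suc n ^ 20"],
    rule exI[where x = "\<lambda>n. 30 * Suc n ^ 1"], rule exI[where x = 1], intro conjI allI impI)
  fix n :: nat and G :: "nat graph"
  assume "simple_graph G \<and> verts G = {..<n} \<and> \<not> contains_odd_hole G"
  then have G: "simple_graph G" "\<not> contains_odd_hole G" "verts G = {..<n}" by simp_all
  \<comment> \<open>Linear words suffice, so the exponent \<open>d\<close> is 1.\<close>
  have "12 * n + 30 \<le> 30 * Suc n ^ 1" by simp
  from runs_search[OF G this] obtain t s where "exec (30 * Suc n ^ 1) search (input n G) t s"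
    "t \<le> (bfs_const + try_const + 217) * Suc n ^ 20" "best_ok G n s"
    "\<forall>\<tau>. length \<tau> = 18 \<longrightarrow> set \<tau> \<subseteq> {..<n} \<longrightarrow> achieved G \<tau> s"
    unfolding runs_def by blast
  with answer_correct[OF G this(3,4)]
  show "\<exists>t s. exec (30 * Suc n ^ 1) search (input n G) t s \<and> t \<le> (bfs_const + try_const + 217) * Suc n ^ 20 \<and>
           (if \<not> (\<exists>X \<subseteq> verts G. is_line_graph_of_bip_subdiv_K4 (induced G X))
            then answer n s = None
            else (\<exists>X \<subseteq> verts G. answer n s = Some X \<and>
                    is_line_graph_of_bip_subdiv_K4 (induced G X) \<and>
                    (\<forall>Y \<subseteq> verts G. is_line_graph_of_bip_subdiv_K4 (induced G Y) \<longrightarrow>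
                       card X \<le> card Y)))"
    by blast
qed (rule Suc_power_bigo)+

end
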